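(* Let $A$ and $B$ be real $n\times n$ matrices whose eigenvalues all have positive real parts, and let $G_A$ and $G_B$ be equipped with arbitrary admissible metrics. Denote by $\lambda_1$ and $\mu_1$ the smallest real parts of the eigenvalues of $A$ and $B$ respectively, and set $\epsilon=\lambda_1/\mu_1$. If the real part Jordan form of $A$ is not a multiple of the identity matrix $I_n$, then for every $\eta$-quasisymmetric map $F:(\mathbb R^n,D_A)\to(\mathbb R^n,D_B)$, the map $F:(\mathbb R^n,D_A^\epsilon)\to(\mathbb R^n,D_B)$ is a $K$-quasisimilarity, where $K$ depends only on $\eta$, $A$, $B$ and the metrics on $G_A$, $G_B$ (and not on $F$).
   Context: For a real $n\times n$ matrix $A$ whose eigenvalues all have positive real parts, $G_A=\mathbb R^n\rtimes_A\mathbb R$ is the Lie group with group law $(x_1,t_1)\cdot(x_2,t_2)=(x_1+e^{t_1A}x_2,\,t_1+t_2)$. An admissible metric on $G_A$ is a left invariant Riemannian metric for which the $\mathbb R$ direction is perpendicular to the $\mathbb R^n$ factor; the standard metric is the left invariant metric given by the standard inner product at the identity $(0,0)$. Parabolic visual quasimetric: let $\|\cdot\|$ be the norm on $\mathbb R^n$ given by the admissible inner product at the identity (the Euclidean norm for the standard metric). The distance induced on $\mathbb R^n\times\{t\}\subset G_A$ is $d_{A,t}((x,t),(y,t))=\|e^{-tA}(x-y)\|$. For $x\ne y$ in $\mathbb R^n$, $D_A(x,y)=e^t$ where $t$ is the smallest real number with $\|e^{-tA}(x-y)\|=1$; $D_A(x,x)=0$. This is a quasimetric on $\mathbb R^n$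 (symmetric, nonnegative, zero exactly on the diagonal, and $D_A(x,z)\le M(D_A(x,y)+D_A(y,z))$ for some constant $M\ge1$). $D_B$ is defined likewise from $G_B$. $D_A^\epsilon(x,y)=(D_A(x,y))^\epsilon$. Real part Jordan form of $A$: the matrix obtained from the (complex) Jordan form of $A$ by replacing each diagonal entry by its real part and reordering the blocks to make it canonical. A bijection $F:X\to Y$ between quasimetric spaces is $\eta$-quasisymmetric, for a homeomorphism $\eta:[0,\infty)\to[0,\infty)$, if $\frac{\rho(F(x),F(y))}{\rho(F(x),F(z))}\le\eta\left(\frac{\rho(x,y)}{\rho(x,z)}\right)$ for all distinct triples $x,y,z\in X$. For $K\ge1$, a bijection $F:X\to Y$ is a $K$-quasisimilarity if there is a constant $C>0$ such that $\frac CK\rho(x,y)\le\rho(F(x),F(y))\le CK\rho(x,y)$ for all $x,y\in X$. *)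

theory Defs
  imports
    "HOL-Analysis.Analysis"
    "Jordan_Normal_Form.Jordan_Normal_Form_Existence"
    "Jordan_Normal_Form.Spectral_Radius"
begin

hide_const (open) Matrix.mat Matrix.vec Matrix.vec_index Determinant.det
no_notation Matrix.vec_index (infixl \<open>$\<close> 100)

definition matrix_exp :: "real^'n^'n \<Rightarrow> real^'n^'n" where
  "matrix_exp A = (\<Sum>k. (((**) A ^^ k) (Finite_Cartesian_Product.mat 1)) /\<^sub>R fact k)"

text \<open>A real matrix, viewed as a complex matrix in the sense of the entry Jordan_Normal_Form;
  the finite index type is enumerated by \<^const>\<open>from_nat_into\<close>. Eigenvalues and Jordan form do
  not depend on the enumeration.\<close>

definition complex_mat :: "real^'n^'n \<Rightarrow> complex mat" where
  "complex_mat A = Matrix.mat CARD('n) CARD('n)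
     (\<lambda>(i, j). complex_of_real (A $ from_nat_into UNIV i $ from_nat_into UNIV j))"

definition min_eigenvalue_Re :: "real^'n^'n \<Rightarrow> real" where
  "min_eigenvalue_Re A = Min (Re ` spectrum (complex_mat A))"

text \<open>A Jordan form is given by its list of blocks (size, eigenvalue). The canonical order is by
  increasing diagonal entry, and by increasing size among blocks with the same diagonal entry;
  \<^const>\<open>sort_key\<close> is stable. As the Jordan form is unique up to the order of the blocks,
  the result does not depend on the choice made by \<open>SOME\<close>.\<close>

definition real_part_jordan_form :: "real^'n^'n \<Rightarrow> real mat" where
  "real_part_jordan_form A = jordan_matrix (sort_key snd (sort_key fst
     (map (\<lambda>(k, c). (k, Re c)) (SOME n_as. jordan_nf (complex_mat A) n_as))))"

text \<open>The group law of \<open>\<real>\<^sup>n \<rtimes>\<^sub>A \<real>\<close>.\<close>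

definition G_mult :: "real^'n^'n \<Rightarrow> (real^'n) \<times> real \<Rightarrow> (real^'n) \<times> real \<Rightarrow> (real^'n) \<times> real" where
  "G_mult A p q = (fst p + matrix_exp (snd p *\<^sub>R A) *v fst q, snd p + snd q)"

definition is_inner_product :: "('a::real_vector \<Rightarrow> 'a \<Rightarrow> real) \<Rightarrow> bool" where
  "is_inner_product b \<longleftrightarrow> bilinear b \<and> (\<forall>v w. b v w = b w v) \<and> (\<forall>v. v \<noteq> 0 \<longrightarrow> b v v > 0)"

text \<open>A Riemannian metric on the manifold \<open>\<real>\<^sup>n \<times> \<real>\<close> is given by an inner product \<open>g p\<close> on the
  tangent space at each point \<open>p\<close>, which is again \<open>\<real>\<^sup>n \<times> \<real>\<close>. Smoothness in \<open>p\<close> need not be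
  required, because it follows from left invariance: the differential of the left translation
  by \<open>(x, t)\<close> is the constant map \<open>(v, s) \<mapsto> (e\<^sup>t\<^sup>A v, s)\<close>, which is smooth in \<open>t\<close>.\<close>

definition left_invariant_metric ::
    "real^'n^'n \<Rightarrow> ((real^'n) \<times> real \<Rightarrow> (real^'n) \<times> real \<Rightarrow> (real^'n) \<times> real \<Rightarrow> real) \<Rightarrow> bool" where
  "left_invariant_metric A g \<longleftrightarrow>
     (\<forall>p. is_inner_product (g p)) \<and>
     (\<forall>p q v w. g (G_mult A p q)
                  (frechet_derivative (G_mult A p) (at q) v)
                  (frechet_derivative (G_mult A p) (at q) w) = g q v w)"

definition admissible_metric ::
    "real^'n^'n \<Rightarrow> ((real^'n) \<times> real \<Rightarrow> (real^'n) \<times> real \<Rightarrow> (real^'n) \<times> real \<Rightarrow> real) \<Rightarrow> bool" where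
  "admissible_metric A g \<longleftrightarrow>
     left_invariant_metric A g \<and> (\<forall>p x t. g p (x, 0) (0, t) = 0)"

definition metric_norm ::
    "((real^'n) \<times> real \<Rightarrow> (real^'n) \<times> real \<Rightarrow> (real^'n) \<times> real \<Rightarrow> real) \<Rightarrow> real^'n \<Rightarrow> real" where
  "metric_norm g x = sqrt (g (0, 0) (x, 0) (x, 0))"

text \<open>The distance induced on the slice \<open>\<real>\<^sup>n \<times> {t}\<close>, between \<open>(x, t)\<close> and \<open>(y, t)\<close>.\<close>

definition slice_dist ::
    "real^'n^'n \<Rightarrow> ((real^'n) \<times> real \<Rightarrow> (real^'n) \<times> real \<Rightarrow> (real^'n) \<times> real \<Rightarrow> real) \<Rightarrow>
     real \<Rightarrow> real^'n \<Rightarrow> real^'n \<Rightarrow> real" where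
  "slice_dist A g t x y = metric_norm g (matrix_exp ((- t) *\<^sub>R A) *v (x - y))"

text \<open>The parabolic visual quasimetric \<open>D\<^sub>A\<close>. The least \<open>t\<close> exists if \<open>x \<noteq> y\<close>, the eigenvalues
  of \<open>A\<close> have positive real parts and \<open>g\<close> is admissible: the slice distance is then continuous
  in \<open>t\<close>, tends to \<open>0\<close> as \<open>t \<rightarrow> \<infinity>\<close> and to \<open>\<infinity>\<close> as \<open>t \<rightarrow> -\<infinity>\<close>.\<close>

definition visual_quasimetric ::
    "real^'n^'n \<Rightarrow> ((real^'n) \<times> real \<Rightarrow> (real^'n) \<times> real \<Rightarrow> (real^'n) \<times> real \<Rightarrow> real) \<Rightarrow>
     real^'n \<Rightarrow> real^'n \<Rightarrow> real" where
  "visual_quasimetric A g x y =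
     (if x = y then 0 else exp (LEAST t. slice_dist A g t x y = 1))"

definition quasisymmetric ::
    "(real \<Rightarrow> real) \<Rightarrow> ('a \<Rightarrow> 'a \<Rightarrow> real) \<Rightarrow> ('b \<Rightarrow> 'b \<Rightarrow> real) \<Rightarrow> ('a \<Rightarrow> 'b) \<Rightarrow> bool" where
  "quasisymmetric \<eta> \<rho> \<sigma> F \<longleftrightarrow>
     (\<exists>\<theta>. homeomorphism {0..} {0..} \<eta> \<theta>) \<and> bij F \<and>
     (\<forall>x y z. distinct [x, y, z] \<longrightarrow>
        \<sigma> (F x) (F y) / \<sigma> (F x) (F z) \<le> \<eta> (\<rho> x y / \<rho> x z))"

definition quasisimilarity ::
    "real \<Rightarrow> ('a \<Rightarrow> 'a \<Rightarrow> real) \<Rightarrow> ('b \<Rightarrow> 'b \<Rightarrow> real) \<Rightarrow> ('a \<Rightarrow> 'b) \<Rightarrow> bool" where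
  "quasisimilarity K \<rho> \<sigma> F \<longleftrightarrow>
     K \<ge> 1 \<and> bij F \<and>
     (\<exists>C>0. \<forall>x y. C / K * \<rho> x y \<le> \<sigma> (F x) (F y) \<and> \<sigma> (F x) (F y) \<le> C * K * \<rho> x y)"

end

theory Submission imports Defs begin

text \<open>Let \<open>\<rho>\<^sub>A(v) = D\<^sub>A(v, 0)\<close>, so that \<open>\<rho>\<^sub>A(e\<^sup>t\<^sup>A v) = e\<^sup>t \<rho>\<^sub>A(v)\<close>. Let \<open>k + 1\<close> be the largest size of
  a Jordan block whose eigenvalue has the minimal real part \<open>\<lambda>\<^sub>1\<close>, and let \<open>H\<^sub>A\<close> be spanned by the
  eigenvectors at the start of such blocks. On \<open>H\<^sub>A\<close>, \<open>\<rho>\<^sub>A\<close> to the power \<open>\<lambda>\<^sub>1\<close> is comparable to a norm.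

  First, a quasisymmetric \<open>F\<close> maps cosets of \<open>H\<^sub>A\<close> onto cosets of \<open>H\<^sub>B\<close>, by a length-volume argument.
  Since \<open>D\<^sub>A\<close>-balls of radius \<open>e\<^sup>-\<^sup>T\<close> are elongated along \<open>H\<^sub>A\<close>, a unit segment in \<open>H\<^sub>A\<close> is followed by a
  chain of about \<open>e\<close> to the power \<open>\<lambda>\<^sub>1 T\<close>, divided by \<open>T\<^sup>k\<close>, steps of this size. The chains through
  the points of a lattice have images of finite total volume; if \<open>\<phi>\<close> is a functional that distinguishes
  the images of the ends of the segment, Hoelder's inequality bounds \<open>\<lambda>\<^sub>1 / tr A\<close> from below
  by \<open>\<mu>\<^sub>1 / tr B\<close>. Applied to \<open>F\<close> and its inverse, this gives equality; then in the same way equality of the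
  numbers \<open>k\<close>, and finally that \<open>\<phi>\<close> does not vanish on \<open>H\<^sub>B\<close>.

  Secondly, \<open>H\<^sub>A\<close> is a proper subspace by hypothesis, so a point has nearby cosets at every distance, and the
  distance between the points of one coset and another coset is constant. Hence the distortion of \<open>F\<close> at
  a given scale is the same along a coset. Adding up steps of equal size along a coset shows that the quotient
  of \<open>D\<^sub>B(F x, F y)\<close> to the power \<open>\<mu>\<^sub>1\<close> by \<open>D\<^sub>A(x, y)\<close> to the power \<open>\<lambda>\<^sub>1\<close> depends only on \<open>x\<close>, up to
  a bounded factor; being symmetric in \<open>x\<close> and \<open>y\<close>, it is then constant up to a bounded factor.\<close>

text \<open>The obstacle is that \<open>F\<close> is only known to be continuous: it has no
  derivative and need not be rectifiable along lines. All lengths and volumes are therefore finite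
  sums at one scale \<open>exp (- T)\<close>. The balance behind the volume argument is this. About
  \<open>exp (T * tr A)\<close> chains start near 0, and for each position in a chain every lattice
  point is used at most once. A step with image size \<open>r\<close> occupies volume of order
  \<open>r powr tr B\<close>, but it moves the functional by at most \<open>r\<close> to the power
  \<open>\<mu>\<^sub>1\<close> times a power of \<open>- ln r\<close>. This logarithm is what makes
  the numbers \<open>k\<close> comparable; it can be replaced by \<open>T\<close> because image
  steps shrink at most exponentially in \<open>T\<close>. The trace enters only as the exponent of
  volume growth. Everything except the construction of \<open>H\<close> concerns abstract flows, so
  that the two sides exchange roles by instantiation. The maps are quantified after the constants,
  which is why \<open>K\<close> does not depend on \<open>F\<close>. A delicate point of the
  construction is that \<open>H\<close> has to be real while the Jordan basis is complex; it is
  settled by describing the complex space through limits of the flow.\<close>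

lemmas cart_eq_iff = Finite_Cartesian_Product.vec_eq_iff

section \<open>Volume scaling of linear maps\<close>

text \<open>The library computes the measure of a linear image only for well-ordered index types.
  The type below is a well-ordered copy of an arbitrary finite index type.\<close>

typedef 'a ordered_copy = "UNIV :: 'a set" by simp

lemma bij_Rep_ordered_copy: "bij Rep_ordered_copy"
  by (metis Abs_ordered_copy_inverse Rep_ordered_copy_inverse UNIV_I bijI')

lemma bij_Abs_ordered_copy: "bij Abs_ordered_copy"
  by (metis Abs_ordered_copy_inverse Rep_ordered_copy_inverse UNIV_I bijI')

instance ordered_copy :: (finite) finite
proof
  have "range (Abs_ordered_copy :: 'a \<Rightarrow> 'a ordered_copy) = UNIV"
    using bij_Abs_ordered_copy by (rule bij_is_surj)
  then show "finite (UNIV :: 'a ordered_copy set)"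
    by (metis finite finite_imageI)
qed

instantiation ordered_copy :: (finite) wellorder
begin

definition index_ordered_copy :: "'a ordered_copy \<Rightarrow> nat" where
  "index_ordered_copy x = to_nat_on UNIV (Rep_ordered_copy x)"

definition less_eq_ordered_copy :: "'a ordered_copy \<Rightarrow> 'a ordered_copy \<Rightarrow> bool" where
  "less_eq_ordered_copy x y \<longleftrightarrow> index_ordered_copy x \<le> index_ordered_copy y"

definition less_ordered_copy :: "'a ordered_copy \<Rightarrow> 'a ordered_copy \<Rightarrow> bool" where
  "less_ordered_copy x y \<longleftrightarrow> index_ordered_copy x < index_ordered_copy y"

instance
proof
  fix x y z :: "'a ordered_copy"
  show "x < y \<longleftrightarrow> x \<le> y \<and> \<not> y \<le> x"
    by (auto simp: less_eq_ordered_copy_def less_ordered_copy_def)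
  show "x \<le> x" by (simp add: less_eq_ordered_copy_def)
  show "x \<le> y \<Longrightarrow> y \<le> z \<Longrightarrow> x \<le> z" by (simp add: less_eq_ordered_copy_def)
  have "inj_on (to_nat_on UNIV) (UNIV :: 'a set)"
    by (rule inj_on_to_nat_on) (simp add: countable_finite)
  then show "x \<le> y \<Longrightarrow> y \<le> x \<Longrightarrow> x = y"
    by (metis Rep_ordered_copy_inject UNIV_I dual_order.antisym index_ordered_copy_def inj_on_def less_eq_ordered_copy_def)
  show "x \<le> y \<or> y \<le> x" by (auto simp: less_eq_ordered_copy_def)
next
  fix P :: "'a ordered_copy \<Rightarrow> bool" and a
  assume step: "\<And>x. (\<And>y. y < x \<Longrightarrow> P y) \<Longrightarrow> P x"
  have "\<forall>a. index_ordered_copy a = m \<longrightarrow> P a" for m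
  proof (induction m rule: less_induct)
    case (less m)
    show ?case
    proof (intro allI impI)
      fix a :: "'a ordered_copy" assume a: "index_ordered_copy a = m"
      show "P a"
      proof (rule step)
        fix y assume "y < a"
        then have "index_ordered_copy y < m" by (simp add: less_ordered_copy_def a)
        then show "P y" using less.IH by blast
      qed
    qed
  qed
  then show "P a" by blast
qed

end

definition to_ordered :: "real^'n \<Rightarrow> real^('n ordered_copy)" where
  "to_ordered v = (\<chi> i. v $ Rep_ordered_copy i)"

definition from_ordered :: "real^('n ordered_copy) \<Rightarrow> real^'n" where
  "from_ordered v = (\<chi> i. v $ Abs_ordered_copy i)"

lemma from_to_ordered [simp]: "from_ordered (to_ordered v) = v"
  by (simp add: from_ordered_def to_ordered_def Abs_ordered_copy_inverse)

lemma to_from_ordered [simp]: "to_ordered (from_ordered v) = v"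
  by (simp add: from_ordered_def to_ordered_def Rep_ordered_copy_inverse)

lemma linear_to_ordered: "linear to_ordered"
  by (rule linearI) (simp_all add: to_ordered_def cart_eq_iff)

lemma linear_from_ordered: "linear from_ordered"
  by (rule linearI) (simp_all add: from_ordered_def cart_eq_iff)

lemma to_ordered_image_eq_vimage: "to_ordered ` S = from_ordered -` S"
  by (metis (no_types, lifting) from_to_ordered image_eqI image_subset_iff subsetI subset_antisym
      to_from_ordered vimage_eq vimageI2)

text \<open>The reindexing permutes coordinates, so the preimage of a box is a box with the same
  side lengths, and Lebesgue measure is determined by its values on boxes.\<close>

lemma lborel_distr_from_ordered:
  "(lborel :: (real^'n) measure) = distr lborel borel (from_ordered :: real^('n ordered_copy) \<Rightarrow> real^'n)"
proof (rule lborel_eqI)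
  fix l u :: "real^'n" assume le: "\<And>b. b \<in> Basis \<Longrightarrow> l \<bullet> b \<le> u \<bullet> b"
  have le': "l $ i \<le> u $ i" for i
    using le[of "axis i 1"] by (simp add: axis_in_Basis_iff inner_axis)
  have prod_Basis: "(\<Prod>b\<in>Basis. (v::real^'k) \<bullet> b) = (\<Prod>i\<in>UNIV. v $ i)" for v :: "real^'k"
  proof -
    have "Basis = (\<lambda>i. axis i (1::real)) ` (UNIV :: 'k set)" by (auto simp: Basis_vec_def)
    moreover have "inj (\<lambda>i::'k. axis i (1::real))"
      by (auto simp: inj_def axis_eq_axis)
    ultimately have "(\<Prod>b\<in>Basis. v \<bullet> b) = (\<Prod>i\<in>UNIV. v \<bullet> axis i 1)"
      using prod.reindex[of "\<lambda>i::'k. axis i (1::real)" UNIV "\<lambda>b. v \<bullet> b"] by (simp add: o_def)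
    then show ?thesis by (simp add: inner_axis)
  qed
  have "from_ordered -` box l u = box (to_ordered l) (to_ordered u)"
  proof (intro equalityI subsetI)
    fix x :: "real^('n ordered_copy)" assume x: "x \<in> from_ordered -` box l u"
    then show "x \<in> box (to_ordered l) (to_ordered u)"
      by (auto simp: mem_box_cart to_ordered_def from_ordered_def)
        (metis Rep_ordered_copy_inverse)+
  next
    fix x :: "real^('n ordered_copy)" assume x: "x \<in> box (to_ordered l) (to_ordered u)"
    then show "x \<in> from_ordered -` box l u"
      by (auto simp: mem_box_cart to_ordered_def from_ordered_def)
        (metis Abs_ordered_copy_inverse UNIV_I)+
  qed
  moreover have "from_ordered \<in> borel_measurable (lborel :: (real^('n ordered_copy)) measure)"
    by (simp add: borel_measurable_continuous_onI linear_continuous_on linear_conv_bounded_linear[symmetric]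
        linear_from_ordered)
  ultimately have "emeasure (distr lborel borel from_ordered) (box l u)
      = emeasure lborel (box (to_ordered l) (to_ordered u))"
    by (simp add: emeasure_distr)
  also have "\<dots> = (\<Prod>b\<in>Basis. (to_ordered u - to_ordered l) \<bullet> b)"
  proof (rule emeasure_lborel_box)
    fix b :: "real^('n ordered_copy)" assume "b \<in> Basis"
    then show "to_ordered l \<bullet> b \<le> to_ordered u \<bullet> b"
      using le' by (auto simp: Basis_vec_def inner_axis to_ordered_def)
  qed
  also have "(\<Prod>b\<in>Basis. (to_ordered u - to_ordered l) \<bullet> b) = (\<Prod>i\<in>UNIV. (u - l) $ Rep_ordered_copy i)"
    by (simp add: prod_Basis to_ordered_def)
  also have "\<dots> = (\<Prod>i\<in>UNIV. (u - l) $ i)"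
    using prod.reindex_bij_betw[OF bij_Rep_ordered_copy, of "\<lambda>i. (u - l) $ i"] by simp
  finally show "emeasure (distr lborel borel from_ordered) (box l u) = (\<Prod>b\<in>Basis. (u - l) \<bullet> b)"
    by (simp add: prod_Basis)
qed simp

lemma measure_to_ordered:
  fixes S :: "(real^'n) set"
  assumes "open S"
  shows "measure lborel (to_ordered ` S) = measure lborel S"
proof -
  have "from_ordered \<in> borel_measurable (lborel :: (real^('n ordered_copy)) measure)"
    by (simp add: borel_measurable_continuous_onI linear_continuous_on linear_conv_bounded_linear[symmetric]
        linear_from_ordered)
  then have "measure (distr lborel borel (from_ordered :: real^('n ordered_copy) \<Rightarrow> real^'n)) S
      = measure lborel (to_ordered ` S)"
    using assms by (simp add: measure_distr to_ordered_image_eq_vimage)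
  then show ?thesis by (simp flip: lborel_distr_from_ordered)
qed

text \<open>Conjugation with \<open>to_ordered\<close> moves the map to the well-ordered index type,
  where the factor is the absolute value of a determinant.\<close>

lemma linear_image_measure_scaling:
  fixes f :: "real^'n \<Rightarrow> real^'n"
  assumes f: "linear f" "bij f"
  obtains \<kappa> where "\<kappa> > 0"
    "\<And>S. open S \<Longrightarrow> bounded S \<Longrightarrow> measure lborel (f ` S) = \<kappa> * measure lborel S"
proof -
  define g where "g = (\<lambda>v :: real^('n ordered_copy). to_ordered (f (from_ordered v)))"
  have g: "linear g"
    unfolding g_def using linear_compose[OF linear_compose[OF linear_from_ordered f(1)] linear_to_ordered]
    by (simp add: o_def)
  have inj_g: "inj g"
    unfolding g_def inj_def by (metis bij_is_inj f(2) from_to_ordered inj_eq to_from_ordered)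
  define \<kappa> where "\<kappa> = \<bar>det (matrix g)\<bar>"
  have "det (matrix g) \<noteq> 0"
    using g inj_g by (simp add: det_nz_iff_inj)
  then have pos: "\<kappa> > 0" by (simp add: \<kappa>_def)
  have "measure lborel (f ` S) = \<kappa> * measure lborel S" if S: "open S" "bounded S" for S
  proof -
    have surj_f: "surj f" using f(2) by (rule bij_is_surj)
    have o1: "open (f ` S)" by (rule open_surjective_linear_image[OF S(1) f(1) surj_f])
    have "surj to_ordered" by (metis surjI to_from_ordered)
    then have o2: "open (to_ordered ` S :: (real^('n ordered_copy)) set)"
      by (rule open_surjective_linear_image[OF S(1) linear_to_ordered])
    have b2: "bounded (to_ordered ` S :: (real^('n ordered_copy)) set)"
      using S(2) linear_to_ordered bounded_linear_image linear_conv_bounded_linear by blast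
    have im: "to_ordered ` (f ` S) = g ` (to_ordered ` S)"
      by (simp add: g_def image_image)
    have "surj g" using g inj_g by (simp add: linear_injective_imp_surjective)
    then have o3: "open (g ` (to_ordered ` S))" by (rule open_surjective_linear_image[OF o2 g])
    have "measure lborel (f ` S) = measure lborel (g ` (to_ordered ` S))"
      using measure_to_ordered[OF o1] by (simp add: im)
    also have "\<dots> = measure lebesgue (g ` (to_ordered ` S))"
      using o3 by (simp add: measure_completion)
    also have "\<dots> = \<kappa> * measure lebesgue (to_ordered ` S)"
      unfolding \<kappa>_def by (rule measure_linear_image[OF g lmeasurable_open[OF b2 o2]])
    also have "\<dots> = \<kappa> * measure lborel S"
      using o2 measure_to_ordered[OF S(1)] by (simp add: measure_completion)
    finally show ?thesis .
  qed
  with pos show ?thesis by (rule that)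
qed

section \<open>Expanding flows and their quasinorms\<close>

lemma exp_minus_cancel [simp]: "exp (t::real) * (exp (- t) * x) = x"
  by (simp flip: exp_add mult.assoc)

text \<open>The rate \<open>a\<close> is split into \<open>k + 1\<close> equal parts, one for each
  linear factor and one to spare. The spare factor supplies the limit 0 also for
  \<open>k = 0\<close>, where \<open>0 ^ k\<close> is 1.\<close>

lemma exp_dominates_power:
  fixes a b :: real
  assumes "a > 0"
  shows "((\<lambda>t. (1 + b * t) ^ k * exp (- a * t)) \<longlongrightarrow> 0) at_top"
proof -
  have "((\<lambda>t. (1 + b * t) ^ k * exp (- a * t)) \<longlongrightarrow> 0) at_top \<longleftrightarrow>
        ((\<lambda>t. ((1 + b * t) * exp (- (a / (real k + 1)) * t)) ^ k * exp (- (a / (real k + 1)) * t)) \<longlongrightarrow> 0) at_top"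
    (is "(?f \<longlongrightarrow> 0) at_top \<longleftrightarrow> (?g \<longlongrightarrow> 0) at_top")
  proof -
    have "?f = ?g"
    proof
      fix t
      have "real (Suc k) * (- (a / (real k + 1)) * t) = - a * t" by (simp add: field_simps)
      then have "exp (- a * t) = exp (- (a / (real k + 1)) * t) ^ Suc k"
        by (metis exp_of_nat_mult)
      then show "?f t = ?g t" by (simp add: power_mult_distrib)
    qed
    then show ?thesis by simp
  qed
  moreover have "(?g \<longlongrightarrow> 0 ^ k * 0) at_top"
  proof -
    define c where "c = a / (real k + 1)"
    have c: "c > 0" using assms by (simp add: c_def)
    have ct: "filterlim (\<lambda>t. c * t) at_top at_top"
      using c by (simp add: filterlim_tendsto_pos_mult_at_top[OF tendsto_const] filterlim_ident)
    have e: "((\<lambda>t. exp (- c * t)) \<longlongrightarrow> 0) at_top"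
      using filterlim_compose[OF exp_at_bot filterlim_compose[OF filterlim_uminus_at_bot_at_top ct]]
      by (simp add: o_def)
    have "((\<lambda>x::real. x ^ 1 / exp x) \<longlongrightarrow> 0) at_top" by (rule tendsto_power_div_exp_0)
    from filterlim_compose[OF this ct]
    have "((\<lambda>t. b / c * (c * t / exp (c * t))) \<longlongrightarrow> b / c * 0) at_top"
      by (intro tendsto_mult tendsto_const) simp
    moreover have "(\<lambda>t. b / c * (c * t / exp (c * t))) = (\<lambda>t. b * t * exp (- c * t))"
      using c by (auto simp: fun_eq_iff exp_minus field_simps)
    ultimately have "((\<lambda>t. b * t * exp (- c * t)) \<longlongrightarrow> 0) at_top" by simp
    from tendsto_add[OF e this] have "((\<lambda>t. (1 + b * t) * exp (- c * t)) \<longlongrightarrow> 0) at_top"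
      by (simp add: algebra_simps)
    then show ?thesis
      unfolding c_def[symmetric] by (intro tendsto_mult tendsto_power e)
  qed
  ultimately show ?thesis by simp
qed

lemma exp_power_bounded:
  fixes a :: real
  assumes "a > 0"
  obtains C where "C \<ge> 1" "\<And>t. t \<ge> 0 \<Longrightarrow> (1 + t) ^ k * exp (- a * t) \<le> C"
proof -
  define f where "f = (\<lambda>t. (1 + 1 * t) ^ k * exp (- a * t))"
  have "(f \<longlongrightarrow> 0) at_top" unfolding f_def by (rule exp_dominates_power[OF assms])
  then have "\<forall>\<^sub>F t in at_top. f t < 1" by (rule order_tendstoD) simp
  then obtain t0 where t0: "\<And>t. t \<ge> t0 \<Longrightarrow> f t < 1" by (auto simp: eventually_at_top_linorder)
  have "f t \<le> max 1 ((1 + \<bar>t0\<bar>) ^ k)" if t: "t \<ge> 0" for t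
  proof (cases "t \<ge> t0")
    case True
    have "f t < 1" by (rule t0[OF True])
    also have "1 \<le> max 1 ((1 + \<bar>t0\<bar>) ^ k)" by simp
    finally show ?thesis by simp
  next
    case False
    then have "f t \<le> (1 + \<bar>t0\<bar>) ^ k * 1"
      unfolding f_def using t assms by (intro mult_mono power_mono) auto
    then show ?thesis by simp
  qed
  then show ?thesis by (intro that[of "max 1 ((1 + \<bar>t0\<bar>) ^ k)"]) (auto simp: f_def)
qed

text \<open>\<open>N\<close> plays the role of the norm of an admissible inner product, \<open>E t\<close> of \<open>e\<^sup>t\<^sup>A\<close>, and
  \<open>lam\<close> of the smallest real part of an eigenvalue. \<open>Suc k\<close> is the largest size of a Jordan block
  with this real part, and \<open>H\<close> is spanned by the eigenvectors that start the blocks of this size.\<close>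

locale expanding_flow =
  fixes E :: "real \<Rightarrow> real^'n \<Rightarrow> real^'n" and N :: "real^'n \<Rightarrow> real"
    and lam :: real and k :: nat and H :: "(real^'n) set"
  assumes linear_E: "linear (E t)"
    and E_add: "E (s + t) x = E s (E t x)"
    and E_0 [simp]: "E 0 x = x"
    and cont_E: "continuous_on UNIV (\<lambda>t. E t x)"
    and decay: "\<exists>C. \<forall>t\<ge>0. \<forall>x. norm (E (- t) x) \<le> C * (exp (- lam * t) * (1 + t) ^ k) * norm x"
    and lam_pos: "lam > 0"
    and N_lower: "\<exists>c>0. \<forall>x. c * norm x \<le> N x"
    and N_upper: "\<exists>C. \<forall>x. N x \<le> C * norm x"
    and cont_N: "continuous_on UNIV N"
    and N_minus: "N (- x) = N x"
    and subspace_H: "Real_Vector_Spaces.subspace H"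
    and H_norm: "\<exists>C. \<forall>h\<in>H. \<forall>t. norm (E t h) \<le> C * exp (lam * t) * norm h"
    and H_inv: "h \<in> H \<Longrightarrow> E t h \<in> H"
    and H_approx: "e \<in> H \<Longrightarrow> \<exists>w C. (\<forall>T. norm (w T) \<le> C) \<and>
      (\<lambda>T::nat. E (- real T) (w T) /\<^sub>R (exp (- lam * real T) * real T ^ k)) \<longlonglongrightarrow> e"
    and H_perp: "\<lbrakk>\<forall>h\<in>H. a \<bullet> h = 0; \<epsilon> > 0\<rbrakk> \<Longrightarrow>
      \<exists>T0. \<forall>t\<ge>T0. \<forall>x. \<bar>a \<bullet> E (- t) x\<bar> \<le> \<epsilon> * (exp (- lam * t) * t ^ k) * norm x"
    and H_nonzero: "H \<noteq> {0}"
begin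

lemma E_E_minus [simp]: "E t (E (- t) x) = x"
  by (simp flip: E_add)

lemma E_minus_E [simp]: "E (- t) (E t x) = x"
  by (simp flip: E_add)

lemmas E_diff = linear_diff[OF linear_E]
  and E_plus = linear_add[OF linear_E]
  and E_uminus = linear_neg[OF linear_E]
  and E_scale = linear_cmul[OF linear_E]
  and E_zero [simp] = linear_0[OF linear_E]

lemma E_eq_0_iff [simp]: "E t x = 0 \<longleftrightarrow> x = 0"
  by (metis E_E_minus E_minus_E E_zero)

lemma bij_E: "bij (E t)"
  by (rule o_bij[of "E (- t)"]) (auto simp: fun_eq_iff)

lemma E_bound:
  obtains C where "C > 0" "\<And>x. norm (E t x) \<le> C * norm x"
  using linear_bounded_pos[OF linear_E] by metis

text \<open>Giving up half of the rate \<open>lam\<close> absorbs the polynomial factor. The second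
  bound is the first one at \<open>E t x\<close>: contraction backwards is expansion
  forwards.\<close>

lemma decay_exp:
  obtains C a where "C > 0" "a > 0" "\<And>t x. t \<ge> 0 \<Longrightarrow> norm (E (- t) x) \<le> C * exp (- a * t) * norm x"
    "\<And>t x. t \<ge> 0 \<Longrightarrow> exp (a * t) * norm x \<le> C * norm (E t x)"
proof -
  obtain C where C: "\<And>t x. t \<ge> 0 \<Longrightarrow> norm (E (- t) x) \<le> C * (exp (- lam * t) * (1 + t) ^ k) * norm x"
    using decay by blast
  define a where "a = lam / 2"
  have a: "a > 0" using lam_pos by (simp add: a_def)
  obtain B where B: "B \<ge> 1" "\<And>t. t \<ge> 0 \<Longrightarrow> (1 + t) ^ k * exp (- a * t) \<le> B"
    by (rule exp_power_bounded[OF a, of k]) (rule that)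
  define D where "D = (\<bar>C\<bar> + 1) * B"
  have D: "D > 0" unfolding D_def using B(1) by (intro mult_pos_pos) auto
  have le: "norm (E (- t) x) \<le> D * exp (- a * t) * norm x" if t: "t \<ge> 0" for t x
  proof -
    have eq: "exp (- lam * t) * (1 + t) ^ k = exp (- a * t) * ((1 + t) ^ k * exp (- a * t))"
      by (simp add: a_def flip: exp_add)
    have "norm (E (- t) x) \<le> C * (exp (- a * t) * ((1 + t) ^ k * exp (- a * t))) * norm x"
      unfolding eq[symmetric] by (rule C[OF t])
    also have "\<dots> \<le> (\<bar>C\<bar> + 1) * (exp (- a * t) * B) * norm x"
      using B(2)[OF t] t by (intro mult_right_mono mult_mono) auto
    finally show ?thesis by (simp add: D_def mult_ac)
  qed
  have "exp (a * t) * norm x \<le> D * norm (E t x)" if "t \<ge> 0" for t x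
  proof -
    have "norm x \<le> D * exp (- a * t) * norm (E t x)"
      using le[OF that, of "E t x"] by simp
    then have "exp (a * t) * norm x \<le> exp (a * t) * (D * exp (- a * t) * norm (E t x))" by simp
    also have "\<dots> = D * norm (E t x)" by (simp add: mult.left_commute)
    finally show ?thesis .
  qed
  then show ?thesis using that[of D a] D a le by blast
qed

lemma N_bounds:
  obtains c C where "c > 0" "C > 0" "\<And>x. c * norm x \<le> N x" "\<And>x. N x \<le> C * norm x"
proof -
  obtain c where c: "c > 0" "\<And>x. c * norm x \<le> N x" using N_lower by blast
  obtain C where C: "\<And>x. N x \<le> C * norm x" using N_upper by blast
  have "N x \<le> (\<bar>C\<bar> + 1) * norm x" for x
    using order_trans[OF C[of x] mult_right_mono[of C "\<bar>C\<bar> + 1" "norm x"]] by simp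
  with c show ?thesis by (intro that[of c "\<bar>C\<bar> + 1"]) auto
qed

definition rho :: "real^'n \<Rightarrow> real" where
  "rho v = (if v = 0 then 0 else exp (LEAST t. N (E (- t) v) = 1))"

lemma rho_zero [simp]: "rho 0 = 0" by (simp add: rho_def)

text \<open>\<open>N (E (- t) v)\<close> need not be monotone in \<open>t\<close>, so the value 1
  may be taken several times. It is below 1 at some late time and above 1 at all early times; the
  solutions thus form a nonempty closed set that is bounded below, and its infimum is the least
  one.\<close>

lemma least_time_exists:
  assumes "v \<noteq> 0"
  obtains t where "N (E (- t) v) = 1" "\<And>s. N (E (- s) v) = 1 \<Longrightarrow> t \<le> s"
proof -
  obtain C a where C: "C > 0" "a > 0" "\<And>t x. t \<ge> 0 \<Longrightarrow> norm (E (- t) x) \<le> C * exp (- a * t) * norm x"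
    "\<And>t x. t \<ge> 0 \<Longrightarrow> exp (a * t) * norm x \<le> C * norm (E t x)" by (rule decay_exp) metis
  obtain c D where cD: "c > 0" "D > 0" "\<And>x. c * norm x \<le> N x" "\<And>x. N x \<le> D * norm x"
    by (rule N_bounds) metis
  define f where "f = (\<lambda>t. N (E (- t) v))"
  have "continuous_on UNIV (\<lambda>t. E (- t) v)"
    by (rule continuous_on_compose2[OF cont_E[of v]]) (auto intro: continuous_intros)
  then have cont: "continuous_on UNIV f"
    unfolding f_def by (intro continuous_on_compose2[OF cont_N]) auto
  have e0: "((\<lambda>t. exp (- a * t)) \<longlongrightarrow> 0) at_top"
    using exp_dominates_power[OF C(2), of 0 0] by simp
  have small: "\<forall>\<^sub>F t in at_top. exp (- a * t) < r" if "r > 0" for r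
    using order_tendstoD(2)[OF e0 that] .
  have nv: "norm v > 0" using assms by simp
  obtain t1 where t1: "t1 \<ge> 0" "exp (- a * t1) < 1 / (D * C * norm v)"
  proof -
    have "\<forall>\<^sub>F t in at_top. exp (- a * t) < 1 / (D * C * norm v) \<and> t \<ge> 0"
      using cD C nv by (intro eventually_conj small eventually_ge_at_top) auto
    then show ?thesis using that by (auto simp: eventually_at_top_linorder)
  qed
  have f1: "f t1 < 1"
  proof -
    have "f t1 \<le> D * (C * exp (- a * t1) * norm v)"
      unfolding f_def using cD(4)[of "E (- t1) v"] mult_left_mono[OF C(3)[OF t1(1), of v], of D] cD(2) by linarith
    also have "\<dots> < 1" using t1(2) cD C nv by (simp add: field_simps)
    finally show ?thesis .
  qed
  obtain t2 where t2: "t2 \<ge> 0" "\<And>t. t \<ge> t2 \<Longrightarrow> exp (- a * t) < c * norm v / C"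
  proof -
    have "\<forall>\<^sub>F t in at_top. exp (- a * t) < c * norm v / C"
      using cD C nv by (intro small) auto
    then obtain t2 where "\<And>t. t \<ge> t2 \<Longrightarrow> exp (- a * t) < c * norm v / C"
      by (auto simp: eventually_at_top_linorder)
    then show ?thesis using that[of "max 0 t2"] by simp
  qed
  have big: "f (- t) > 1" if "t \<ge> t2" for t
  proof -
    have "exp (a * t) * norm v \<le> C * norm (E t v)" using C(4) t2(1) that by simp
    then have "c * (exp (a * t) * norm v) \<le> c * (C * norm (E t v))" using cD(1) by simp
    also have "\<dots> \<le> C * f (- t)" using mult_left_mono[OF cD(3)[of "E t v"], of C] C(1)
      by (simp add: f_def mult_ac)
    finally have *: "c * norm v * exp (a * t) \<le> C * f (- t)" by (simp add: mult_ac)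
    have "1 < c * norm v / C * exp (a * t)"
      using mult_strict_right_mono[OF t2(2)[OF that], of "exp (a * t)"] by (simp flip: exp_add)
    then have "C < c * norm v * exp (a * t)" using C(1) by (simp add: field_simps)
    with * have "C * 1 < C * f (- t)" by simp
    then show ?thesis using C(1) by simp
  qed
  define S where "S = {t. f t = 1}"
  have "\<exists>t\<ge>- t2. t \<le> t1 \<and> f t = 1"
    using f1 big[of t2] t1(1) t2(1) continuous_on_subset[OF cont]
    by (intro IVT2') auto
  then have ne: "S \<noteq> {}" by (auto simp: S_def)
  have lb: "- t2 \<le> t" if "t \<in> S" for t
    using big[of "- t"] that by (force simp: S_def)
  have bdd: "bdd_below S" by (rule bdd_belowI[of S "- t2"]) (rule lb)
  have "closed S" unfolding S_def using continuous_closed_preimage_constant[OF cont closed_UNIV, of 1] by simp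
  then have "Inf S \<in> S" using closed_contains_Inf ne bdd by blast
  moreover have "Inf S \<le> s" if "f s = 1" for s
    using bdd that by (intro cInf_lower) (auto simp: S_def)
  ultimately show ?thesis
    by (intro that[of "Inf S"]) (auto simp: S_def f_def)
qed

lemma rho_eqI:
  assumes "v \<noteq> 0" "N (E (- t) v) = 1" "\<And>s. N (E (- s) v) = 1 \<Longrightarrow> t \<le> s"
  shows "rho v = exp t"
  using assms Least_equality[of "\<lambda>t. N (E (- t) v) = 1" t] by (simp add: rho_def)

lemma rhoE:
  assumes "v \<noteq> 0"
  obtains t where "rho v = exp t" "N (E (- t) v) = 1" "\<And>s. N (E (- s) v) = 1 \<Longrightarrow> t \<le> s"
  using least_time_exists[OF assms] rho_eqI[OF assms] by metis

lemma rho_pos [simp]: "rho v > 0 \<longleftrightarrow> v \<noteq> 0"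
  by (auto simp: rho_def)

lemma rho_nonneg [simp]: "rho v \<ge> 0"
  by (auto simp: rho_def)

lemma rho_eq_0_iff [simp]: "rho v = 0 \<longleftrightarrow> v = 0"
  by (auto simp: rho_def)

lemma rho_uminus [simp]: "rho (- v) = rho v"
  by (simp add: rho_def E_uminus N_minus)

lemma rho_E: "rho (E s v) = exp s * rho v"
proof (cases "v = 0")
  case False
  then obtain t where t: "rho v = exp t" "N (E (- t) v) = 1" "\<And>s. N (E (- s) v) = 1 \<Longrightarrow> t \<le> s"
    by (rule rhoE) metis
  have "rho (E s v) = exp (s + t)"
  proof (rule rho_eqI)
    show "N (E (- (s + t)) (E s v)) = 1" using t(2) by (simp flip: E_add)
    fix r assume "N (E (- r) (E s v)) = 1"
    then have "N (E (- (r - s)) v) = 1" by (simp flip: E_add)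
    then show "s + t \<le> r" using t(3) by fastforce
  qed (use False in simp)
  then show ?thesis by (simp add: t(1) exp_add)
qed simp

lemma rho_normalize: "v \<noteq> 0 \<Longrightarrow> rho (E (- ln (rho v)) v) = 1"
  by (simp add: rho_E exp_minus)

lemma rho_bounded:
  obtains C where "C > 0" "\<And>v. norm v \<le> b \<Longrightarrow> rho v \<le> C"
proof -
  obtain C a where C: "C > 0" "a > 0" "\<And>t x. t \<ge> 0 \<Longrightarrow> norm (E (- t) x) \<le> C * exp (- a * t) * norm x"
    by (rule decay_exp) metis
  obtain c D where cD: "c > 0" "D > 0" "\<And>x. c * norm x \<le> N x" "\<And>x. N x \<le> D * norm x"
    by (rule N_bounds) metis
  \<comment> \<open>From time \<open>L\<close> on, the bound
    \<open>D * C * exp (- a * t) * \<bar>b\<bar>\<close> for \<open>N (E (- t) v)\<close> is below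
    1. The added 1 keeps the logarithm nonnegative.\<close>
  define L where "L = ln (1 + D * C * \<bar>b\<bar>) / a"
  have L: "L \<ge> 0" unfolding L_def using C cD by simp
  have "rho v \<le> exp L" if v: "norm v \<le> b" for v
  proof (cases "v = 0")
    case False
    then obtain t where t: "rho v = exp t" "N (E (- t) v) = 1" by (rule rhoE) metis
    have "t \<le> L"
    proof (cases "t \<ge> 0")
      case True
      have "1 \<le> D * norm (E (- t) v)" using cD(4)[of "E (- t) v"] t(2) by simp
      also have "\<dots> \<le> D * (C * exp (- a * t) * norm v)" using C(3)[OF True, of v] cD(2) by (intro mult_left_mono) auto
      also have "\<dots> \<le> D * (C * exp (- a * t) * \<bar>b\<bar>)" using C cD v by simp
      finally have "exp (a * t) \<le> exp (a * t) * (D * (C * exp (- a * t) * \<bar>b\<bar>))" by simp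
      also have "\<dots> = D * C * \<bar>b\<bar>" by (simp add: exp_minus)
      finally have "exp (a * t) \<le> 1 + D * C * \<bar>b\<bar>" by simp
      then have "a * t \<le> ln (1 + D * C * \<bar>b\<bar>)"
        using C cD by (metis exp_gt_zero exp_le_cancel_iff exp_ln order_less_le_trans)
      then show ?thesis using C(2) by (simp add: L_def field_simps)
    qed (use L in simp)
    then show ?thesis using t(1) by simp
  qed simp
  then show ?thesis by (intro that[of "exp L"]) auto
qed

lemma rho_away:
  assumes "b > 0"
  obtains c where "c > 0" "\<And>v. norm v \<ge> b \<Longrightarrow> rho v \<ge> c"
proof -
  obtain C a where C: "C > 0" "a > 0" 
    "\<And>t x. t \<ge> 0 \<Longrightarrow> exp (a * t) * norm x \<le> C * norm (E t x)" by (rule decay_exp) metis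
  obtain c D where cD: "c > 0" "D > 0" "\<And>x. c * norm x \<le> N x" "\<And>x. N x \<le> D * norm x"
    by (rule N_bounds) metis
  \<comment> \<open>For \<open>t < - L\<close> the expansion has already pushed
    \<open>N (E (- t) v)\<close> above 1, so no solution lies there.\<close>
  define L where "L = ln (1 + C / (c * b)) / a"
  have L: "L \<ge> 0" unfolding L_def using C cD assms by simp
  have "rho v \<ge> exp (- L)" if v: "norm v \<ge> b" for v
  proof -
    have "v \<noteq> 0" using v assms by auto
    then obtain t where t: "rho v = exp t" "N (E (- t) v) = 1" by (rule rhoE) metis
    have "- L \<le> t"
    proof (cases "t \<le> 0")
      case True
      have "exp (a * (- t)) * b \<le> exp (a * (- t)) * norm v" using v by simp
      also have "\<dots> \<le> C * norm (E (- t) v)" using C(3)[of "- t" v] True by simp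
      also have "c * \<dots> \<le> C * N (E (- t) v)"
        using mult_left_mono[OF cD(3)[of "E (- t) v"], of C] C(1) by (simp add: mult_ac)
      finally have "c * (exp (a * (- t)) * b) \<le> C" using t(2) cD(1) by simp
      then have "exp (a * (- t)) \<le> C / (c * b)" using cD(1) assms by (simp add: field_simps)
      then have "exp (a * (- t)) \<le> 1 + C / (c * b)" by simp
      then have "a * (- t) \<le> ln (1 + C / (c * b))"
        by (metis exp_gt_zero exp_le_cancel_iff exp_ln order_less_le_trans)
      then have "- t \<le> L" using C(2) by (simp add: L_def field_simps)
      then show ?thesis by simp
    qed (use L in simp)
    then show ?thesis using t(1) by simp
  qed
  then show ?thesis by (intro that[of "exp (- L)"]) auto
qed

text \<open>The time \<open>t\<close> is chosen so that \<open>rho (E t v)\<close> falls below the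
  value \<open>c\<close> that every vector of norm at least 1 reaches. Then \<open>E t v\<close> has
  norm below 1, and undoing the flow for this fixed time costs a bounded factor.\<close>

lemma norm_bounded_by_rho:
  obtains C where "C > 0" "\<And>v. rho v \<le> b \<Longrightarrow> norm v \<le> C"
proof -
  obtain c where c: "c > 0" "\<And>v. norm v \<ge> 1 \<Longrightarrow> rho v \<ge> c" using rho_away[of 1] by auto
  define t where "t = ln (c / (2 * (\<bar>b\<bar> + 1)))"
  have et: "exp t = c / (2 * (\<bar>b\<bar> + 1))" using c(1) by (simp add: t_def)
  obtain C where C: "C > 0" "\<And>x. norm (E (- t) x) \<le> C * norm x" by (rule E_bound[of "- t"]) metis
  have "norm v \<le> C" if v: "rho v \<le> b" for v
  proof -
    have "rho (E t v) \<le> exp t * \<bar>b\<bar>" using v by (simp add: rho_E)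
    also have "\<dots> < c"
    proof -
      have "c * \<bar>b\<bar> < c * (2 * (\<bar>b\<bar> + 1))" using c(1) by (intro mult_strict_left_mono) auto
      then have "c * \<bar>b\<bar> / (2 * (\<bar>b\<bar> + 1)) < c" by (subst divide_less_eq) (auto simp: add_pos_nonneg mult.commute)
      then show ?thesis by (simp add: et)
    qed
    finally have "norm (E t v) < 1" using c(2) by (meson not_le)
    then have "C * norm (E t v) \<le> C * 1" using C(1) by simp
    then show ?thesis using C(2)[of "E t v"] by simp
  qed
  with C(1) show ?thesis by (rule that)
qed

lemma rho_small:
  assumes "\<epsilon> > 0"
  obtains \<delta> where "\<delta> > 0" "\<And>v. norm v < \<delta> \<Longrightarrow> rho v < \<epsilon>"
proof -
  obtain C where C: "C > 0" "\<And>v. norm v \<le> 1 \<Longrightarrow> rho v \<le> C" by (rule rho_bounded[of 1]) metis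
  define t where "t = ln (\<epsilon> / (2 * C))"
  have et: "exp t = \<epsilon> / (2 * C)" using C(1) assms by (simp add: t_def)
  obtain D where D: "D > 0" "\<And>x. norm (E (- t) x) \<le> D * norm x" by (rule E_bound[of "- t"]) metis
  have "rho v < \<epsilon>" if v: "norm v < 1 / D" for v
  proof -
    have "norm (E (- t) v) \<le> 1" using D(2)[of v] v D(1) by (simp add: field_simps)
    then have "rho (E (- t) v) \<le> C" by (rule C(2))
    then have "exp t * rho (E (- t) v) \<le> exp t * C" by simp
    also have "\<dots> < \<epsilon>" using C(1) assms by (simp add: et)
    finally show ?thesis by (simp add: rho_E)
  qed
  then show ?thesis using D(1) by (intro that[of "1 / D"]) auto
qed

text \<open>By homogeneity under the flow the vector with the larger \<open>rho\<close> may be moved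
  to \<open>rho = 1\<close>. Both vectors then have bounded norm, where the ordinary triangle
  inequality applies.\<close>

lemma rho_triangle:
  obtains M where "M \<ge> 1" "\<And>v w. rho (v + w) \<le> M * (rho v + rho w)"
proof -
  obtain C where C: "C > 0" "\<And>v. rho v \<le> 1 \<Longrightarrow> norm v \<le> C" by (rule norm_bounded_by_rho[of 1]) metis
  obtain D where D: "D > 0" "\<And>v. norm v \<le> 2 * C \<Longrightarrow> rho v \<le> D" by (rule rho_bounded[of "2 * C"]) metis
  have main: "rho (v + w) \<le> D * rho v" if le: "rho w \<le> rho v" for v w
  proof (cases "v = 0")
    case True
    then have "rho w = 0" using le rho_nonneg[of w] by simp
    then show ?thesis using True by simp
  next
    case False
    define s where "s = ln (rho v)"
    have s: "exp s = rho v" using False by (simp add: s_def)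
    have 1: "norm (E (- s) v) \<le> C"
      using C(2) False by (simp add: s_def rho_normalize)
    have "rho (E (- s) w) \<le> 1" using le False s by (simp add: rho_E exp_minus field_simps)
    then have 2: "norm (E (- s) w) \<le> C" by (rule C(2))
    have "norm (E (- s) (v + w)) \<le> 2 * C"
      using norm_triangle_ineq[of "E (- s) v" "E (- s) w"] 1 2 by (simp add: E_plus)
    then have "rho (E (- s) (v + w)) \<le> D" by (rule D(2))
    then have "exp (- s) * rho (v + w) \<le> D" by (simp only: rho_E)
    moreover have "rho (v + w) = exp s * (exp (- s) * rho (v + w))" by simp
    ultimately show ?thesis unfolding s[symmetric]
      by (metis exp_ge_zero mult.commute mult_left_mono)
  qed
  have "rho (v + w) \<le> (D + 1) * (rho v + rho w)" for v w
  proof -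
    have "rho (v + w) \<le> D * (rho v + rho w)"
    proof (cases "rho w \<le> rho v")
      case True
      have "D * rho v \<le> D * (rho v + rho w)" using D(1) by simp
      with main[OF True] show ?thesis by linarith
    next
      case False
      have "D * rho w \<le> D * (rho v + rho w)" using D(1) by simp
      with main[of v w] False main[of w v] show ?thesis by (simp add: add.commute)
    qed
    also have "\<dots> \<le> (D + 1) * (rho v + rho w)" by (intro mult_right_mono) auto
    finally show ?thesis .
  qed
  then show ?thesis using D(1) by (intro that[of "D + 1"]) auto
qed

text \<open>\<open>H_norm\<close> holds for times of both signs, so on \<open>H\<close> the flow
  multiplies norms by \<open>exp (lam * t)\<close> up to a bounded factor. It remains to flow
  \<open>h\<close> to \<open>rho = 1\<close>, where norms lie between \<open>\<delta>\<close> and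
  \<open>b\<close>.\<close>

lemma rho_H:
  obtains C where "C > 0"
    "\<And>h. h \<in> H \<Longrightarrow> rho h powr lam \<le> C * norm h" "\<And>h. h \<in> H \<Longrightarrow> norm h \<le> C * rho h powr lam"
proof -
  obtain D0 where D0: "\<And>h t. h \<in> H \<Longrightarrow> norm (E t h) \<le> D0 * exp (lam * t) * norm h"
    using H_norm by blast
  define D where "D = \<bar>D0\<bar> + 1"
  have D: "D > 0" "\<And>h t. h \<in> H \<Longrightarrow> norm (E t h) \<le> D * exp (lam * t) * norm h"
  proof -
    show "D > 0" by (simp add: D_def)
    fix h t assume "h \<in> H"
    from order_trans[OF D0[OF this]] show "norm (E t h) \<le> D * exp (lam * t) * norm h"
      by (simp add: D_def mult_right_mono)
  qed
  obtain b where b: "b > 0" "\<And>v. rho v \<le> 1 \<Longrightarrow> norm v \<le> b" by (rule norm_bounded_by_rho[of 1]) metis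
  obtain \<delta> where \<delta>: "\<delta> > 0" "\<And>v. norm v < \<delta> \<Longrightarrow> rho v < 1" using rho_small[of 1] by auto
  define C where "C = D * b + D / \<delta>"
  have "rho h powr lam \<le> C * norm h \<and> norm h \<le> C * rho h powr lam" if h: "h \<in> H" for h
  proof (cases "h = 0")
    case False
    define t where "t = ln (rho h)"
    define w where "w = E (- t) h"
    have pw: "rho h powr lam = exp (lam * t)" using False by (simp add: t_def powr_def)
    have w: "rho w = 1" "w \<in> H" using False h by (auto simp: w_def t_def rho_normalize H_inv)
    have hw: "h = E t w" by (simp add: w_def)
    have "norm h \<le> D * exp (lam * t) * norm w" using D(2)[OF w(2), of t] by (simp add: hw)
    also have "\<dots> \<le> D * exp (lam * t) * b" using b(2)[of w] w(1) D(1) by simp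
    also have "\<dots> \<le> C * rho h powr lam" using D(1) \<delta>(1) by (simp add: C_def pw algebra_simps)
    finally have 1: "norm h \<le> C * rho h powr lam" .
    have "\<delta> \<le> norm w" using \<delta>(2)[of w] w(1) by force
    also have "\<dots> \<le> D * exp (- (lam * t)) * norm h" using D(2)[OF h, of "- t"] by (simp add: w_def)
    finally have "exp (lam * t) * \<delta> \<le> exp (lam * t) * (D * exp (- (lam * t)) * norm h)" by simp
    then have "exp (lam * t) * \<delta> \<le> D * norm h"
      by (simp only: mult.assoc mult.left_commute[of "exp (lam * t)"] exp_minus_cancel)
    then have "exp (lam * t) \<le> D / \<delta> * norm h" using \<delta>(1) by (simp add: field_simps)
    also have "\<dots> \<le> C * norm h" using D(1) b(1) by (intro mult_right_mono) (auto simp: C_def)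
    finally show ?thesis using 1 pw by simp
  qed simp
  moreover have "C > 0" using D b \<delta> by (simp add: C_def add_pos_pos)
  ultimately show ?thesis by (intro that[of C]) auto
qed

end

section \<open>Integer points and volumes under the flow\<close>

definition integer_vectors :: "(real^'n) set" where
  "integer_vectors = {z. \<forall>i. z $ i \<in> \<int>}"

definition floor_vec :: "real^'n \<Rightarrow> real^'n" where
  "floor_vec v = (\<chi> i. of_int \<lfloor>v $ i\<rfloor>)"

lemma floor_vec_in [simp]: "floor_vec v \<in> integer_vectors"
  by (simp add: integer_vectors_def floor_vec_def)

lemma norm_diff_floor_vec: "norm (v - floor_vec v) \<le> real CARD('n)" for v :: "real^'n"
proof -
  have "norm (v - floor_vec v) \<le> (\<Sum>i\<in>UNIV. \<bar>(v - floor_vec v) $ i\<bar>)" by (rule norm_le_l1_cart)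
  also have "\<dots> \<le> (\<Sum>i\<in>(UNIV::'n set). 1)"
    by (rule sum_mono) (simp add: floor_vec_def, linarith)
  finally show ?thesis by simp
qed

lemma integer_vectors_add: "\<lbrakk>v \<in> integer_vectors; w \<in> integer_vectors\<rbrakk> \<Longrightarrow> v + w \<in> integer_vectors"
  and integer_vectors_diff: "\<lbrakk>v \<in> integer_vectors; w \<in> integer_vectors\<rbrakk> \<Longrightarrow> v - w \<in> integer_vectors"
  by (auto simp: integer_vectors_def)

lemma norm_integer_vector_ge_1:
  assumes "z \<in> integer_vectors" "z \<noteq> 0"
  shows "norm z \<ge> 1"
proof -
  obtain i where i: "z $ i \<noteq> 0" using assms(2) by (metis cart_eq_iff zero_index)
  have "z $ i \<in> \<int>" using assms(1) by (simp add: integer_vectors_def)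
  then have "\<bar>z $ i\<bar> \<ge> 1" using i by (metis Ints_nonzero_abs_ge1)
  then show ?thesis using component_le_norm_cart[of z i] by linarith
qed

lemma finite_bounded_integer_vectors: "finite {z \<in> integer_vectors. norm z \<le> r}"
proof (rule finite_subset)
  define S where "S = (of_int ` {\<lfloor>- r\<rfloor>..\<lceil>r\<rceil>} :: real set)"
  show "{z \<in> integer_vectors. norm z \<le> r} \<subseteq> vec_lambda ` (PiE UNIV (\<lambda>_. S))"
  proof
    fix z :: "real^'n" assume z: "z \<in> {z \<in> integer_vectors. norm z \<le> r}"
    have "z $ i \<in> S" for i
    proof -
      obtain m :: int where m: "z $ i = of_int m"
        using z by (auto simp: integer_vectors_def elim: Ints_cases)
      have "\<bar>of_int m\<bar> \<le> r" using component_le_norm_cart[of z i] z m by simp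
      then have "m \<in> {\<lfloor>- r\<rfloor>..\<lceil>r\<rceil>}" by (auto; linarith)
      then show ?thesis unfolding S_def m by blast
    qed
    then have "vec_nth z \<in> PiE UNIV (\<lambda>_. S)" by auto
    then show "z \<in> vec_lambda ` (PiE UNIV (\<lambda>_. S))" by (metis image_eqI vec_nth_inverse)
  qed
  show "finite (vec_lambda ` (PiE UNIV (\<lambda>_. S)))"
    by (intro finite_imageI finite_PiE) (auto simp: S_def)
qed

lemma measure_ball_pos: "r > 0 \<Longrightarrow> measure lborel (ball (x::real^'n) r) > 0"
  by (rule content_ball_pos)

lemma sum_measure_disjoint_le:
  fixes S :: "'i \<Rightarrow> (real^'n) set"
  assumes "finite I" "disjoint_family_on S I" "\<And>i. i \<in> I \<Longrightarrow> open (S i)"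
    and "\<And>i. i \<in> I \<Longrightarrow> S i \<subseteq> ball 0 R"
  shows "(\<Sum>i\<in>I. measure lborel (S i)) \<le> measure lborel (ball (0::real^'n) R)"
proof -
  have fin: "emeasure lborel (S i) \<noteq> \<infinity>" if "i \<in> I" for i
  proof -
    have "emeasure lborel (S i) \<le> emeasure lborel (ball (0::real^'n) R)"
      using assms(4)[OF that] by (intro emeasure_mono) auto
    also have "\<dots> < \<infinity>" by (rule emeasure_lborel_ball_finite)
    finally show ?thesis by simp
  qed
  have "(\<Sum>i\<in>I. measure lborel (S i)) = measure lborel (\<Union>i\<in>I. S i)"
    using assms fin by (intro measure_finite_Union[symmetric]) auto
  also have "\<dots> \<le> measure lborel (ball (0::real^'n) R)"
    using assms(3,4) by (intro measure_mono_fmeasurable)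
      (auto intro!: borel_open fmeasurableI emeasure_lborel_ball_finite)
  finally show ?thesis .
qed

lemma measure_cover_le:
  fixes S :: "'i \<Rightarrow> (real^'n) set"
  assumes "finite I" "\<And>i. i \<in> I \<Longrightarrow> open (S i)" "\<And>i. i \<in> I \<Longrightarrow> bounded (S i)"
    and "ball 0 R \<subseteq> (\<Union>i\<in>I. S i)"
  shows "measure lborel (ball (0::real^'n) R) \<le> (\<Sum>i\<in>I. measure lborel (S i))"
proof -
  have fm: "S i \<in> fmeasurable lborel" if "i \<in> I" for i
    using assms(2,3)[OF that] emeasure_bounded_finite by (intro fmeasurableI) auto
  have "measure lborel (ball (0::real^'n) R) \<le> measure lborel (\<Union>i\<in>I. S i)"
    using assms fm by (intro measure_mono_fmeasurable fmeasurable.finite_UN) auto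
  also have "\<dots> \<le> (\<Sum>i\<in>I. measure lborel (S i))"
    using assms fm by (intro measure_UNION_le) (auto simp: fmeasurable_def)
  finally show ?thesis .
qed

context expanding_flow
begin

text \<open>This is the absolute value of the determinant of \<open>E t\<close>, written as a ratio
  of volumes because it is compared with volumes only.\<close>

definition kappa :: "real \<Rightarrow> real" where
  "kappa t = measure lborel (E t ` ball 0 1) / measure lborel (ball (0::real^'n) 1)"

lemma kappa_pos: "kappa t > 0"
  and measure_E_image: "\<lbrakk>open S; bounded S\<rbrakk> \<Longrightarrow> measure lborel (E t ` S) = kappa t * measure lborel S"
proof -
  obtain \<kappa> where \<kappa>: "\<kappa> > 0"
    "\<And>S. open S \<Longrightarrow> bounded S \<Longrightarrow> measure lborel (E t ` S) = \<kappa> * measure lborel S"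
    using linear_image_measure_scaling[OF linear_E[of t] bij_E[of t]] by metis
  have "kappa t = \<kappa>"
    using \<kappa>(2)[of "ball 0 1"] measure_ball_pos[of 1 "0::real^'n"] by (simp add: kappa_def)
  then show "kappa t > 0" using \<kappa>(1) by simp
  show "measure lborel (E t ` S) = kappa t * measure lborel S" if "open S" "bounded S"
    using \<kappa>(2)[OF that] \<open>kappa t = \<kappa>\<close> by simp
qed

lemma open_E_image: "open S \<Longrightarrow> open (E t ` S)"
  by (rule open_surjective_linear_image[OF _ linear_E bij_is_surj[OF bij_E]])

lemma bounded_E_image: "bounded S \<Longrightarrow> bounded (E t ` S)"
  by (rule bounded_linear_image[OF _ linear_conv_bounded_linear[THEN iffD1, OF linear_E]])

lemma kappa_add: "kappa (s + t) = kappa s * kappa t"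
proof -
  have "E (s + t) ` ball 0 1 = E s ` (E t ` ball 0 1)" by (simp add: image_image E_add)
  then show ?thesis
    by (simp add: kappa_def[of "s + t"] measure_E_image open_E_image bounded_E_image)
qed

lemma kappa_0: "kappa 0 = 1"
  using measure_ball_pos[of 1 "0::real^'n"] by (simp add: kappa_def)

text \<open>For \<open>E t = e\<^sup>t\<^sup>A\<close> the number \<open>growth\<close> is the trace of \<open>A\<close>.\<close>

definition growth :: real where "growth = ln (kappa 1)"

lemma kappa_nat: "kappa (real m) = exp (growth * m)"
proof (induction m)
  case (Suc m)
  have "kappa (real (Suc m)) = kappa 1 * kappa (real m)"
    by (metis add.commute kappa_add of_nat_Suc)
  then show ?case using kappa_pos[of 1] by (simp add: Suc growth_def algebra_simps exp_add)
qed (simp add: kappa_0)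

lemma kappa_minus_nat: "kappa (- real m) = exp (- growth * m)"
proof -
  have "kappa (real m) * kappa (- real m) = 1" by (simp flip: kappa_add add: kappa_0)
  then show ?thesis by (simp add: kappa_nat exp_minus field_simps)
qed

text \<open>At integers \<open>kappa\<close> is exactly exponential. For the fractional part
  \<open>f\<close> of \<open>s\<close>, the map \<open>E (- f)\<close> expands by at most
  \<open>C\<close>, so \<open>E f\<close> maps the unit ball onto a set containing the ball of
  radius \<open>1 / C\<close>. The factor \<open>exp (- \<bar>growth\<bar>)\<close> pays for the
  rounding of \<open>s\<close>.\<close>

lemma kappa_lower:
  obtains c where "c > 0" "\<And>s. kappa s \<ge> c * exp (growth * s)"
proof -
  obtain C a where C: "C > 0" "a > 0" "\<And>t x. t \<ge> 0 \<Longrightarrow> norm (E (- t) x) \<le> C * exp (- a * t) * norm x"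
    by (rule decay_exp) metis
  define c0 where "c0 = measure lborel (ball (0::real^'n) (1 / C)) / measure lborel (ball (0::real^'n) 1)"
  have c0: "c0 > 0" unfolding c0_def using C(1) by (intro divide_pos_pos measure_ball_pos) auto
  have frac: "kappa f \<ge> c0" if f: "f \<ge> 0" for f
  proof -
    have "ball 0 (1 / C) \<subseteq> E f ` ball 0 1"
    proof
      fix x :: "real^'n" assume x: "x \<in> ball 0 (1 / C)"
      have "norm (E (- f) x) \<le> C * exp (- a * f) * norm x" by (rule C(3)[OF f])
      also have "\<dots> \<le> C * 1 * norm x" using C(1,2) f by (intro mult_right_mono mult_left_mono) auto
      also have "\<dots> < 1" using x C(1) by (simp add: field_simps)
      finally show "x \<in> E f ` ball 0 1" by (intro image_eqI[of _ _ "E (- f) x"]) auto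
    qed
    then have "measure lborel (ball (0::real^'n) (1 / C)) \<le> measure lborel (E f ` ball 0 1)"
      using emeasure_bounded_finite[OF bounded_E_image[of "ball 0 1" f]]
      by (intro measure_mono_fmeasurable fmeasurableI) (auto intro!: borel_open open_E_image)
    then show ?thesis
      unfolding c0_def kappa_def using measure_ball_pos[of 1 "0::real^'n"] by (intro divide_right_mono) auto
  qed
  have int: "kappa (of_int m) = exp (growth * of_int m)" for m
  proof (cases "m \<ge> 0")
    case True then show ?thesis using kappa_nat[of "nat m"] by simp
  next
    case False then show ?thesis using kappa_minus_nat[of "nat (- m)"] by simp
  qed
  have "kappa s \<ge> c0 * exp (- \<bar>growth\<bar>) * exp (growth * s)" for s
  proof -
    define m where "m = \<lfloor>s\<rfloor>"
    define f where "f = s - of_int m"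
    have f: "0 \<le> f" "f \<le> 1" by (auto simp: f_def m_def) linarith
    have "growth * f \<le> \<bar>growth\<bar> * 1" using f by (intro mult_mono) auto
    then have "- \<bar>growth\<bar> + growth * s \<le> growth * of_int m" by (simp add: f_def algebra_simps)
    then have "exp (- \<bar>growth\<bar>) * exp (growth * s) \<le> exp (growth * of_int m)" by (simp flip: exp_add)
    then have "c0 * (exp (- \<bar>growth\<bar>) * exp (growth * s)) \<le> kappa f * kappa (of_int m)"
      using frac[OF f(1)] c0 by (intro mult_mono) (auto simp: int)
    then show ?thesis by (simp add: f_def mult.assoc flip: kappa_add)
  qed
  then show ?thesis using c0 by (intro that[of "c0 * exp (- \<bar>growth\<bar>)"]) auto
qed

text \<open>\<open>E (- m)\<close> maps the unit ball into a ball of radius about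
  \<open>exp (- lam * m) * m ^ k\<close>; comparing volumes as \<open>m\<close> grows gives even
  \<open>CARD('n) * lam \<le> growth\<close>. The stated bound is what makes the exponent
  \<open>growth / lam\<close> admissible in Hoelder's inequality.\<close>

lemma lam_le_growth: "lam \<le> growth"
proof (rule ccontr)
  assume "\<not> lam \<le> growth"
  obtain C0 where C0: "\<And>t x. t \<ge> 0 \<Longrightarrow> norm (E (- t) x) \<le> C0 * (exp (- lam * t) * (1 + t) ^ k) * norm x"
    using decay by blast
  define C where "C = \<bar>C0\<bar> + 1"
  define d where "d = CARD('n)"
  have d: "d \<ge> 1" by (simp add: d_def Suc_leI)
  define b where "b = real d * lam - growth"
  have "lam \<le> real d * lam" using d lam_pos by simp
  then have b: "b > 0" using \<open>\<not> lam \<le> growth\<close> by (simp add: b_def)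
  have C: "C > 0" "\<And>t x. t \<ge> 0 \<Longrightarrow> norm (E (- t) x) \<le> C * (exp (- lam * t) * (1 + t) ^ k) * norm x"
  proof -
    show "C > 0" by (simp add: C_def)
    fix t :: real and x :: "real^'n" assume t: "t \<ge> 0"
    have "C0 * (exp (- lam * t) * (1 + t) ^ k) * norm x \<le> C * (exp (- lam * t) * (1 + t) ^ k) * norm x"
      using t by (intro mult_right_mono) (auto simp: C_def)
    with C0[OF t, of x] show "norm (E (- t) x) \<le> C * (exp (- lam * t) * (1 + t) ^ k) * norm x" by linarith
  qed
  have "1 / C ^ d \<le> (1 + 1 * real m) ^ (k * d) * exp (- b * real m)" for m :: nat
  proof -
    define r where "r = C * (exp (- lam * real m) * (1 + real m) ^ k)"
    have r: "r > 0" unfolding r_def using C(1) by simp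
    have "E (- real m) ` ball 0 1 \<subseteq> ball 0 r"
    proof clarify
      fix x :: "real^'n" assume "x \<in> ball 0 1"
      then have "norm (E (- real m) x) < r"
        using C(2)[of "real m" x] mult_strict_left_mono[of "norm x" 1 r] r by (simp add: r_def)
      then show "E (- real m) x \<in> ball 0 r" by simp
    qed
    then have "measure lborel (E (- real m) ` ball 0 1) \<le> measure lborel (ball (0::real^'n) r)"
      by (intro measure_mono_fmeasurable fmeasurableI emeasure_lborel_ball_finite)
        (auto intro!: borel_open open_E_image)
    also have "\<dots> = r ^ d * measure lborel (ball (0::real^'n) 1)"
      using r by (simp add: content_ball d_def)
    finally have "exp (- growth * m) \<le> r ^ d"
      using measure_ball_pos[of 1 "0::real^'n"] by (simp add: measure_E_image kappa_minus_nat)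
    also have "r ^ d = C ^ d * ((1 + real m) ^ (k * d) * exp (- (real d * lam * m)))"
      by (simp add: r_def power_mult_distrib exp_of_nat_mult[symmetric] mult_ac flip: power_mult)
    finally have "exp (growth * m) * exp (- growth * m)
        \<le> exp (growth * m) * (C ^ d * ((1 + real m) ^ (k * d) * exp (- (real d * lam * m))))" by simp
    also have "exp (growth * m) * exp (- growth * m) = 1" by (simp flip: exp_add)
    also have "exp (growth * m) * (C ^ d * ((1 + real m) ^ (k * d) * exp (- (real d * lam * m))))
        = C ^ d * ((1 + real m) ^ (k * d) * (exp (growth * m) * exp (- (real d * lam * m))))" by simp
    also have "exp (growth * m) * exp (- (real d * lam * m)) = exp (- b * real m)"
      by (simp add: b_def algebra_simps flip: exp_add)
    finally show ?thesis using C(1) by (simp add: field_simps)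
  qed
  moreover have "(\<lambda>m. (1 + 1 * real m) ^ (k * d) * exp (- b * real m)) \<longlonglongrightarrow> 0"
    by (rule filterlim_compose[OF exp_dominates_power[OF b] filterlim_real_sequentially])
  ultimately have "1 / C ^ d \<le> 0" by (intro tendsto_lowerbound) auto
  moreover have "1 / C ^ d > 0" using C(1) by simp
  ultimately show False by linarith
qed

text \<open>The points \<open>E (- T) z\<close> with \<open>z\<close> in this set form a grid in the
  ball of radius \<open>R\<close>, and distinct grid points are at least a constant times
  \<open>exp (- T)\<close> apart in \<open>rho\<close>.\<close>

definition lattice :: "nat \<Rightarrow> real \<Rightarrow> (real^'n) set" where
  "lattice T R = {z \<in> integer_vectors. norm (E (- real T) z) \<le> R}"

lemma finite_lattice: "finite (lattice T R)"
proof -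
  obtain K where K: "K > 0" "\<And>x. norm (E (real T) x) \<le> K * norm x" by (rule E_bound[of "real T"]) metis
  have "lattice T R \<subseteq> {z \<in> integer_vectors. norm z \<le> K * R}"
  proof
    fix z assume z: "z \<in> lattice T R"
    have "norm z \<le> K * norm (E (- real T) z)" using K(2)[of "E (- real T) z"] by simp
    also have "\<dots> \<le> K * R" using z K(1) by (simp add: lattice_def)
    finally show "z \<in> {z \<in> integer_vectors. norm z \<le> K * R}" using z by (simp add: lattice_def)
  qed
  then show ?thesis using finite_bounded_integer_vectors finite_subset by blast
qed

text \<open>Packing: balls of radius \<open>1 / 2\<close> around integer points are disjoint, and
  after contraction they have volume \<open>exp (- growth * T) * v\<close> each and stay in the ball
  of radius \<open>R + C\<close>.\<close>

lemma card_lattice_upper: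
  obtains C where "C > 0" "\<And>T. real (card (lattice T R)) \<le> C * exp (growth * T)"
proof -
  obtain C a where C: "C > 0" "a > 0" "\<And>t x. t \<ge> 0 \<Longrightarrow> norm (E (- t) x) \<le> C * exp (- a * t) * norm x"
    by (rule decay_exp) metis
  define v where "v = measure lborel (ball (0::real^'n) (1 / 2))"
  define V where "V = measure lborel (ball (0::real^'n) (R + C))"
  have v: "v > 0" unfolding v_def by (rule measure_ball_pos) simp
  have V: "V \<ge> 0" by (simp add: V_def)
  have "real (card (lattice T R)) \<le> V / v * exp (growth * T)" for T
  proof -
    have "(\<Sum>z\<in>lattice T R. measure lborel (E (- real T) ` ball z (1 / 2))) \<le> V"
      unfolding V_def
    proof (rule sum_measure_disjoint_le[OF finite_lattice])
      show "disjoint_family_on (\<lambda>z. E (- real T) ` ball z (1 / 2)) (lattice T R)"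
        unfolding disjoint_family_on_def
      proof (intro ballI impI)
        fix y z assume yz: "y \<in> lattice T R" "z \<in> lattice T R" "y \<noteq> z"
        have "norm (y - z) \<ge> 1"
          using yz by (intro norm_integer_vector_ge_1 integer_vectors_diff) (auto simp: lattice_def)
        then have "ball y (1 / 2) \<inter> ball z (1 / 2) = {}"
          by (intro disjoint_ballI) (simp add: dist_norm)
        then show "E (- real T) ` ball y (1 / 2) \<inter> E (- real T) ` ball z (1 / 2) = {}"
          using bij_is_inj[OF bij_E] by (metis image_Int image_empty)
      qed
      fix z assume z: "z \<in> lattice T R"
      show "open (E (- real T) ` ball z (1 / 2))" by (simp add: open_E_image)
      show "E (- real T) ` ball z (1 / 2) \<subseteq> ball 0 (R + C)"
      proof clarify
        fix x assume "x \<in> ball z (1 / 2)"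
        then have x: "norm (x - z) \<le> 1 / 2" by (simp add: dist_norm norm_minus_commute)
        have "norm (E (- real T) (x - z)) \<le> C * exp (- a * T) * norm (x - z)" by (rule C(3)) simp
        also have "\<dots> \<le> C * 1 * (1 / 2)" using C(1,2) x by (intro mult_mono) auto
        also have "\<dots> < C" using C(1) by simp
        finally have "norm (E (- real T) x - E (- real T) z) < C" by (simp add: E_diff)
        moreover have "norm (E (- real T) z) \<le> R" using z by (simp add: lattice_def)
        ultimately show "E (- real T) x \<in> ball 0 (R + C)"
          using norm_triangle_ineq2[of "E (- real T) x" "E (- real T) z"] by simp
      qed
    qed
    moreover have "measure lborel (E (- real T) ` ball z (1 / 2)) = exp (- growth * T) * v" for z
      using content_ball[of "1/2" z] content_ball[of "1/2" "0::real^'n"]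
      by (simp add: measure_E_image kappa_minus_nat v_def)
    ultimately have "real (card (lattice T R)) * (exp (- growth * T) * v) \<le> V" by simp
    then have "exp (growth * T) * (exp (- (growth * T)) * (real (card (lattice T R)) * v)) \<le> exp (growth * T) * V"
      by (simp add: mult_ac)
    then have "real (card (lattice T R)) * v \<le> exp (growth * T) * V" by (simp only: exp_minus_cancel)
    then show ?thesis using v by (simp add: field_simps)
  qed
  then have "real (card (lattice T R)) \<le> (V / v + 1) * exp (growth * T)" for T
    by (rule order_trans) (simp add: algebra_simps)
  then show ?thesis using V v by (intro that[of "V / v + 1"]) (auto simp: add_nonneg_pos)
qed

text \<open>Covering: a point \<open>y\<close> near 0 is expanded by \<open>E T\<close>, rounded to
  an integer point and contracted again. From \<open>T0\<close> on, the contracted rounding error is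
  below \<open>R / 2\<close>, so the integer point belongs to the lattice.\<close>

lemma card_lattice_lower:
  assumes "R > 0"
  obtains c T0 where "c > 0" "\<And>T. T \<ge> T0 \<Longrightarrow> c * exp (growth * real T) \<le> card (lattice T R)"
proof -
  obtain C a where C: "C > 0" "a > 0" "\<And>t x. t \<ge> 0 \<Longrightarrow> norm (E (- t) x) \<le> C * exp (- a * t) * norm x"
    by (rule decay_exp) metis
  define n where "n = real CARD('n) + 1"
  define v where "v = measure lborel (ball (0::real^'n) n)"
  define V where "V = measure lborel (ball (0::real^'n) (R / 2))"
  have n: "n > 0" by (simp add: n_def)
  have vV: "v > 0" "V > 0" unfolding v_def V_def using n assms by (auto intro: measure_ball_pos)
  have "(\<lambda>T. exp (- a * real T)) \<longlonglongrightarrow> 0"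
    using filterlim_compose[OF exp_dominates_power[OF C(2), of 0 0] filterlim_real_sequentially] by simp
  then have "\<forall>\<^sub>F T in sequentially. exp (- a * real T) < R / (2 * C * n)"
    using assms C(1) n by (intro order_tendstoD(2)) auto
  then obtain T0 where T0: "\<And>T. T \<ge> T0 \<Longrightarrow> exp (- a * real T) < R / (2 * C * n)"
    by (auto simp: eventually_sequentially)
  have "V / v * exp (growth * real T) \<le> card (lattice T R)" if "T \<ge> T0" for T
  proof -
    have "V \<le> (\<Sum>z\<in>lattice T R. measure lborel (E (- real T) ` ball z n))"
      unfolding V_def
    proof (rule measure_cover_le[OF finite_lattice])
      fix z show "open (E (- real T) ` ball z n)" "bounded (E (- real T) ` ball z n)"
        by (auto intro: open_E_image bounded_E_image)
    next
      show "ball 0 (R / 2) \<subseteq> (\<Union>z\<in>lattice T R. E (- real T) ` ball z n)"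
      proof
        fix y :: "real^'n" assume y: "y \<in> ball 0 (R / 2)"
        define u where "u = E (real T) y"
        define z where "z = floor_vec u"
        have uz: "norm (u - z) < n" using norm_diff_floor_vec[of u] by (simp add: z_def n_def)
        have yu: "y = E (- real T) u" by (simp add: u_def)
        have "norm (E (- real T) (u - z)) \<le> C * exp (- a * T) * norm (u - z)" by (rule C(3)) simp
        also have "\<dots> \<le> C * exp (- a * T) * n" using uz C(1) by simp
        also have "\<dots> < R / 2" using T0[OF that] C(1) n by (simp add: field_simps)
        finally have "norm (y - E (- real T) z) < R / 2" by (simp add: E_diff flip: yu)
        then have "norm (E (- real T) z) \<le> R"
          using y norm_triangle_ineq2[of "E (- real T) z" y] by (simp add: norm_minus_commute)
        then have "z \<in> lattice T R" by (simp add: lattice_def z_def)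
        moreover have "u \<in> ball z n" using uz by (simp add: dist_norm norm_minus_commute)
        ultimately show "y \<in> (\<Union>z\<in>lattice T R. E (- real T) ` ball z n)" using yu by blast
      qed
    qed
    also have "\<dots> = card (lattice T R) * (exp (- growth * T) * v)"
    proof -
      have "measure lborel (E (- real T) ` ball z n) = exp (- growth * T) * v" for z
        using content_ball[of n z] content_ball[of n "0::real^'n"] n
        by (simp add: measure_E_image kappa_minus_nat v_def)
      then show ?thesis by simp
    qed
    finally have "exp (growth * T) * V \<le> exp (growth * T) * (exp (- (growth * T)) * (card (lattice T R) * v))"
      by (simp add: mult_ac)
    then have "exp (growth * T) * V \<le> card (lattice T R) * v" by (simp only: exp_minus_cancel)
    then show ?thesis using vV by (simp add: field_simps)
  qed
  then show ?thesis using vV by (intro that[of "V / v" T0]) auto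
qed

end

section \<open>Controlled maps between expanding flows\<close>

text \<open>A pointwise substitute for Hoelder's inequality. Summed over \<open>m\<close> terms for
  which the sum of \<open>a powr p\<close> is bounded, the choice
  \<open>s = m powr (- 1 / p)\<close> gives Hoelder's bound up to a constant.\<close>

lemma le_scaled_powr_add:
  fixes a s p :: real
  assumes "a \<ge> 0" "s > 0" "p \<ge> 1"
  shows "a \<le> s powr (1 - p) * a powr p + s"
proof (cases "a \<le> s")
  case True
  then show ?thesis by (simp add: add_increasing)
next
  case False
  then have a: "a > 0" using assms by simp
  have "a = a powr (1 - p) * a powr p" using a by (simp flip: powr_add)
  also have "\<dots> \<le> s powr (1 - p) * a powr p"
    using False assms by (intro mult_right_mono powr_mono2') auto
  finally show ?thesis using assms(2) by linarith
qed

text \<open>Quasisymmetry without quotients: points may coincide, and all that is kept of the gauge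
  are its sign and its limit at 0. The values of \<open>h\<close> at large \<open>s\<close> serve to
  compare different directions at one scale, the limit makes images of small steps small.\<close>

locale controlled_map =
  A: expanding_flow EA NA lA kA HA + B: expanding_flow EB NB lB kB HB
  for EA :: "real \<Rightarrow> real^'n \<Rightarrow> real^'n" and NA lA kA HA
  and EB :: "real \<Rightarrow> real^'n \<Rightarrow> real^'n" and NB lB kB HB +
  fixes h :: "real \<Rightarrow> real" and F :: "real^'n \<Rightarrow> real^'n"
  assumes h_nonneg: "h s \<ge> 0"
    and h_tendsto: "(h \<longlongrightarrow> 0) (at_right 0)"
    and control: "\<lbrakk>s > 0; A.rho (x - y) \<le> s * A.rho (x - z)\<rbrakk> \<Longrightarrow>
      B.rho (F x - F y) \<le> h s * B.rho (F x - F z)"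
    and inj_F: "inj F"
begin

section \<open>Image steps at a given scale\<close>

definition ones :: "real^'n" where "ones = (\<chi> i. 1)"

lemma ones_nonzero [simp]: "ones \<noteq> 0"
  by (simp add: ones_def cart_eq_iff)

text \<open>The size of the image near \<open>y\<close> at scale \<open>exp (- t)\<close>. The
  vector \<open>ones\<close> is an arbitrary nonzero reference direction; by \<open>control\<close>,
  displacements of comparable \<open>rho\<close> in other directions have comparable images.\<close>

definition step :: "real^'n \<Rightarrow> real \<Rightarrow> real" where
  "step y t = B.rho (F y - F (y + EA (- t) ones))"

lemma step_pos: "step y t > 0"
  using inj_F by (simp add: step_def inj_eq)

lemma step_le:
  assumes "s > 0" "A.rho (y - z) \<le> s * (exp (- t) * A.rho ones)"
  shows "B.rho (F y - F z) \<le> h s * step y t"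
  unfolding step_def using assms by (intro control) (simp_all add: A.rho_E)

lemma image_bounded:
  obtains M where "M > 0" "\<And>y. norm y \<le> R \<Longrightarrow> B.rho (F y - F 0) \<le> M" "\<And>y. norm y \<le> R \<Longrightarrow> norm (F y) \<le> M"
proof -
  obtain C where C: "C > 0" "\<And>y. norm y \<le> R \<Longrightarrow> A.rho y \<le> C" by (rule A.rho_bounded[where b=R]) metis
  define s where "s = C / A.rho ones"
  have s: "s > 0" using C(1) by (simp add: s_def)
  define M0 where "M0 = h s * step 0 0"
  have 1: "B.rho (F 0 - F y) \<le> M0" if "norm y \<le> R" for y
    unfolding M0_def using C(2)[OF that] s by (intro step_le) (auto simp: s_def)
  then have 1: "B.rho (F y - F 0) \<le> M0" if "norm y \<le> R" for y
    using B.rho_uminus[of "F 0 - F y"] that by simp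
  obtain M1 where M1: "M1 > 0" "\<And>v. B.rho v \<le> M0 \<Longrightarrow> norm v \<le> M1" by (rule B.norm_bounded_by_rho[where b=M0]) metis
  have "norm (F y) \<le> M1 + norm (F 0)" if "norm y \<le> R" for y
    using M1(2)[OF 1[OF that]] norm_triangle_ineq2[of "F y" "F 0"] by linarith
  then show ?thesis
    using 1 M1(1) by (intro that[of "max \<bar>M0\<bar> (M1 + norm (F 0))"]) (auto simp: less_max_iff_disj add_pos_nonneg le_max_iff_disj, fastforce)
qed

lemma step_0_bounded:
  obtains M where "M > 0" "\<And>y. norm y \<le> R \<Longrightarrow> step y 0 \<le> M"
proof -
  obtain M where M: "M > 0" "\<And>y. norm y \<le> R + norm ones \<Longrightarrow> B.rho (F y - F 0) \<le> M"
    by (rule image_bounded[where R="R + norm ones"]) metis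
  obtain K where K: "K \<ge> 1" "\<And>v w. B.rho (v + w) \<le> K * (B.rho v + B.rho w)"
    by (rule B.rho_triangle) metis
  have "step y 0 \<le> K * (M + M)" if y: "norm y \<le> R" for y
  proof -
    have 1: "B.rho (F y - F 0) \<le> M" using y by (intro M(2)) (simp add: add_increasing2)
    have "norm (y + ones) \<le> R + norm ones" using norm_triangle_ineq[of y ones] y by linarith
    then have 2: "B.rho (F 0 - F (y + ones)) \<le> M"
      using M(2)[of "y + ones"] B.rho_uminus[of "F 0 - F (y + ones)"] by simp
    have "step y 0 \<le> K * (B.rho (F y - F 0) + B.rho (F 0 - F (y + ones)))"
      using K(2)[of "F y - F 0" "F 0 - F (y + ones)"] by (simp add: step_def)
    also have "\<dots> \<le> K * (M + M)" using 1 2 K(1) by (intro mult_left_mono) auto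
    finally show ?thesis .
  qed
  then show ?thesis using K(1) M(1) by (intro that[of "K * (M + M)"]) auto
qed

lemma step_antimono_bound:
  assumes "t \<le> t'"
  shows "step y t' \<le> h (exp (t - t')) * step y t"
  unfolding step_def by (intro control) (auto simp: A.rho_E simp flip: exp_add)

lemma step_small:
  assumes "\<epsilon> > 0"
  obtains T0 where "\<And>t y. \<lbrakk>t \<ge> T0; norm y \<le> R\<rbrakk> \<Longrightarrow> step y t < \<epsilon>"
proof -
  obtain M where M: "M > 0" "\<And>y. norm y \<le> R \<Longrightarrow> step y 0 \<le> M" by (rule step_0_bounded[where R=R]) metis
  have "filterlim (\<lambda>t::real. exp (- t)) (at_right 0) at_top"
    unfolding at_within_def filterlim_inf filterlim_principal
    using filterlim_compose[OF exp_at_bot filterlim_uminus_at_bot_at_top] by simp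
  from filterlim_compose[OF h_tendsto this]
  have "\<forall>\<^sub>F t in at_top. h (exp (- t)) < \<epsilon> / M" using assms M(1) by (intro order_tendstoD(2)) auto
  then obtain T0 where T0: "\<And>t. t \<ge> T0 \<Longrightarrow> h (exp (- t)) < \<epsilon> / M"
    by (auto simp: eventually_at_top_linorder)
  have "step y t < \<epsilon>" if "t \<ge> max 0 T0" "norm y \<le> R" for t y
  proof -
    have "step y t \<le> h (exp (- t)) * step y 0" using step_antimono_bound[of 0 t y] that by simp
    also have "\<dots> \<le> h (exp (- t)) * M" using M(2)[OF that(2)] h_nonneg by (intro mult_left_mono) auto
    also have "\<dots> < \<epsilon>" using T0[of t] that M(1) by (simp add: field_simps)
    finally show ?thesis .
  qed
  then show ?thesis by (rule that)
qed

text \<open>An image step loses at most the factor \<open>G\<close> when the scale is divided by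
  \<open>exp 1\<close>, so it decays at most geometrically in \<open>T\<close>. This keeps
  \<open>- ln (step y T)\<close> below a multiple of \<open>T\<close>, so that polynomial factors in
  the one can be compared with powers of the other.\<close>

lemma step_lower:
  obtains \<beta> where "\<beta> > 0" "\<And>T y. \<lbrakk>T \<ge> 1; norm y \<le> R\<rbrakk> \<Longrightarrow> exp (- \<beta> * real T) \<le> step y (real T)"
proof -
  obtain C where C: "C > 0" "\<And>y. norm y \<le> \<bar>R\<bar> + norm ones \<Longrightarrow> A.rho y \<le> C" by (rule A.rho_bounded[where b="\<bar>R\<bar> + norm ones"]) metis
  obtain K where K: "K \<ge> 1" "\<And>v w. B.rho (v + w) \<le> K * (B.rho v + B.rho w)"
    by (rule B.rho_triangle) metis
  define s where "s = C / A.rho ones"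
  have s: "s > 0" using C(1) by (simp add: s_def)
  define d where "d = step 0 0"
  have d: "d > 0" unfolding d_def by (rule step_pos)
  define c where "c = d / (2 * K * (h s + 1))"
  have c: "c > 0" using d K(1) h_nonneg[of s] by (simp add: c_def)
  \<comment> \<open>The points \<open>F 0\<close> and \<open>F ones\<close> have distance
    \<open>d\<close>. By the quasi-triangle inequality they cannot both be close to
    \<open>F y\<close>, while both distances from \<open>F y\<close> are controlled by the step at
    \<open>y\<close>.\<close>
  have 0: "c \<le> step y 0" if y: "norm y \<le> R" for y
  proof -
    have "norm y \<le> \<bar>R\<bar> + norm ones" using y norm_ge_zero[of ones] by linarith
    then have 1: "B.rho (F y - F 0) \<le> h s * step y 0" using C(2) s by (intro step_le) (auto simp: s_def)
    have "norm (y - ones) \<le> \<bar>R\<bar> + norm ones" using norm_triangle_ineq4[of y ones] y by linarith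
    then have 2: "B.rho (F y - F ones) \<le> h s * step y 0" using C(2) s by (intro step_le) (auto simp: s_def)
    have "d \<le> K * (B.rho (F 0 - F y) + B.rho (F y - F ones))"
      using K(2)[of "F 0 - F y" "F y - F ones"] by (simp add: d_def step_def)
    also have "\<dots> \<le> K * (h s * step y 0 + h s * step y 0)"
      using 1 2 K(1) B.rho_uminus[of "F y - F 0"] by (intro mult_left_mono add_mono) auto
    also have "\<dots> \<le> 2 * K * (h s + 1) * step y 0" using K(1) step_pos[of y 0] by (simp add: algebra_simps)
    finally have "d \<le> 2 * K * (h s + 1) * step y 0" .
    moreover have "0 < 2 * K * (h s + 1)" using K(1) h_nonneg[of s] by simp
    ultimately show ?thesis by (simp only: c_def pos_divide_le_eq mult.commute)
  qed
  define G where "G = max 1 (h (exp 1))"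
  have G: "G \<ge> 1" by (simp add: G_def)
  have iter: "step y 0 \<le> G ^ T * step y (real T)" for y T
  proof (induction T)
    case (Suc T)
    have "step y (real T) \<le> h (exp 1) * step y (real (Suc T))"
      unfolding step_def by (intro control) (auto simp: A.rho_E simp flip: exp_add)
    also have "\<dots> \<le> G * step y (real (Suc T))" using step_pos[of y] by (intro mult_right_mono) (auto simp: G_def intro: less_imp_le)
    finally have "G ^ T * step y (real T) \<le> G ^ T * (G * step y (real (Suc T)))"
      using G by (intro mult_left_mono) auto
    with Suc show ?case unfolding power_Suc by (metis mult.assoc mult.commute order_trans)
  qed simp
  \<comment> \<open>Since \<open>T \<ge> 1\<close>, the constant \<open>c\<close> can be absorbed
    into the rate.\<close>
  define \<beta> where "\<beta> = ln G + \<bar>ln c\<bar> + 1"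
  have "exp (- \<beta> * real T) \<le> step y (real T)" if T: "T \<ge> 1" and y: "norm y \<le> R" for T y
  proof -
    have "c \<le> G ^ T * step y (real T)" using 0[OF y] iter[of y T] by linarith
    moreover have "G ^ T = exp (ln G * real T)" using G by (simp add: exp_of_nat2_mult)
    ultimately have "exp (- (ln G * real T)) * c \<le> exp (- (ln G * real T)) * (exp (ln G * real T) * step y (real T))"
      by (intro mult_left_mono) auto
    moreover have "exp (- (ln G * real T)) * (exp (ln G * real T) * step y (real T)) = step y (real T)"
      using exp_minus_cancel[of "- (ln G * real T)" "step y (real T)"] by (simp only: minus_minus)
    ultimately have *: "exp (- (ln G * real T)) * c \<le> step y (real T)" by (simp only:)
    have "\<bar>ln c\<bar> * 1 \<le> \<bar>ln c\<bar> * real T" using T by (intro mult_left_mono) auto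
    then have "- \<beta> * real T \<le> - (ln G * real T) + ln c" using T by (simp add: \<beta>_def algebra_simps)
    then have "exp (- \<beta> * real T) \<le> exp (- (ln G * real T)) * exp (ln c)" by (simp flip: exp_add)
    with * show ?thesis using c by simp
  qed
  moreover have "\<beta> > 0" using G by (simp add: \<beta>_def add_nonneg_pos)
  ultimately show ?thesis by (intro that[of \<beta>])
qed

lemma step_dominates:
  obtains C where "C > 0" "\<And>y v t. norm v \<le> R \<Longrightarrow> B.rho (F y - F (y + EA (- t) v)) \<le> C * step y t"
proof -
  obtain D where D: "D > 0" "\<And>y. norm y \<le> R \<Longrightarrow> A.rho y \<le> D" by (rule A.rho_bounded[where b=R]) metis
  define s where "s = D / A.rho ones"
  have s: "s > 0" using D(1) by (simp add: s_def)
  have "B.rho (F y - F (y + EA (- t) v)) \<le> (h s + 1) * step y t" if "norm v \<le> R" for y v t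
  proof -
    have "B.rho (F y - F (y + EA (- t) v)) \<le> h s * step y t"
      using D(2)[OF that] s by (intro step_le) (auto simp: s_def A.rho_E)
    also have "\<dots> \<le> (h s + 1) * step y t" using step_pos[of y t] by (intro mult_right_mono) auto
    finally show ?thesis .
  qed
  then show ?thesis using h_nonneg[of s] by (intro that[of "h s + 1"]) auto
qed

lemma F_continuous:
  assumes "\<epsilon> > 0"
  obtains \<delta> where "\<delta> > 0" "\<And>y. norm (y - x) < \<delta> \<Longrightarrow> norm (F y - F x) < \<epsilon>"
proof -
  obtain c where c: "c > 0" "\<And>v. norm v \<ge> \<epsilon> \<Longrightarrow> B.rho v \<ge> c" using B.rho_away[OF assms] by metis
  have "\<forall>\<^sub>F s in at_right 0. h s < c / step x 0"
    using c(1) step_pos[of x 0] by (intro order_tendstoD(2)[OF h_tendsto]) auto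
  then obtain b where b: "b > 0" "\<And>s. 0 < s \<Longrightarrow> s < b \<Longrightarrow> h s < c / step x 0"
    by (auto simp: eventually_at_right_field)
  define s where "s = b / 2"
  have s: "s > 0" "h s < c / step x 0" using b by (auto simp: s_def)
  obtain \<delta> where \<delta>: "\<delta> > 0" "\<And>v. norm v < \<delta> \<Longrightarrow> A.rho v < s * A.rho ones"
    using A.rho_small[of "s * A.rho ones"] s(1) by auto
  have "norm (F y - F x) < \<epsilon>" if "norm (y - x) < \<delta>" for y
  proof -
    have "A.rho (x - y) < s * A.rho ones" using \<delta>(2)[of "x - y"] that by (simp add: norm_minus_commute)
    then have "B.rho (F x - F y) \<le> h s * step x 0" using s(1) by (intro step_le) auto
    also have "\<dots> < c" using s(2) step_pos[of x 0] by (simp add: field_simps)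
    finally have "B.rho (F y - F x) < c" using B.rho_uminus[of "F x - F y"] by simp
    then show ?thesis using c(2) by (meson not_le)
  qed
  then show ?thesis using \<delta>(1) by (intro that)
qed

text \<open>Around the image of each grid point there is a quasiball whose radius is proportional to
  the image step there. These sets are disjoint, because by \<open>control\<close> the images of
  distinct grid points are separated by a multiple of either step, and they lie in a bounded region.
  Their volumes are of order step to the power \<open>B.growth\<close>.\<close>

lemma sum_step_growth_bounded:
  obtains C where "C > 0"
    "\<And>T. (\<Sum>z\<in>A.lattice T R. step (EA (- real T) z) (real T) powr B.growth) \<le> C"
proof -
  obtain K where K: "K \<ge> 1" "\<And>v w. B.rho (v + w) \<le> K * (B.rho v + B.rho w)"
    by (rule B.rho_triangle) metis
  obtain c0 where c0: "c0 > 0" "\<And>v. norm v \<ge> 1 \<Longrightarrow> A.rho v \<ge> c0" using A.rho_away[of 1] by auto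
  \<comment> \<open>Distinct integer points are at \<open>rho\<close>-distance at least
    \<open>c0\<close>, so at every scale the reference step is at most \<open>s\<close> times the
    distance of two grid points.\<close>
  define s where "s = A.rho ones / c0"
  have s: "s > 0" using c0 by (simp add: s_def)
  \<comment> \<open>Chosen so that \<open>2 * K * cc * h s < 1\<close>: if two quasiballs met, their
    centres would be closer than \<open>control\<close> permits.\<close>
  define cc where "cc = 1 / (2 * K * (h s + 1))"
  have cc: "cc > 0" using K(1) h_nonneg[of s] by (simp add: cc_def add_nonneg_pos)
  obtain \<delta> where \<delta>: "\<delta> > 0" "\<And>v. norm v < \<delta> \<Longrightarrow> B.rho v < cc" using B.rho_small[OF cc] by metis
  obtain M1 where M1: "M1 > 0" "\<And>y. norm y \<le> R \<Longrightarrow> norm (F y) \<le> M1" by (rule image_bounded[where R=R]) metis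
  obtain M2 where M2: "M2 > 0" "\<And>y. norm y \<le> R \<Longrightarrow> step y 0 \<le> M2" by (rule step_0_bounded[where R=R]) metis
  have step_bd: "step y t \<le> h 1 * M2 + h 1 * M2" if "norm y \<le> R" "t \<ge> 0" for y t
  proof -
    have "step y t \<le> h 1 * step y 0"
      unfolding step_def using that(2) by (intro control) (auto simp: A.rho_E mult_left_le_one_le)
    also have "\<dots> \<le> h 1 * M2" using M2(2)[OF that(1)] h_nonneg by (intro mult_left_mono)
    finally show ?thesis using h_nonneg[of 1] M2(1) by (smt (verit) mult_nonneg_nonneg)
  qed
  define M3 where "M3 = h 1 * M2 + h 1 * M2"
  have M3: "M3 \<ge> 0" using h_nonneg[of 1] M2(1) by (simp add: M3_def)
  obtain M4 where M4: "M4 > 0" "\<And>v. B.rho v \<le> M3 * cc \<Longrightarrow> norm v \<le> M4" by (rule B.norm_bounded_by_rho[where b="M3 * cc"]) metis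
  obtain c where c: "c > 0" "\<And>s. B.kappa s \<ge> c * exp (B.growth * s)" by (rule B.kappa_lower) metis
  define v where "v = measure lborel (ball (0::real^'n) \<delta>)"
  have v: "v > 0" unfolding v_def using \<delta>(1) by (rule measure_ball_pos)
  define V where "V = measure lborel (ball (0::real^'n) (M1 + M4 + 1))"
  have V: "V > 0" unfolding V_def using M1 M4 by (intro measure_ball_pos) auto
  have "(\<Sum>z\<in>A.lattice T R. step (EA (- real T) z) (real T) powr B.growth) \<le> V / (c * v)" for T
  proof -
    define r where "r = (\<lambda>z. step (EA (- real T) z) (real T))"
    \<comment> \<open>A ball of fixed radius is flowed for time \<open>ln (r z)\<close>. It then
      lies within quasidistance \<open>cc * r z\<close> of its centre, and its volume is
      \<open>kappa (ln (r z))\<close> times a constant.\<close>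
    define S where "S = (\<lambda>z. (+) (F (EA (- real T) z)) ` (EB (ln (r z)) ` ball 0 \<delta>))"
    have r: "r z > 0" for z by (simp add: r_def step_pos)
    have in_S: "B.rho (F (EA (- real T) z) - p) < cc * r z" if p: "p \<in> S z" for p z
    proof -
      obtain w where w: "norm w < \<delta>" "p = F (EA (- real T) z) + EB (ln (r z)) w"
        using p by (auto simp: S_def)
      have "B.rho (F (EA (- real T) z) - p) = r z * B.rho w" using r[of z] by (simp add: w(2) B.rho_E)
      also have "\<dots> < cc * r z" using \<delta>(2)[OF w(1)] r[of z] by (simp add: mult.commute)
      finally show ?thesis .
    qed
    have "(\<Sum>z\<in>A.lattice T R. measure lborel (S z)) \<le> V"
      unfolding V_def
    proof (rule sum_measure_disjoint_le[OF A.finite_lattice])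
      show "disjoint_family_on S (A.lattice T R)"
        unfolding disjoint_family_on_def
      proof (intro ballI impI, rule ccontr)
        fix y z assume yz: "y \<in> A.lattice T R" "z \<in> A.lattice T R" "y \<noteq> z" and "S y \<inter> S z \<noteq> {}"
        then obtain p where p: "p \<in> S y" "p \<in> S z" by blast
        define d where "d = B.rho (F (EA (- real T) y) - F (EA (- real T) z))"
        have le: "r y \<le> h s * B.rho (F (EA (- real T) y) - F (EA (- real T) z))"
          if "y \<in> A.lattice T R" "z \<in> A.lattice T R" "y \<noteq> z" for y z
        proof -
          have "norm (y - z) \<ge> 1" using that
            by (intro norm_integer_vector_ge_1 integer_vectors_diff) (auto simp: A.lattice_def)
          then have "c0 \<le> A.rho (y - z)" by (rule c0(2))
          then have "A.rho ones \<le> s * A.rho (y - z)" using c0(1) by (simp add: s_def field_simps)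
          then have "exp (- real T) * A.rho ones \<le> exp (- real T) * (s * A.rho (y - z))" by simp
          also have "\<dots> = s * A.rho (EA (- real T) y - EA (- real T) z)"
            by (simp add: A.rho_E flip: A.E_diff)
          finally show ?thesis
            unfolding r_def step_def using s by (intro control) (auto simp: A.rho_E)
        qed
        have "r y \<le> h s * d" "r z \<le> h s * d"
          using le[of y z] le[of z y] yz B.rho_uminus[of "F (EA (- real T) y) - F (EA (- real T) z)"]
          by (auto simp: d_def)
        then have "K * (cc * r y + cc * r z) \<le> K * (cc * (h s * d) + cc * (h s * d))"
          using K(1) cc by (intro mult_left_mono add_mono) auto
        also have "\<dots> = (2 * K * cc) * h s * d" by (simp add: algebra_simps)
        also have "2 * K * cc = 1 / (h s + 1)" using K(1) by (simp add: cc_def)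
        also have "1 / (h s + 1) * h s * d = d * (h s / (h s + 1))" by simp
        also have "\<dots> \<le> d * 1" using h_nonneg[of s] by (intro mult_left_mono) (auto simp: d_def)
        finally have 1: "K * (cc * r y + cc * r z) \<le> d" by simp
        have "d \<le> K * (B.rho (F (EA (- real T) y) - p) + B.rho (p - F (EA (- real T) z)))"
          using K(2)[of "F (EA (- real T) y) - p" "p - F (EA (- real T) z)"] by (simp add: d_def)
        also have "\<dots> < K * (cc * r y + cc * r z)"
          using in_S[OF p(1)] in_S[OF p(2)] K(1) B.rho_uminus[of "F (EA (- real T) z) - p"]
          by (intro mult_strict_left_mono add_strict_mono) auto
        finally show False using 1 by simp
      qed
      fix z assume z: "z \<in> A.lattice T R"
      show "open (S z)" unfolding S_def by (intro open_translation B.open_E_image) simp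
      show "S z \<subseteq> ball 0 (M1 + M4 + 1)"
      proof
        fix p assume p: "p \<in> S z"
        have nz: "norm (EA (- real T) z) \<le> R" using z by (simp add: A.lattice_def)
        have "B.rho (F (EA (- real T) z) - p) \<le> cc * r z" using in_S[OF p] by simp
        also have "\<dots> \<le> M3 * cc" using step_bd[OF nz, of "real T"] cc by (simp add: r_def M3_def)
        finally have "norm (F (EA (- real T) z) - p) \<le> M4" by (rule M4(2))
        then show "p \<in> ball 0 (M1 + M4 + 1)"
          using M1(2)[OF nz] norm_triangle_ineq2[of p "F (EA (- real T) z)"]
          by (simp add: norm_minus_commute)
      qed
    qed
    moreover have "c * v * r z powr B.growth \<le> measure lborel (S z)" for z
    proof -
      have "measure lborel (S z) = measure lborel (EB (ln (r z)) ` ball 0 \<delta>)"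
        unfolding S_def using B.open_E_image[of "ball 0 \<delta>" "ln (r z)"]
        by (simp add: measure_completion[symmetric] measure_translation open_translation borel_open
            del: measure_completion)
      also have "\<dots> = B.kappa (ln (r z)) * v" by (simp add: B.measure_E_image v_def)
      also have "\<dots> \<ge> c * exp (B.growth * ln (r z)) * v" using c(2) v by (intro mult_right_mono) auto
      finally show ?thesis using r[of z] by (simp add: powr_def mult_ac)
    qed
    ultimately have "(\<Sum>z\<in>A.lattice T R. c * v * r z powr B.growth) \<le> V"
      by (meson order_trans sum_mono)
    then have "c * v * (\<Sum>z\<in>A.lattice T R. r z powr B.growth) \<le> V" by (simp add: sum_distrib_left)
    then show ?thesis using c(1) v by (simp add: r_def field_simps)
  qed
  then show ?thesis using V c(1) v by (intro that[of "V / (c * v)"]) auto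
qed

text \<open>Hoelder's inequality with exponent \<open>B.growth / lB\<close>, between the volume
  bound and the number of lattice points.\<close>

lemma sum_step_bounded:
  obtains C where "C > 0"
    "\<And>T. (\<Sum>z\<in>A.lattice T R. step (EA (- real T) z) (real T) powr lB)
       \<le> C * exp (A.growth * T - A.growth * lB / B.growth * T)"
proof -
  obtain C1 where C1: "C1 > 0"
    "\<And>T. (\<Sum>z\<in>A.lattice T R. step (EA (- real T) z) (real T) powr B.growth) \<le> C1"
    by (rule sum_step_growth_bounded[where R=R]) metis
  obtain C2 where C2: "C2 > 0" "\<And>T. real (card (A.lattice T R)) \<le> C2 * exp (A.growth * T)"
    by (rule A.card_lattice_upper[where R=R]) metis
  have lB: "lB > 0" "lB \<le> B.growth" using B.lam_pos B.lam_le_growth by auto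
  define p where "p = B.growth / lB"
  have p: "p \<ge> 1" using lB by (simp add: p_def)
  have "(\<Sum>z\<in>A.lattice T R. step (EA (- real T) z) (real T) powr lB)
      \<le> (C1 + C2) * exp (A.growth * T - A.growth * lB / B.growth * T)" for T
  proof -
    \<comment> \<open>There are about \<open>exp (A.growth * T)\<close> terms; \<open>s\<close> is
      this number to the power \<open>- 1 / p\<close>, which balances the two summands of
      \<open>le_scaled_powr_add\<close>.\<close>
    define s where "s = exp (- (A.growth * lB / B.growth * T))"
    define X where "X = exp (A.growth * T - A.growth * lB / B.growth * T)"
    have s1: "s powr (1 - p) = X"
      using lB by (simp add: s_def X_def p_def powr_def field_simps)
    have s2: "exp (A.growth * T) * s = X" by (simp add: s_def X_def flip: exp_add)
    have "(\<Sum>z\<in>A.lattice T R. step (EA (- real T) z) (real T) powr lB)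
      \<le> (\<Sum>z\<in>A.lattice T R. s powr (1 - p) * (step (EA (- real T) z) (real T) powr lB) powr p + s)"
      using p by (intro sum_mono le_scaled_powr_add) (auto simp: s_def)
    also have "\<dots> = X * (\<Sum>z\<in>A.lattice T R. step (EA (- real T) z) (real T) powr B.growth)
        + real (card (A.lattice T R)) * s"
    proof -
      have "lB * p = B.growth" using lB by (simp add: p_def)
      then show ?thesis by (simp add: sum.distrib s1 powr_powr sum_distrib_left)
    qed
    also have "\<dots> \<le> X * C1 + C2 * exp (A.growth * T) * s"
      using C1(2) C2(2) by (intro add_mono mult_left_mono mult_right_mono) (auto simp: X_def s_def)
    also have "\<dots> = (C1 + C2) * X" using s2 by (simp add: algebra_simps)
    finally show ?thesis by (simp add: X_def)
  qed
  then show ?thesis using C1(1) C2(1) by (intro that[of "C1 + C2"]) auto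
qed

end

section \<open>Lattice chains in the directions of the slowest contraction\<close>

lemma floor_vec_0 [simp]: "floor_vec 0 = 0"
  by (simp add: floor_vec_def cart_eq_iff)

context expanding_flow
begin

text \<open>The order of magnitude of the operator norm of \<open>E (- T)\<close> for large
  \<open>T\<close>: an upper bound by \<open>decay\<close>, attained in the directions of
  \<open>H\<close> by \<open>H_approx\<close>.\<close>

definition weight :: "nat \<Rightarrow> real" where
  "weight T = exp (- lam * real T) * real T ^ k"

lemma weight_pos: "T \<ge> 1 \<Longrightarrow> weight T > 0"
  by (simp add: weight_def)

lemma weight_tendsto_0: "weight \<longlonglongrightarrow> 0"
proof (rule tendsto_sandwich[where f="\<lambda>_. 0"])
  show "(\<lambda>T. (1 + 1 * real T) ^ k * exp (- lam * real T)) \<longlonglongrightarrow> 0"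
    by (rule filterlim_compose[OF exp_dominates_power[OF lam_pos] filterlim_real_sequentially])
  show "\<forall>\<^sub>F T in sequentially. weight T \<le> (1 + 1 * real T) ^ k * exp (- lam * real T)"
    by (intro always_eventually allI) (auto simp: weight_def mult.commute intro!: mult_left_mono power_mono)
qed (auto simp: weight_def)

text \<open>Because a ball of radius \<open>e\<^sup>-\<^sup>T\<close> is elongated in the directions of \<open>H\<close>, only \<open>1 / weight T\<close>
  steps of this size are needed to travel from \<open>0\<close> to a point of \<open>H\<close>.\<close>

lemma lattice_chain:
  assumes e: "e \<in> H"
  obtains U L R r where
    "\<And>T i. U T i \<in> integer_vectors" "\<And>T. U T 0 = 0"
    "\<And>T i. norm (U T (Suc i) - U T i) \<le> r"
    "(\<lambda>T. E (- real T) (U T (L T))) \<longlonglongrightarrow> e"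
    "\<forall>\<^sub>F T in sequentially. \<forall>i\<le>L T. norm (E (- real T) (U T i)) \<le> R"
    "\<forall>\<^sub>F T in sequentially. real (L T) * weight T \<le> 2"
proof -
  obtain w Cw where w: "\<And>T. norm (w T) \<le> Cw"
    "(\<lambda>T::nat. E (- real T) (w T) /\<^sub>R weight T) \<longlonglongrightarrow> e"
    using H_approx[OF e] unfolding weight_def by blast
  obtain C a where C: "C > 0" "a > 0" "\<And>t x. t \<ge> 0 \<Longrightarrow> norm (E (- t) x) \<le> C * exp (- a * t) * norm x"
    by (rule decay_exp) metis
  define n where "n = real CARD('n)"
  \<comment> \<open>Multiples of \<open>w T\<close>, rounded to integer points. As
    \<open>E (- T) (w T)\<close> is about \<open>weight T\<close> times \<open>e\<close>, roughly
    \<open>1 / weight T\<close> of them lead from 0 to \<open>e\<close> after contraction.\<close>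
  define U where "U = (\<lambda>T i. floor_vec (real i *\<^sub>R w T))"
  define L where "L = (\<lambda>T. nat \<lceil>1 / weight T\<rceil>)"
  have fl: "norm (real i *\<^sub>R w T - U T i) \<le> n" for T i
    unfolding U_def n_def by (rule norm_diff_floor_vec)
  have Efl: "norm (E (- real T) (real i *\<^sub>R w T - U T i)) \<le> C * exp (- a * real T) * n" for T i
  proof -
    have "norm (E (- real T) (real i *\<^sub>R w T - U T i)) \<le> C * exp (- a * real T) * norm (real i *\<^sub>R w T - U T i)"
      by (rule C(3)) simp
    also have "\<dots> \<le> C * exp (- a * real T) * n" using fl[of i T] C(1) by (intro mult_left_mono) auto
    finally show ?thesis .
  qed
  have L: "1 \<le> real (L T) * weight T" "real (L T) * weight T \<le> 1 + weight T" if "T \<ge> 1" for T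
  proof -
    have p: "weight T > 0" by (rule weight_pos[OF that])
    then have "0 < 1 / weight T" by simp
    then have "0 \<le> \<lceil>1 / weight T\<rceil>" by linarith
    then have "real (L T) = of_int \<lceil>1 / weight T\<rceil>" by (simp add: L_def)
    then have "1 / weight T \<le> real (L T)" "real (L T) \<le> 1 / weight T + 1" by linarith+
    then show "1 \<le> real (L T) * weight T" "real (L T) * weight T \<le> 1 + weight T"
      using p by (auto simp: field_simps)
  qed
  have w_small: "\<forall>\<^sub>F T in sequentially. weight T < 1"
    using weight_tendsto_0 by (rule order_tendstoD) simp
  have ge1: "\<forall>\<^sub>F T::nat in sequentially. T \<ge> 1" by (rule eventually_ge_at_top)
  have exp0: "(\<lambda>T. exp (- a * real T)) \<longlonglongrightarrow> 0"
    using filterlim_compose[OF exp_dominates_power[OF C(2), of 0 0] filterlim_real_sequentially] by simp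
  have Lw: "(\<lambda>T. real (L T) * weight T) \<longlonglongrightarrow> 1"
  proof (rule tendsto_sandwich)
    show "\<forall>\<^sub>F T in sequentially. 1 \<le> real (L T) * weight T"
      using ge1 by eventually_elim (rule L)
    show "\<forall>\<^sub>F T in sequentially. real (L T) * weight T \<le> 1 + weight T"
      using ge1 by eventually_elim (rule L)
    show "(\<lambda>T. 1 + weight T) \<longlonglongrightarrow> 1" using tendsto_add[OF tendsto_const weight_tendsto_0, of 1] by simp
  qed auto
  have scale: "real i *\<^sub>R E (- real T) (w T) = (real i * weight T) *\<^sub>R (E (- real T) (w T) /\<^sub>R weight T)"
    if "T \<ge> 1" for i T
    using weight_pos[OF that] by simp
  have EU: "E (- real T) (U T i) = real i *\<^sub>R E (- real T) (w T) - E (- real T) (real i *\<^sub>R w T - U T i)" for i T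
    by (simp add: E_diff E_scale)
  \<comment> \<open>The rounding error is bounded before the contraction, hence it tends to 0 after
    it.\<close>
  have end0: "(\<lambda>T. E (- real T) (real (L T) *\<^sub>R w T - U T (L T))) \<longlonglongrightarrow> 0"
  proof (rule Lim_null_comparison)
    show "\<forall>\<^sub>F T in sequentially. norm (E (- real T) (real (L T) *\<^sub>R w T - U T (L T))) \<le> C * exp (- a * real T) * n"
      using Efl by (intro always_eventually allI)
    show "(\<lambda>T. C * exp (- a * real T) * n) \<longlonglongrightarrow> 0"
      using tendsto_mult[OF tendsto_mult[OF tendsto_const exp0, of C] tendsto_const, of n] by simp
  qed
  have lim: "(\<lambda>T. (real (L T) * weight T) *\<^sub>R (E (- real T) (w T) /\<^sub>R weight T)
      - E (- real T) (real (L T) *\<^sub>R w T - U T (L T))) \<longlonglongrightarrow> 1 *\<^sub>R e - 0"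
    by (intro tendsto_diff tendsto_scaleR Lw w(2) end0)
  have 4: "(\<lambda>T. E (- real T) (U T (L T))) \<longlonglongrightarrow> e"
  proof (rule Lim_transform_eventually)
    show "\<forall>\<^sub>F T in sequentially. (real (L T) * weight T) *\<^sub>R (E (- real T) (w T) /\<^sub>R weight T)
      - E (- real T) (real (L T) *\<^sub>R w T - U T (L T)) = E (- real T) (U T (L T))"
      using ge1 by eventually_elim (simp only: EU scale)
  qed (use lim in simp)
  have norm_lim: "\<forall>\<^sub>F T in sequentially. norm (E (- real T) (w T) /\<^sub>R weight T) < norm e + 1"
    using tendsto_norm[OF w(2)] by (rule order_tendstoD) simp
  have 6: "\<forall>\<^sub>F T in sequentially. real (L T) * weight T \<le> 2"
    using ge1 w_small by eventually_elim (use L in fastforce)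
  have 5: "\<forall>\<^sub>F T in sequentially. \<forall>i\<le>L T. norm (E (- real T) (U T i)) \<le> 2 * (norm e + 1) + C * n"
    using ge1 6 norm_lim
  proof eventually_elim
    case (elim T)
    show ?case
    proof (intro allI impI)
      fix i assume i: "i \<le> L T"
      have p: "weight T > 0" using elim(1) by (rule weight_pos)
      have "real i * weight T \<le> real (L T) * weight T" using i p by (intro mult_right_mono) auto
      then have "real i * weight T \<le> 2" using elim(2) by linarith
      then have "(real i * weight T) * norm (E (- real T) (w T) /\<^sub>R weight T) \<le> 2 * (norm e + 1)"
        using elim(3) p by (intro mult_mono) auto
      then have 1: "norm (real i *\<^sub>R E (- real T) (w T)) \<le> 2 * (norm e + 1)"
        unfolding scale[OF elim(1)] using p by simp
      have "C * exp (- a * real T) * n \<le> C * 1 * n"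
        using C(1,2) by (intro mult_right_mono mult_left_mono) (auto simp: n_def)
      then have "norm (E (- real T) (real i *\<^sub>R w T - U T i)) \<le> C * n" using Efl[of T i] by simp
      then show "norm (E (- real T) (U T i)) \<le> 2 * (norm e + 1) + C * n"
        unfolding EU using 1 norm_triangle_ineq4 by (meson add_mono order_trans)
    qed
  qed
  have 3: "norm (U T (Suc i) - U T i) \<le> Cw + 2 * n" for T i
  proof -
    \<comment> \<open>A step of the chain is \<open>w T\<close> up to two rounding errors.\<close>
    have eq: "U T (Suc i) - U T i = w T + ((real i *\<^sub>R w T - U T i) - (real (Suc i) *\<^sub>R w T - U T (Suc i)))"
      by (simp add: algebra_simps)
    have "norm (U T (Suc i) - U T i) \<le> norm (w T) + (norm (real i *\<^sub>R w T - U T i) + norm (real (Suc i) *\<^sub>R w T - U T (Suc i)))"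
      unfolding eq by (intro order_trans[OF norm_triangle_ineq] add_left_mono norm_triangle_ineq4)
    then show ?thesis using fl[of i T] fl[of "Suc i" T] w(1)[of T] by linarith
  qed
  show ?thesis
    by (rule that[of U "Cw + 2 * n" L "2 * (norm e + 1) + C * n"]) (use 3 4 5 6 in \<open>auto simp: U_def\<close>)
qed

end

section \<open>The length-volume argument\<close>

context controlled_map
begin

text \<open>The images of lattice chains in direction \<open>e\<close> are compared, in the mean over all chains that
  start near \<open>0\<close>, with the total volume that is available in the target.\<close>

lemma functional_vanishes:
  assumes e: "e \<in> HA"
    and small: "\<And>\<epsilon> \<beta>. \<lbrakk>\<epsilon> > 0; \<beta> > 0\<rbrakk> \<Longrightarrow> \<exists>S0 T0. \<forall>T\<ge>T0. \<forall>S\<ge>S0. S \<le> \<beta> * real T \<longrightarrow>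
      (\<forall>w. \<bar>a \<bullet> EB (- S) w\<bar> \<le> \<epsilon> * (exp (- lB * S) *
        (real T ^ kA * exp ((A.growth * lB / B.growth - lA) * real T))) * norm w)"
  shows "a \<bullet> (F e - F 0) = 0"
proof (rule ccontr)
  define D where "D = \<bar>a \<bullet> (F e - F 0)\<bar>"
  assume "a \<bullet> (F e - F 0) \<noteq> 0"
  then have D: "D > 0" by (simp add: D_def)
  \<comment> \<open>Moving the two ends of the chain a little changes the functional by at most
    \<open>D / 4\<close> at each end, so that \<open>D / 2\<close> remains for every chain that
    starts near 0.\<close>
  define \<epsilon>1 where "\<epsilon>1 = D / (4 * (norm a + 1))"
  have e1: "\<epsilon>1 > 0" "norm a * \<epsilon>1 \<le> D / 4"
    using D by (auto simp: \<epsilon>1_def field_simps add_pos_nonneg)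
  obtain \<eta>0 where \<eta>0: "\<eta>0 > 0" "\<And>y. norm (y - 0) < \<eta>0 \<Longrightarrow> norm (F y - F 0) < \<epsilon>1"
    by (rule F_continuous[OF e1(1), of 0]) metis
  obtain \<eta>1 where \<eta>1: "\<eta>1 > 0" "\<And>y. norm (y - e) < \<eta>1 \<Longrightarrow> norm (F y - F e) < \<epsilon>1"
    by (rule F_continuous[OF e1(1), of e]) metis
  define \<eta> where "\<eta> = min \<eta>0 \<eta>1 / 2"
  have \<eta>: "\<eta> > 0" "\<eta> < \<eta>0" "2 * \<eta> \<le> \<eta>1" using \<eta>0(1) \<eta>1(1) by (auto simp: \<eta>_def)
  have gap: "D / 2 \<le> \<bar>a \<bullet> (F y' - F y)\<bar>" if "norm y \<le> \<eta>" "norm (y' - e) < \<eta>1" for y y'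
  proof -
    have "\<bar>a \<bullet> (F y - F 0)\<bar> \<le> norm a * norm (F y - F 0)" by (rule Cauchy_Schwarz_ineq2)
    also have "\<dots> \<le> norm a * \<epsilon>1" using \<eta>0(2)[of y] that(1) \<eta>(2) by (intro mult_left_mono) auto
    finally have 1: "\<bar>a \<bullet> (F y - F 0)\<bar> \<le> D / 4" using e1(2) by linarith
    have "\<bar>a \<bullet> (F y' - F e)\<bar> \<le> norm a * norm (F y' - F e)" by (rule Cauchy_Schwarz_ineq2)
    also have "\<dots> \<le> norm a * \<epsilon>1" using \<eta>1(2)[of y'] that(2) by (intro mult_left_mono) auto
    finally have 2: "\<bar>a \<bullet> (F y' - F e)\<bar> \<le> D / 4" using e1(2) by linarith
    have "a \<bullet> (F y' - F y) = a \<bullet> (F e - F 0) + a \<bullet> (F y' - F e) - a \<bullet> (F y - F 0)"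
      by (simp add: inner_diff_right)
    then show ?thesis using 1 2 unfolding D_def by linarith
  qed
  obtain U L R1 r where
    U: "\<And>T i. U T i \<in> integer_vectors" "\<And>T. U T 0 = 0"
      "\<And>T i. norm (U T (Suc i) - U T i) \<le> r"
    and end_lim: "(\<lambda>T. EA (- real T) (U T (L T))) \<longlonglongrightarrow> e"
    and inside: "\<forall>\<^sub>F T in sequentially. \<forall>i\<le>L T. norm (EA (- real T) (U T i)) \<le> R1"
    and L: "\<forall>\<^sub>F T in sequentially. real (L T) * A.weight T \<le> 2"
    by (rule A.lattice_chain[OF e]) (rule that)
  define R where "R = \<eta> + R1"
  obtain c0 T0 where c0: "c0 > 0" "\<And>T. T \<ge> T0 \<Longrightarrow> c0 * exp (A.growth * real T) \<le> card (A.lattice T \<eta>)"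
    by (rule A.card_lattice_lower[OF \<eta>(1)]) metis
  obtain C1 where C1: "C1 > 0"
    "\<And>T. (\<Sum>z\<in>A.lattice T R. step (EA (- real T) z) (real T) powr lB)
       \<le> C1 * exp (A.growth * T - A.growth * lB / B.growth * T)"
    by (rule sum_step_bounded[where R=R]) metis
  obtain C2 where C2: "C2 > 0"
    "\<And>y v t. norm v \<le> r \<Longrightarrow> B.rho (F y - F (y + EA (- t) v)) \<le> C2 * step y t"
    by (rule step_dominates[where R=r]) metis
  obtain C3 where C3: "C3 > 0" "\<And>v. B.rho v \<le> C2 \<Longrightarrow> norm v \<le> C3"
    by (rule B.norm_bounded_by_rho[where b=C2]) metis
  obtain \<beta> where \<beta>: "\<beta> > 0" "\<And>T y. \<lbrakk>T \<ge> 1; norm y \<le> R\<rbrakk> \<Longrightarrow> exp (- \<beta> * real T) \<le> step y (real T)"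
    by (rule step_lower[where R=R]) metis
  \<comment> \<open>With this value all chains together gain at most
    \<open>c0 * exp (A.growth * T) * (D / 4)\<close>, whereas \<open>D / 2\<close> for each chain is
    required.\<close>
  define \<epsilon> where "\<epsilon> = c0 * D / (8 * C3 * C1)"
  have \<epsilon>: "\<epsilon> > 0" using c0 D C3 C1 by (simp add: \<epsilon>_def)
  \<comment> \<open>The loss per step that the balance permits: multiplied by the bound for the sum
    of the steps and by the number of positions, which is of order \<open>1 / A.weight T\<close>, it
    gives \<open>exp (A.growth * T)\<close>, the order of the number of chains.\<close>
  define \<Omega> where "\<Omega> = (\<lambda>T::nat. real T ^ kA * exp ((A.growth * lB / B.growth - lA) * real T))"
  obtain S0 T1 where small': "\<And>T S w. \<lbrakk>T \<ge> T1; S \<ge> S0; S \<le> \<beta> * real T\<rbrakk> \<Longrightarrow>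
      \<bar>a \<bullet> EB (- S) w\<bar> \<le> \<epsilon> * (exp (- lB * S) * \<Omega> T) * norm w"
    using small[OF \<epsilon> \<beta>(1)] unfolding \<Omega>_def by blast
  obtain t2 where t2: "\<And>t y. \<lbrakk>t \<ge> t2; norm y \<le> R\<rbrakk> \<Longrightarrow> step y t < exp (- S0)"
    by (rule step_small[of "exp (- S0)" R]) auto
  have "\<forall>\<^sub>F T in sequentially. norm (EA (- real T) (U T (L T)) - e) < \<eta>"
    using tendstoD[OF end_lim \<eta>(1)] by (simp add: dist_norm)
  moreover have "\<forall>\<^sub>F T in sequentially. real T \<ge> t2"
    using filterlim_real_sequentially by (simp add: filterlim_at_top)
  ultimately have "\<forall>\<^sub>F T in sequentially. norm (EA (- real T) (U T (L T)) - e) < \<eta> \<and> real T \<ge> t2 \<and>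
      (\<forall>i\<le>L T. norm (EA (- real T) (U T i)) \<le> R1) \<and> real (L T) * A.weight T \<le> 2 \<and> T \<ge> T0 \<and> T \<ge> T1 \<and> T \<ge> 1"
    using inside L by (intro eventually_conj eventually_ge_at_top)
  then obtain T where T: "norm (EA (- real T) (U T (L T)) - e) < \<eta>" "real T \<ge> t2"
      "\<And>i. i \<le> L T \<Longrightarrow> norm (EA (- real T) (U T i)) \<le> R1" "real (L T) * A.weight T \<le> 2" "T \<ge> T0" "T \<ge> T1" "T \<ge> 1"
    by (auto simp: eventually_sequentially)
  define y where "y = (\<lambda>z. EA (- real T) z)"
  define g where "g = (\<lambda>z. step (y z) (real T) powr lB)"
  have in_lattice: "z + U T i \<in> A.lattice T R" if z: "z \<in> A.lattice T \<eta>" and i: "i \<le> L T" for z i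
  proof -
    have "norm (EA (- real T) (z + U T i)) \<le> norm (EA (- real T) z) + norm (EA (- real T) (U T i))"
      by (simp add: A.E_plus norm_triangle_ineq)
    also have "\<dots> \<le> R" using z T(3)[OF i] by (simp add: R_def A.lattice_def)
    finally show ?thesis using z U(1) by (simp add: A.lattice_def integer_vectors_add)
  qed
  have link: "\<bar>a \<bullet> (F (y (z + U T (Suc i))) - F (y (z + U T i)))\<bar> \<le> \<epsilon> * C3 * \<Omega> T * g (z + U T i)"
    if z: "z \<in> A.lattice T \<eta>" and i: "i < L T" for z i
  proof -
    define p where "p = y (z + U T i)"
    have p: "norm p \<le> R" using in_lattice[OF z, of i] i by (simp add: p_def y_def A.lattice_def)
    define s where "s = step p (real T)"
    define S where "S = - ln s"
    have s: "s > 0" unfolding s_def by (rule step_pos)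
    then have Ss: "exp (- S) = s" by (simp add: S_def)
    have "s < exp (- S0)" unfolding s_def using T(2) p by (rule t2)
    then have S0: "S0 \<le> S" by (simp flip: Ss)
    have "exp (- \<beta> * real T) \<le> s" unfolding s_def using T(7) p by (rule \<beta>(2))
    then have S1: "S \<le> \<beta> * real T" by (simp flip: Ss)
    define q where "q = y (z + U T (Suc i))"
    have q: "q = p + EA (- real T) (U T (Suc i) - U T i)"
      by (simp add: q_def p_def y_def flip: A.E_plus)
    \<comment> \<open>Flowing for time \<open>S\<close> brings the image difference to bounded size,
      so that \<open>small\<close> can be applied to the bounded vector \<open>w\<close>; then
      \<open>exp (- lB * S)\<close> is the image step to the power \<open>lB\<close>.\<close>
    define w where "w = EB S (F p - F q)"
    have "B.rho (F p - F q) \<le> C2 * s" unfolding q s_def by (intro C2(2) U(3))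
    then have "B.rho w \<le> C2" using s by (simp add: w_def B.rho_E S_def exp_minus field_simps)
    then have w: "norm w \<le> C3" by (rule C3(2))
    have "\<bar>a \<bullet> (F q - F p)\<bar> = \<bar>a \<bullet> EB (- S) w\<bar>" by (simp add: w_def inner_diff_right)
    also have "\<dots> \<le> \<epsilon> * (exp (- lB * S) * \<Omega> T) * norm w" using T(6) S0 S1 by (rule small')
    also have "\<dots> \<le> \<epsilon> * (exp (- lB * S) * \<Omega> T) * C3"
      using w \<epsilon> by (intro mult_left_mono) (auto simp: \<Omega>_def)
    also have "exp (- lB * S) = g (z + U T i)"
      using s by (simp add: g_def p_def[symmetric] s_def[symmetric] powr_def S_def)
    finally show ?thesis by (simp add: q_def p_def mult_ac)
  qed
  have chain: "D / 2 \<le> (\<Sum>i<L T. \<epsilon> * C3 * \<Omega> T * g (z + U T i))" if z: "z \<in> A.lattice T \<eta>" for z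
  proof -
    have nz: "norm (y z) \<le> \<eta>" using z by (simp add: y_def A.lattice_def)
    have "norm (y (z + U T (L T)) - e) = norm (y z + (EA (- real T) (U T (L T)) - e))"
      by (simp add: y_def A.E_plus add_diff_eq)
    also have "\<dots> < \<eta>1" using nz T(1) \<eta>(3) norm_triangle_ineq[of "y z" "EA (- real T) (U T (L T)) - e"] by linarith
    finally have "D / 2 \<le> \<bar>a \<bullet> (F (y (z + U T (L T))) - F (y z))\<bar>" by (intro gap nz)
    also have "F (y (z + U T (L T))) - F (y z) = (\<Sum>i<L T. F (y (z + U T (Suc i))) - F (y (z + U T i)))"
      by (subst sum_lessThan_telescope) (simp add: U(2))
    also have "\<bar>a \<bullet> \<dots>\<bar> \<le> (\<Sum>i<L T. \<bar>a \<bullet> (F (y (z + U T (Suc i))) - F (y (z + U T i)))\<bar>)"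
      by (simp add: inner_sum_right sum_abs)
    also have "\<dots> \<le> (\<Sum>i<L T. \<epsilon> * C3 * \<Omega> T * g (z + U T i))" using z by (intro sum_mono link) auto
    finally show ?thesis .
  qed
  define X where "X = C1 * exp (A.growth * T - A.growth * lB / B.growth * T)"
  \<comment> \<open>For a fixed position \<open>i\<close>, translation by \<open>U T i\<close> is
    injective, so each lattice point is counted at most once.\<close>
  have shift: "(\<Sum>z\<in>A.lattice T \<eta>. g (z + U T i)) \<le> X" if "i < L T" for i
  proof -
    have "(\<Sum>z\<in>A.lattice T \<eta>. g (z + U T i)) = sum g ((\<lambda>z. z + U T i) ` A.lattice T \<eta>)"
      by (simp add: sum.reindex)
    also have "\<dots> \<le> sum g (A.lattice T R)"
      using that by (intro sum_mono2 A.finite_lattice image_subsetI in_lattice) (auto simp: g_def)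
    also have "\<dots> \<le> X" unfolding g_def y_def X_def by (rule C1(2))
    finally show ?thesis .
  qed
  have eC: "\<epsilon> * C3 * \<Omega> T \<ge> 0" using \<epsilon> C3(1) by (simp add: \<Omega>_def)
  have "card (A.lattice T \<eta>) * (D / 2) = (\<Sum>z\<in>A.lattice T \<eta>. D / 2)" by simp
  also have "\<dots> \<le> (\<Sum>z\<in>A.lattice T \<eta>. \<Sum>i<L T. \<epsilon> * C3 * \<Omega> T * g (z + U T i))"
    by (intro sum_mono chain)
  also have "\<dots> = (\<Sum>i<L T. \<epsilon> * C3 * \<Omega> T * (\<Sum>z\<in>A.lattice T \<eta>. g (z + U T i)))"
    by (subst sum.swap) (simp add: sum_distrib_left)
  also have "\<dots> \<le> (\<Sum>i<L T. \<epsilon> * C3 * \<Omega> T * X)"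
    using shift eC by (intro sum_mono mult_left_mono) auto
  also have "\<dots> = \<epsilon> * C3 * C1 * exp (A.growth * T) * (real (L T) * A.weight T)"
  proof -
    have "\<Omega> T * exp (A.growth * T - A.growth * lB / B.growth * T)
        = real T ^ kA * (exp ((A.growth * lB / B.growth - lA) * T) * exp (A.growth * T - A.growth * lB / B.growth * T))"
      by (simp add: \<Omega>_def)
    also have "exp ((A.growth * lB / B.growth - lA) * T) * exp (A.growth * T - A.growth * lB / B.growth * T)
        = exp (A.growth * T) * exp (- lA * T)"
      by (simp add: algebra_simps flip: exp_add)
    finally have "\<Omega> T * exp (A.growth * T - A.growth * lB / B.growth * T) = exp (A.growth * T) * A.weight T"
      by (simp add: A.weight_def)
    then show ?thesis by (simp add: X_def mult.assoc mult.left_commute)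
  qed
  also have "\<dots> \<le> \<epsilon> * C3 * C1 * exp (A.growth * T) * 2"
    using T(4) \<epsilon> C3(1) C1(1) by (intro mult_left_mono) auto
  also have "\<dots> = c0 * exp (A.growth * T) * (D / 4)" using C3(1) C1(1) by (simp add: \<epsilon>_def)
  also have "\<dots> < c0 * exp (A.growth * T) * (D / 2)" using c0(1) D by simp
  also have "\<dots> \<le> card (A.lattice T \<eta>) * (D / 2)" using c0(2)[OF T(5)] D by (intro mult_right_mono) auto
  finally show False by simp
qed

end

section \<open>Comparison of growth rates and block sizes; images of cosets\<close>

context controlled_map
begin

text \<open>The hypothesis says that the polynomial loss in the decay of \<open>EB\<close> is
  negligible against the permitted loss. Then every functional may be used in
  \<open>functional_vanishes\<close>, in particular \<open>F e - F 0\<close> itself, which gives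
  \<open>F e = F 0\<close> with \<open>e \<noteq> 0\<close>.\<close>

lemma no_fast_contraction:
  assumes "\<And>\<beta>. \<beta> > 0 \<Longrightarrow> (\<lambda>T. (1 + \<beta> * real T) ^ kB /
    (real T ^ kA * exp ((A.growth * lB / B.growth - lA) * real T))) \<longlonglongrightarrow> 0"
  shows False
proof -
  define \<Omega> where "\<Omega> = (\<lambda>T::nat. real T ^ kA * exp ((A.growth * lB / B.growth - lA) * real T))"
  obtain C where C: "\<And>t x. t \<ge> 0 \<Longrightarrow> norm (EB (- t) x) \<le> C * (exp (- lB * t) * (1 + t) ^ kB) * norm x"
    using B.decay by blast
  have small: "\<exists>S0 T0. \<forall>T\<ge>T0. \<forall>S\<ge>S0. S \<le> \<beta> * real T \<longrightarrow>
      (\<forall>w. \<bar>a \<bullet> EB (- S) w\<bar> \<le> \<epsilon> * (exp (- lB * S) *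
        (real T ^ kA * exp ((A.growth * lB / B.growth - lA) * real T))) * norm w)"
    if "\<epsilon> > 0" "\<beta> > 0" for \<epsilon> \<beta> a
  proof -
    define D where "D = norm a * \<bar>C\<bar> + 1"
    have D: "D > 0" by (simp add: D_def add_nonneg_pos)
    have "\<forall>\<^sub>F T in sequentially. (1 + \<beta> * real T) ^ kB / \<Omega> T < \<epsilon> / D"
      unfolding \<Omega>_def using assms[OF that(2)] by (rule order_tendstoD) (use that D in simp)
    then obtain T0 where T0: "\<And>T. T \<ge> T0 \<Longrightarrow> (1 + \<beta> * real T) ^ kB / \<Omega> T < \<epsilon> / D"
      by (auto simp: eventually_sequentially)
    have "\<bar>a \<bullet> EB (- S) w\<bar> \<le> \<epsilon> * (exp (- lB * S) * \<Omega> T) * norm w"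
      if T: "T \<ge> max 1 T0" and S: "S \<ge> 0" "S \<le> \<beta> * real T" for T S w
    proof -
      have \<Omega>: "\<Omega> T > 0" using T by (simp add: \<Omega>_def)
      have "\<bar>a \<bullet> EB (- S) w\<bar> \<le> norm a * norm (EB (- S) w)" by (rule Cauchy_Schwarz_ineq2)
      also have "\<dots> \<le> norm a * (C * (exp (- lB * S) * (1 + S) ^ kB) * norm w)"
        by (intro mult_left_mono C S) auto
      also have "\<dots> = (norm a * C) * (exp (- lB * S) * (1 + S) ^ kB * norm w)" by (simp add: mult_ac)
      also have "\<dots> \<le> D * (exp (- lB * S) * (1 + \<beta> * real T) ^ kB * norm w)"
      proof (intro mult_mono power_mono order_refl)
        show "norm a * C \<le> D" unfolding D_def
          using mult_left_mono[OF abs_ge_self[of C] norm_ge_zero[of a]] by linarith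
      qed (use S D in auto)
      also have "\<dots> = D * (1 + \<beta> * real T) ^ kB * (exp (- lB * S) * norm w)" by (simp add: mult_ac)
      also have "\<dots> \<le> (\<epsilon> * \<Omega> T) * (exp (- lB * S) * norm w)"
      proof (intro mult_right_mono)
        show "D * (1 + \<beta> * real T) ^ kB \<le> \<epsilon> * \<Omega> T"
          using T0[of T] T \<Omega> D by (simp add: field_simps)
      qed auto
      finally show ?thesis by (simp add: mult_ac)
    qed
    then show ?thesis unfolding \<Omega>_def by blast
  qed
  obtain e where e: "e \<in> HA" "e \<noteq> 0"
    using A.H_nonzero subspace_0[OF A.subspace_H] by blast
  have "F e = F 0"
    using functional_vanishes[OF e(1) small, of "F e - F 0"] by simp
  then show False using inj_F e(2) by (simp add: inj_eq)
qed

text \<open>Otherwise the permitted loss grows exponentially and dominates any power of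
  \<open>T\<close>.\<close>

lemma growth_le: "lB * A.growth \<le> lA * B.growth"
proof (rule ccontr)
  assume n: "\<not> lB * A.growth \<le> lA * B.growth"
  define g where "g = A.growth * lB / B.growth - lA"
  have gB: "B.growth > 0" using B.lam_pos B.lam_le_growth by linarith
  have g: "g > 0" using n gB by (simp add: g_def field_simps)
  show False
  proof (rule no_fast_contraction)
    fix \<beta> :: real assume \<beta>: "\<beta> > 0"
    show "(\<lambda>T. (1 + \<beta> * real T) ^ kB / (real T ^ kA * exp ((A.growth * lB / B.growth - lA) * real T))) \<longlonglongrightarrow> 0"
      unfolding g_def[symmetric]
    proof (rule tendsto_sandwich[where f="\<lambda>_. 0"])
      show "(\<lambda>T. (1 + \<beta> * real T) ^ kB * exp (- g * real T)) \<longlonglongrightarrow> 0"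
        by (rule filterlim_compose[OF exp_dominates_power[OF g] filterlim_real_sequentially])
      show "\<forall>\<^sub>F T in sequentially. (1 + \<beta> * real T) ^ kB / (real T ^ kA * exp (g * real T))
          \<le> (1 + \<beta> * real T) ^ kB * exp (- g * real T)"
        using eventually_ge_at_top[of 1]
      proof eventually_elim
        case (elim T)
        have "1 * exp (g * real T) \<le> real T ^ kA * exp (g * real T)"
          using elim by (intro mult_right_mono one_le_power) auto
        then have "(1 + \<beta> * real T) ^ kB / (real T ^ kA * exp (g * real T)) \<le> (1 + \<beta> * real T) ^ kB / exp (g * real T)"
          using \<beta> elim by (intro divide_left_mono) auto
        then show ?case by (simp add: exp_minus divide_inverse)
      qed
    qed (use \<beta> in auto)
  qed
qed

text \<open>By the equality the exponentials cancel and the permitted loss is \<open>T ^ kA\<close>.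
  If \<open>kA > kB\<close>, it would dominate \<open>T ^ kB\<close>.\<close>

lemma order_le:
  assumes "lB * A.growth = lA * B.growth"
  shows "kA \<le> kB"
proof (rule ccontr)
  assume "\<not> kA \<le> kB"
  then obtain j where j: "kA = kB + Suc j" by (metis less_natE not_le add_Suc_right)
  have gB: "B.growth > 0" using B.lam_pos B.lam_le_growth by linarith
  have g: "A.growth * lB / B.growth - lA = 0" using assms gB by (simp add: field_simps)
  show False
  proof (rule no_fast_contraction)
    fix \<beta> :: real assume \<beta>: "\<beta> > 0"
    show "(\<lambda>T. (1 + \<beta> * real T) ^ kB / (real T ^ kA * exp ((A.growth * lB / B.growth - lA) * real T))) \<longlonglongrightarrow> 0"
      unfolding g
    proof (rule tendsto_sandwich[where f="\<lambda>_. 0"])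
      show "(\<lambda>T. (1 + \<beta>) ^ kB / real T) \<longlonglongrightarrow> 0" by (rule lim_const_over_n)
      show "\<forall>\<^sub>F T in sequentially. (1 + \<beta> * real T) ^ kB / (real T ^ kA * exp (0 * real T))
          \<le> (1 + \<beta>) ^ kB / real T"
        using eventually_ge_at_top[of 1]
      proof eventually_elim
        case (elim T)
        have "(1 + \<beta> * real T) ^ kB \<le> ((1 + \<beta>) * real T) ^ kB"
          using elim \<beta> by (intro power_mono) (auto simp: algebra_simps)
        then have "(1 + \<beta> * real T) ^ kB / real T ^ kA \<le> ((1 + \<beta>) * real T) ^ kB / real T ^ kA"
          by (intro divide_right_mono) auto
        also have "\<dots> = (1 + \<beta>) ^ kB / real T ^ Suc j"
          using elim by (simp add: j power_add power_mult_distrib)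
        also have "\<dots> \<le> (1 + \<beta>) ^ kB / real T ^ 1"
          using elim \<beta> by (intro divide_left_mono power_increasing) auto
        finally show ?case by simp
      qed
    qed (use \<beta> in auto)
  qed
qed

text \<open>The critical case: the permitted loss equals the actual order \<open>T ^ kB\<close>, so
  a general functional gains nothing. For functionals orthogonal to \<open>HB\<close>, however,
  \<open>H_perp\<close> supplies an arbitrarily small factor, and \<open>S ^ kB\<close> is at most
  \<open>\<beta> ^ kB * T ^ kB\<close>.\<close>

lemma image_diff_in_HB:
  assumes eq: "lB * A.growth = lA * B.growth" "kA = kB" and e: "e \<in> HA"
  shows "F e - F 0 \<in> HB"
proof -
  have gB: "B.growth > 0" using B.lam_pos B.lam_le_growth by linarith
  have g: "A.growth * lB / B.growth - lA = 0" using eq gB by (simp add: field_simps)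
  have perp: "a \<bullet> (F e - F 0) = 0" if a: "\<forall>b\<in>HB. a \<bullet> b = 0" for a
  proof (rule functional_vanishes[OF e], unfold g)
    fix \<epsilon> \<beta> :: real assume \<epsilon>: "\<epsilon> > 0" and \<beta>: "\<beta> > 0"
    obtain S0 where S0: "\<And>S x. S \<ge> S0 \<Longrightarrow> \<bar>a \<bullet> EB (- S) x\<bar> \<le> \<epsilon> / \<beta> ^ kB * (exp (- lB * S) * S ^ kB) * norm x"
      using B.H_perp[OF a, of "\<epsilon> / \<beta> ^ kB"] \<epsilon> \<beta> by auto
    have "\<bar>a \<bullet> EB (- S) w\<bar> \<le> \<epsilon> * (exp (- lB * S) * (real T ^ kA * exp (0 * real T))) * norm w"
      if S: "S \<ge> max 0 S0" "S \<le> \<beta> * real T" for S T w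
    proof -
      have "S ^ kB \<le> (\<beta> * real T) ^ kB" using S by (intro power_mono) auto
      then have "\<epsilon> / \<beta> ^ kB * (exp (- lB * S) * S ^ kB) * norm w
          \<le> \<epsilon> / \<beta> ^ kB * (exp (- lB * S) * (\<beta> * real T) ^ kB) * norm w"
        using \<epsilon> \<beta> by (intro mult_left_mono mult_right_mono) auto
      also have "\<dots> = \<epsilon> * (exp (- lB * S) * (real T ^ kA * exp (0 * real T))) * norm w"
        using \<beta> by (simp add: power_mult_distrib eq(2))
      finally show ?thesis using S0[of S w] S by simp
    qed
    then show "\<exists>S0 T0. \<forall>T\<ge>T0. \<forall>S\<ge>S0. S \<le> \<beta> * real T \<longrightarrow>
      (\<forall>w. \<bar>a \<bullet> EB (- S) w\<bar> \<le> \<epsilon> * (exp (- lB * S) * (real T ^ kA * exp (0 * real T))) * norm w)"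
      by blast
  qed
  \<comment> \<open>The component \<open>v\<close> of \<open>F e - F 0\<close> orthogonal to
    \<open>HB\<close> is itself an admissible functional; evaluating it gives
    \<open>v \<bullet> v = 0\<close>.\<close>
  obtain u v where uv: "u \<in> span HB" "\<And>w. w \<in> span HB \<Longrightarrow> v \<bullet> w = 0" "F e - F 0 = u + v"
    using orthogonal_subspace_decomp_exists[of HB "F e - F 0"] unfolding Linear_Algebra.orthogonal_def by metis
  have "v \<bullet> (F e - F 0) = 0" using uv(2) by (intro perp) (auto simp: span_base)
  moreover have "v \<bullet> u = 0" using uv(1,2) by simp
  ultimately have "v = 0" by (simp add: uv(3) inner_add_right)
  then show ?thesis using uv(1,3) B.subspace_H by (simp add: span_eq_iff[THEN iffD2])
qed

lemma translate: "controlled_map EA NA lA kA HA EB NB lB kB HB h (\<lambda>y. F (x + y))"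
proof unfold_locales
  show "inj (\<lambda>y. F (x + y))" using inj_F by (intro injI) (metis add_left_cancel injD)
  fix s u v w assume "0 < s" "A.rho (u - v) \<le> s * A.rho (u - w)"
  then show "B.rho (F (x + u) - F (x + v)) \<le> h s * B.rho (F (x + u) - F (x + w))"
    by (intro control) auto
qed (use h_nonneg h_tendsto in auto)

end

section \<open>Maps controlled in both directions\<close>

locale bicontrolled_map =
  controlled_map EA NA lA kA HA EB NB lB kB HB h F +
  inv_map: controlled_map EB NB lB kB HB EA NA lA kA HA h' G
  for EA :: "real \<Rightarrow> real^'n \<Rightarrow> real^'n" and NA lA kA HA EB NB lB kB HB h F h' G +
  assumes GF [simp]: "G (F x) = x" and FG [simp]: "F (G y) = y"
begin

lemma growth_eq: "lB * A.growth = lA * B.growth"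
  using growth_le inv_map.growth_le by linarith

lemma order_eq: "kA = kB"
  using order_le[OF growth_eq] inv_map.order_le[OF growth_eq[symmetric]] by simp

lemma coset_image:
  assumes "x - y \<in> HA"
  shows "F x - F y \<in> HB"
proof -
  interpret T: controlled_map EA NA lA kA HA EB NB lB kB HB h "\<lambda>z. F (y + z)" by (rule translate)
  show ?thesis using T.image_diff_in_HB[OF growth_eq order_eq assms] by simp
qed

lemma coset_preimage:
  assumes "F x - F y \<in> HB"
  shows "x - y \<in> HA"
proof -
  interpret T: controlled_map EB NB lB kB HB EA NA lA kA HA h' "\<lambda>z. G (F y + z)" by (rule inv_map.translate)
  show ?thesis using T.image_diff_in_HB[OF growth_eq[symmetric] order_eq[symmetric] assms] by simp
qed

lemma HB_ne_UNIV: "HA \<noteq> UNIV \<Longrightarrow> HB \<noteq> UNIV"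
  using coset_preimage[of _ 0] by (metis UNIV_I UNIV_eq_I diff_zero)

end

text \<open>The map is not fixed by the locale but quantified inside the lemmas. The constants
  obtained there depend only on the flows and on the gauges \<open>h\<close> and
  \<open>h'\<close>.\<close>

locale two_flows =
  A: expanding_flow EA NA lA kA HA + B: expanding_flow EB NB lB kB HB
  for EA :: "real \<Rightarrow> real^'n \<Rightarrow> real^'n" and NA lA kA HA
  and EB :: "real \<Rightarrow> real^'n \<Rightarrow> real^'n" and NB lB kB HB
begin

text \<open>Distinct cosets of \<open>HA\<close> stay at constant distance from each other, so the image of a step
  transversal to a coset has about the same size at all points of the coset. Along the cosets, the
  quasimetrics are powers of a norm, so many steps of the same size add up.\<close>

lemma ratio_increase_bound:
  assumes "HA \<noteq> UNIV"
  obtains C where "C > 0"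
    "\<And>F G x y z. \<lbrakk>bicontrolled_map EA NA lA kA HA EB NB lB kB HB h F h' G; x \<noteq> y; A.rho (x - y) \<le> A.rho (x - z)\<rbrakk> \<Longrightarrow>
      B.rho (F x - F z) powr lB * A.rho (x - y) powr lA \<le> C * (B.rho (F x - F y) powr lB * A.rho (x - z) powr lA)"
proof -
  obtain e where e: "e \<in> HA" "e \<noteq> 0"
    using A.H_nonzero subspace_0[OF A.subspace_H] by blast
  obtain v where v: "v \<notin> HA" using assms by blast
  then have v0: "v \<noteq> 0" using subspace_0[OF A.subspace_H] by auto
  have "open (- HA)" using closed_subspace[OF A.subspace_H] by auto
  then obtain d where d: "d > 0" "ball v d \<subseteq> - HA" using v by (meson ComplI openE)
  have away: "norm (v + g) \<ge> d" if "g \<in> HA" for g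
  proof -
    have "- g \<in> HA" using that subspace_neg[OF A.subspace_H] by blast
    then have "- g \<notin> ball v d" using d(2) by blast
    then show ?thesis by (simp add: dist_norm)
  qed
  obtain c0 where c0: "c0 > 0" "\<And>u. norm u \<ge> d \<Longrightarrow> A.rho u \<ge> c0" using A.rho_away[OF d(1)] by metis
  obtain CA where CA: "CA > 0" "\<And>g. g \<in> HA \<Longrightarrow> A.rho g powr lA \<le> CA * norm g"
    "\<And>g. g \<in> HA \<Longrightarrow> norm g \<le> CA * A.rho g powr lA" by (rule A.rho_H) metis
  obtain CB where CB: "CB > 0" "\<And>g. g \<in> HB \<Longrightarrow> B.rho g powr lB \<le> CB * norm g"
    "\<And>g. g \<in> HB \<Longrightarrow> norm g \<le> CB * B.rho g powr lB" by (rule B.rho_H) metis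
  have lA: "lA > 0" and lB: "lB > 0" using A.lam_pos B.lam_pos by auto
  \<comment> \<open>Every element of \<open>v + HA\<close> has norm at least \<open>d\<close>, hence
    \<open>rho\<close> at least \<open>c0\<close>; so \<open>A.rho v\<close> is at most
    \<open>s1\<close> times the \<open>rho\<close> of any such element.\<close>
  define s1 where "s1 = A.rho v / c0"
  \<comment> \<open>The two factors \<open>CA\<close> come from passing from \<open>rho\<close> to
    the norm, in which the steps add up, and back.\<close>
  define s2 where "s2 = (CA\<^sup>2 / A.rho e powr lA) powr (1 / lA)"
  have s1: "s1 > 0" using v0 c0(1) by (simp add: s1_def)
  have s2: "s2 > 0" using e(2) CA(1) by (simp add: s2_def)
  have s2p: "s2 powr lA = CA\<^sup>2 / A.rho e powr lA" using lA by (simp add: s2_def powr_powr)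
  \<comment> \<open>Three comparisons: the step \<open>e\<close> with the transversal step
    \<open>v\<close> at the same coset point, the transversal steps at two points of the coset, and
    the transversal step at \<open>x\<close> with \<open>F x - F y\<close>.\<close>
  define K1 where "K1 = h (A.rho e / A.rho v) * (h s1 * h (A.rho v))"
  define C where "C = h s2 powr lB * (2 * CB\<^sup>2 * K1 powr lB) + 1"
  have bound: "B.rho (F x - F z) powr lB * A.rho (x - y) powr lA \<le> C * (B.rho (F x - F y) powr lB * A.rho (x - z) powr lA)"
    if bc: "bicontrolled_map EA NA lA kA HA EB NB lB kB HB h F h' G" and xy: "x \<noteq> y" and le: "A.rho (x - y) \<le> A.rho (x - z)"
    for F G x y z
  proof -
    interpret bicontrolled_map EA NA lA kA HA EB NB lB kB HB h F h' G by (rule bc)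
    have K1: "K1 \<ge> 0" unfolding K1_def by (intro mult_nonneg_nonneg h_nonneg)
    define t where "t = ln (A.rho (x - y))"
    define s where "s = ln (A.rho (x - z))"
    have rxy: "A.rho (x - y) > 0" using xy by simp
    then have rxz: "A.rho (x - z) > 0" using le by linarith
    have et: "exp t = A.rho (x - y)" and es: "exp s = A.rho (x - z)" using rxy rxz by (auto simp: t_def s_def)
    have ts: "t \<le> s" using le by (simp flip: et es)
    define b where "b = B.rho (F x - F y)"
    define R where "R = (\<lambda>u. B.rho (F u - F (u + EA t v)))"
    have R_le: "R u \<le> h s1 * R w" if uw: "u - w \<in> HA" for u w
    proof -
      \<comment> \<open>The image of \<open>w + EA t v\<close> is translated by
        \<open>F u - F w\<close>, which lies in \<open>HB\<close>, so that \<open>p\<close> has the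
        same position relative to \<open>F u\<close> as this image has relative to
        \<open>F w\<close>. The preimage \<open>q\<close> of \<open>p\<close> lies in the coset of
        \<open>w + EA t v\<close>, hence at distance at least \<open>exp t * c0\<close> from
        \<open>u\<close>, and \<open>control\<close> at \<open>u\<close> applies.\<close>
      define p where "p = F (w + EA t v) - F w + F u"
      define q where "q = G p"
      have Fq: "F q = p" by (simp add: q_def)
      have "F q - F (w + EA t v) \<in> HB" using coset_image[OF uw] by (simp add: Fq p_def)
      then have "q - (w + EA t v) \<in> HA" by (rule coset_preimage)
      then have "q - (w + EA t v) - (u - w) \<in> HA" using uw by (rule subspace_diff[OF A.subspace_H])
      then have "EA (- t) (q - (w + EA t v) - (u - w)) \<in> HA" by (rule A.H_inv)
      then have "c0 \<le> A.rho (v + EA (- t) (q - (w + EA t v) - (u - w)))" by (intro c0(2) away)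
      also have "v + EA (- t) (q - (w + EA t v) - (u - w)) = EA (- t) (q - u)"
        by (simp add: A.E_diff A.E_plus A.E_uminus)
      also have "A.rho \<dots> = exp (- t) * A.rho (u - q)" using A.rho_uminus[of "q - u"] by (simp add: A.rho_E)
      finally have "exp t * c0 \<le> A.rho (u - q)" by (simp add: exp_minus field_simps)
      then have "s1 * (exp t * c0) \<le> s1 * A.rho (u - q)" using s1 by simp
      then have "A.rho (u - (u + EA t v)) \<le> s1 * A.rho (u - q)" using c0(1) by (simp add: A.rho_E s1_def mult_ac)
      then have "R u \<le> h s1 * B.rho (F u - F q)" unfolding R_def by (intro control s1)
      also have "B.rho (F u - F q) = R w" by (simp add: Fq p_def R_def)
      finally show ?thesis .
    qed
    define X where "X = (\<lambda>i::nat. x + real i *\<^sub>R EA t e)"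
    have XH: "X i - X j \<in> HA" for i j
      by (simp add: X_def flip: scaleR_diff_left)
        (intro subspace_scale[OF A.subspace_H] A.H_inv e)
    have X0: "X 0 = x" by (simp add: X_def)
    have Xs: "X (Suc i) = X i + EA t e" for i by (simp add: X_def algebra_simps)
    have Rx: "R x \<le> h (A.rho v) * b"
      unfolding R_def b_def using v0 by (intro control) (auto simp: A.rho_E et mult.commute)
    have Xstep: "B.rho (F (X i) - F (X (Suc i))) \<le> K1 * b" for i
    proof -
      have "B.rho (F (X i) - F (X (Suc i))) \<le> h (A.rho e / A.rho v) * R (X i)"
        unfolding R_def Xs using e(2) v0 by (intro control) (auto simp: A.rho_E)
      also have "R (X i) \<le> h s1 * R x" using R_le[OF XH[of i 0]] by (simp add: X0)
      also have "h s1 * R x \<le> h s1 * (h (A.rho v) * b)" using Rx h_nonneg by (intro mult_left_mono)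
      finally show ?thesis using h_nonneg by (simp add: K1_def mult_left_mono mult.assoc)
    qed
    have b: "b > 0" using xy inj_F by (simp add: b_def inj_eq)
    have Xnorm: "norm (F (X i) - F (X (Suc i))) \<le> CB * (K1 * b) powr lB" for i
    proof -
      have "norm (F (X i) - F (X (Suc i))) \<le> CB * B.rho (F (X i) - F (X (Suc i))) powr lB"
        by (intro CB(3) coset_image XH)
      also have "\<dots> \<le> CB * (K1 * b) powr lB" using Xstep[of i] CB(1) lB by (intro mult_left_mono powr_mono2) auto
      finally show ?thesis .
    qed
    \<comment> \<open>On the coset, \<open>rho\<close> to the power \<open>lA\<close> behaves like a
      norm, so this many steps of size \<open>exp t\<close> reach a distance of order
      \<open>exp s\<close>.\<close>
    define m where "m = nat \<lceil>exp (lA * (s - t))\<rceil>"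
    have "exp (lA * (s - t)) \<ge> 1" using lA ts by simp
    then have m: "exp (lA * (s - t)) \<le> real m" "real m \<le> 2 * exp (lA * (s - t))"
      unfolding m_def by linarith+
    have "norm (F (X 0) - F (X m)) \<le> real m * (CB * (K1 * b) powr lB)"
    proof -
      have "F (X 0) - F (X m) = (\<Sum>i<m. F (X i) - F (X (Suc i)))" by (rule sum_lessThan_telescope'[symmetric])
      also have "norm \<dots> \<le> (\<Sum>i<m. CB * (K1 * b) powr lB)" by (intro sum_norm_le Xnorm)
      finally show ?thesis by simp
    qed
    then have "CB * norm (F x - F (X m)) \<le> CB * (real m * (CB * (K1 * b) powr lB))"
      using CB(1) by (simp add: X0)
    moreover have "B.rho (F x - F (X m)) powr lB \<le> CB * norm (F x - F (X m))"
      using XH[of 0 m] by (intro CB(2) coset_image) (simp add: X0)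
    ultimately have up: "B.rho (F x - F (X m)) powr lB \<le> CB\<^sup>2 * K1 powr lB * real m * b powr lB"
      using K1 b by (simp add: powr_mult power2_eq_square mult_ac)
    have low: "exp s \<le> s2 * A.rho (x - X m)"
    proof -
      have "exp t powr lA * A.rho e powr lA \<le> CA * norm (EA t e)"
        using CA(2)[OF A.H_inv[OF e(1)], of t] by (simp add: A.rho_E powr_mult)
      then have "real m * (exp t powr lA * A.rho e powr lA) \<le> real m * (CA * norm (EA t e))"
        by (intro mult_left_mono) auto
      then have "real m * (exp t powr lA * A.rho e powr lA) \<le> CA * norm (x - X m)"
        by (simp add: X_def mult.left_commute)
      also have "CA * norm (x - X m) \<le> CA * (CA * A.rho (x - X m) powr lA)"
        using XH[of 0 m] CA(1) by (intro mult_left_mono CA(3)) (auto simp: X0)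
      finally have 1: "real m * (exp t powr lA * A.rho e powr lA) \<le> CA\<^sup>2 * A.rho (x - X m) powr lA"
        by (simp add: power2_eq_square mult_ac)
      have "exp s powr lA = exp (lA * (s - t)) * exp t powr lA"
        by (simp add: powr_def algebra_simps flip: exp_add)
      also have "\<dots> \<le> real m * exp t powr lA" using m(1) by (intro mult_right_mono) auto
      also have "\<dots> \<le> s2 powr lA * A.rho (x - X m) powr lA"
        using 1 e(2) by (simp add: s2p field_simps)
      also have "\<dots> = (s2 * A.rho (x - X m)) powr lA" using s2 by (simp add: powr_mult)
      finally show ?thesis using lA s2 powr_less_mono2[of lA "s2 * A.rho (x - X m)" "exp s"]
        by (meson A.rho_nonneg less_imp_le mult_nonneg_nonneg not_le)
    qed
    have "B.rho (F x - F z) \<le> h s2 * B.rho (F x - F (X m))"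
      using low by (intro control s2) (simp add: es)
    then have "B.rho (F x - F z) powr lB \<le> (h s2 * B.rho (F x - F (X m))) powr lB"
      using lB by (intro powr_mono2) auto
    also have "\<dots> = h s2 powr lB * B.rho (F x - F (X m)) powr lB" using h_nonneg by (simp add: powr_mult)
    also have "\<dots> \<le> h s2 powr lB * (CB\<^sup>2 * K1 powr lB * real m * b powr lB)"
      using up by (intro mult_left_mono) auto
    also have "\<dots> = (h s2 powr lB * (CB\<^sup>2 * K1 powr lB) * b powr lB) * real m" by (simp add: mult_ac)
    also have "\<dots> \<le> (h s2 powr lB * (CB\<^sup>2 * K1 powr lB) * b powr lB) * (2 * exp (lA * (s - t)))"
      using m(2) by (intro mult_left_mono) auto
    finally have "B.rho (F x - F z) powr lB * exp t powr lA \<le>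
        (h s2 powr lB * (CB\<^sup>2 * K1 powr lB) * b powr lB) * (2 * exp (lA * (s - t))) * exp t powr lA"
      by (intro mult_right_mono) auto
    also have "\<dots> = (h s2 powr lB * (2 * CB\<^sup>2 * K1 powr lB)) * (b powr lB * (exp (lA * (s - t)) * exp t powr lA))"
      by (simp add: mult_ac)
    also have "exp (lA * (s - t)) * exp t powr lA = exp s powr lA"
      by (simp add: powr_def algebra_simps flip: exp_add)
    also have "(h s2 powr lB * (2 * CB\<^sup>2 * K1 powr lB)) * (b powr lB * exp s powr lA) \<le> C * (b powr lB * exp s powr lA)"
      by (intro mult_right_mono) (auto simp: C_def)
    finally show ?thesis by (simp add: et es b_def)
  qed
  have "C > 0" unfolding C_def using CB(1) by (intro add_nonneg_pos) auto
  then show ?thesis using bound by (intro that)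
qed

text \<open>\<open>ratio_increase_bound\<close> is one-sided: it bounds the quotient at the farther
  point by that at the nearer one. Applied to the inverse map, with distances ordered in the target,
  it gives the opposite estimate.\<close>

lemma controlled_imp_quasisimilar:
  assumes "HA \<noteq> UNIV"
  obtains K where "K \<ge> 1"
    "\<And>F G. bicontrolled_map EA NA lA kA HA EB NB lB kB HB h F h' G \<Longrightarrow>
      \<exists>C>0. \<forall>x y. C / K * A.rho (x - y) powr (lA / lB) \<le> B.rho (F x - F y) \<and>
        B.rho (F x - F y) \<le> C * K * A.rho (x - y) powr (lA / lB)"
proof (cases "HB = UNIV")
  case True
  \<comment> \<open>Cosets pull back to cosets, so \<open>HB = UNIV\<close> would force
    \<open>HA = UNIV\<close>; there is no such map and any constant will do.\<close>
  then have "\<not> bicontrolled_map EA NA lA kA HA EB NB lB kB HB h F h' G" for F G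
    using bicontrolled_map.HB_ne_UNIV assms by blast
  then show ?thesis by (intro that[of 1]) auto
next
  case False
  interpret rev: two_flows EB NB lB kB HB EA NA lA kA HA ..
  obtain C1 where C1: "C1 > 0"
    "\<And>F G x y z. \<lbrakk>bicontrolled_map EA NA lA kA HA EB NB lB kB HB h F h' G; x \<noteq> y; A.rho (x - y) \<le> A.rho (x - z)\<rbrakk> \<Longrightarrow>
      B.rho (F x - F z) powr lB * A.rho (x - y) powr lA \<le> C1 * (B.rho (F x - F y) powr lB * A.rho (x - z) powr lA)"
    by (rule ratio_increase_bound[OF assms, of h h']) (rule that)
  obtain C2 where C2: "C2 > 0"
    "\<And>F G x y z. \<lbrakk>bicontrolled_map EB NB lB kB HB EA NA lA kA HA h' F h G; x \<noteq> y; B.rho (x - y) \<le> B.rho (x - z)\<rbrakk> \<Longrightarrow>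
      A.rho (F x - F z) powr lA * B.rho (x - y) powr lB \<le> C2 * (A.rho (F x - F y) powr lA * B.rho (x - z) powr lB)"
    by (rule rev.ratio_increase_bound[OF False, of h' h]) (rule that)
  have lA: "lA > 0" and lB: "lB > 0" using A.lam_pos B.lam_pos by auto
  define C3 where "C3 = max 1 (max C1 (max C2 (h 1 powr lB * h' 1 powr lA)))"
  \<comment> \<open>Two values of the quotient \<open>q\<close> differ at most by the factor
    \<open>C3\<^sup>2\<close>; the root returns from the power \<open>lB\<close> to the quasimetric
    itself.\<close>
  define K where "K = (C3\<^sup>2) powr (1 / lB)"
  have C3: "C3 \<ge> 1" "C1 \<le> C3" "C2 \<le> C3" "h 1 powr lB * h' 1 powr lA \<le> C3" by (auto simp: C3_def)
  have "C3\<^sup>2 \<ge> 1" using C3(1) by (simp add: one_le_power)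
  then have K: "K \<ge> 1" unfolding K_def using lB by (intro ge_one_powr_ge_zero) auto
  have "\<exists>C>0. \<forall>x y. C / K * A.rho (x - y) powr (lA / lB) \<le> B.rho (F x - F y) \<and>
        B.rho (F x - F y) \<le> C * K * A.rho (x - y) powr (lA / lB)"
    if bc: "bicontrolled_map EA NA lA kA HA EB NB lB kB HB h F h' G" for F G
  proof -
    interpret bicontrolled_map EA NA lA kA HA EB NB lB kB HB h F h' G by (rule bc)
    have bc': "bicontrolled_map EB NB lB kB HB EA NA lA kA HA h' G h F" by unfold_locales simp_all
    define a where "a = (\<lambda>x y. A.rho (x - y) powr lA)"
    define b where "b = (\<lambda>x y. B.rho (F x - F y) powr lB)"
    have ab_pos: "a x y > 0" "b x y > 0" if "x \<noteq> y" for x y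
      using that inj_F by (auto simp: a_def b_def inj_eq)
    have sym: "a x y = a y x" "b x y = b y x" for x y
      using A.rho_uminus[of "x - y"] B.rho_uminus[of "F x - F y"] by (auto simp: a_def b_def)
    have one: "b x y * a x z \<le> C3 * (b x z * a x y)" if "x \<noteq> y" "x \<noteq> z" for x y z
    proof -
      \<comment> \<open>If \<open>z\<close> is nearer in the source, the bound for \<open>F\<close>
        applies; if \<open>z\<close> is farther in source and target, the bound for the inverse
        applies. If the two orders disagree, \<open>control\<close> with \<open>s = 1\<close> in
        both directions makes the distances comparable at once.\<close>
      consider "A.rho (x - z) \<le> A.rho (x - y)"
        | "A.rho (x - y) \<le> A.rho (x - z)" "B.rho (F x - F y) \<le> B.rho (F x - F z)"
        | "A.rho (x - y) \<le> A.rho (x - z)" "B.rho (F x - F z) \<le> B.rho (F x - F y)" by linarith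
      then show ?thesis
      proof cases
        case 1
        then have "b x y * a x z \<le> C1 * (b x z * a x y)"
          unfolding a_def b_def using that by (intro C1(2)[OF bc]) auto
        also have "\<dots> \<le> C3 * (b x z * a x y)" using C3(2) by (intro mult_right_mono) (auto simp: a_def b_def)
        finally show ?thesis .
      next
        case 2
        have "F x \<noteq> F y" using that inj_F by (simp add: inj_eq)
        then have "a x z * b x y \<le> C2 * (a x y * b x z)"
          unfolding a_def b_def using C2(2)[OF bc', of "F x" "F y" "F z"] 2 by simp
        also have "\<dots> \<le> C3 * (a x y * b x z)" using C3(3) by (intro mult_right_mono) (auto simp: a_def b_def)
        finally show ?thesis by (simp add: mult.commute)
      next
        case 3
        have "B.rho (F x - F y) \<le> h 1 * B.rho (F x - F z)" using 3(1) by (intro control) auto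
        then have 1: "b x y \<le> h 1 powr lB * b x z"
          unfolding b_def using lB h_nonneg[of 1] powr_mono2[of lB "B.rho (F x - F y)" "h 1 * B.rho (F x - F z)"]
          by (simp add: powr_mult)
        have "A.rho (x - z) \<le> h' 1 * A.rho (x - y)"
          using 3(2) inv_map.control[of 1 "F x" "F z" "F y"] by simp
        then have 2: "a x z \<le> h' 1 powr lA * a x y"
          unfolding a_def using lA inv_map.h_nonneg[of 1] powr_mono2[of lA "A.rho (x - z)" "h' 1 * A.rho (x - y)"]
          by (simp add: powr_mult)
        have "b x y * a x z \<le> (h 1 powr lB * b x z) * (h' 1 powr lA * a x y)"
          using 1 2 by (intro mult_mono) (auto simp: a_def b_def)
        also have "\<dots> = (h 1 powr lB * h' 1 powr lA) * (b x z * a x y)" by (simp add: mult_ac)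
        also have "\<dots> \<le> C3 * (b x z * a x y)" using C3(4) by (intro mult_right_mono) (auto simp: a_def b_def)
        finally show ?thesis .
      qed
    qed
    define q where "q = (\<lambda>x y. b x y / a x y)"
    have q_one: "q x y \<le> C3 * q x z" if "x \<noteq> y" "x \<noteq> z" for x y z
      using one[OF that] ab_pos that by (simp add: q_def field_simps)
    have q_sym: "q x y = q y x" for x y by (simp add: q_def sym[of x y])
    have q_pos: "q x y > 0" if "x \<noteq> y" for x y using ab_pos[OF that] by (simp add: q_def)
    have q_two: "q x y \<le> C3\<^sup>2 * q u v" if "x \<noteq> y" "u \<noteq> v" for x y u v
    proof (cases "u = x")
      case True
      have "C3 * q x v \<le> C3\<^sup>2 * q x v" using C3(1) q_pos[of x v] that True
        by (intro mult_right_mono) (auto simp: power2_eq_square)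
      then show ?thesis using q_one[of x y v] that True by simp
    next
      case False
      have "q x y \<le> C3 * q x u" using False that by (intro q_one) auto
      also have "q x u = q u x" by (rule q_sym)
      also have "C3 * q u x \<le> C3 * (C3 * q u v)" using C3(1) False that by (intro mult_left_mono q_one) auto
      finally show ?thesis by (simp add: power2_eq_square mult_ac)
    qed
    define q0 where "q0 = q 0 ones"
    have q0: "q0 > 0" unfolding q0_def by (rule q_pos) (metis ones_nonzero)
    define C where "C = q0 powr (1 / lB)"
    have C: "C > 0" using q0 by (simp add: C_def)
    have "C / K * A.rho (x - y) powr (lA / lB) \<le> B.rho (F x - F y) \<and>
        B.rho (F x - F y) \<le> C * K * A.rho (x - y) powr (lA / lB)" for x y
    proof (cases "x = y")
      case False
      have root: "B.rho (F x - F y) = q x y powr (1 / lB) * A.rho (x - y) powr (lA / lB)"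
      proof -
        have "B.rho (F x - F y) = b x y powr (1 / lB)" using lB by (simp add: b_def powr_powr)
        also have "b x y = q x y * a x y" using ab_pos[OF False] by (simp add: q_def)
        also have "(q x y * a x y) powr (1 / lB) = q x y powr (1 / lB) * a x y powr (1 / lB)"
          using ab_pos[OF False] q_pos[OF False] by (simp add: powr_mult)
        finally show ?thesis by (simp add: a_def powr_powr)
      qed
      have "q x y powr (1 / lB) \<le> (C3\<^sup>2 * q0) powr (1 / lB)"
        using q_two[of x y 0 ones] False q_pos[OF False] lB ones_nonzero
        by (intro powr_mono2) (auto simp: q0_def)
      then have up: "q x y powr (1 / lB) \<le> C * K" using q0 by (simp add: C_def K_def powr_mult mult.commute)
      have "q0 powr (1 / lB) \<le> (C3\<^sup>2 * q x y) powr (1 / lB)"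
        using q_two[of 0 ones x y] False q0 lB ones_nonzero
        by (intro powr_mono2) (auto simp: q0_def)
      then have "C \<le> K * q x y powr (1 / lB)" using q_pos[OF False] by (simp add: C_def K_def powr_mult)
      then have low: "C / K \<le> q x y powr (1 / lB)" using K by (simp add: field_simps)
      show ?thesis unfolding root using up low by (intro conjI mult_right_mono) auto
    qed simp
    then show ?thesis using C by blast
  qed
  then show ?thesis using K by (intro that)
qed

end

section \<open>The flow of a matrix in a Jordan basis\<close>

definition complex_vec :: "real^'n \<Rightarrow> complex^'n" where
  "complex_vec x = (\<chi> i. complex_of_real (x $ i))"

definition Re_vec :: "complex^'n \<Rightarrow> real^'n" where "Re_vec v = (\<chi> i. Re (v $ i))"
definition Im_vec :: "complex^'n \<Rightarrow> real^'n" where "Im_vec v = (\<chi> i. Im (v $ i))"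
definition cnj_vec :: "complex^'n \<Rightarrow> complex^'n" where "cnj_vec v = (\<chi> i. cnj (v $ i))"

lemma norm_complex_vec [simp]: "norm (complex_vec x) = norm x"
  by (simp add: complex_vec_def norm_vec_def)

lemma complex_vec_eq_iff [simp]: "complex_vec x = complex_vec y \<longleftrightarrow> x = y"
  by (simp add: complex_vec_def cart_eq_iff)

lemma complex_vec_0 [simp]: "complex_vec 0 = 0"
  by (simp add: complex_vec_def cart_eq_iff)

lemma complex_vec_add: "complex_vec (x + y) = complex_vec x + complex_vec y"
  and complex_vec_scaleR: "complex_vec (r *\<^sub>R x) = complex_of_real r *s complex_vec x"
  by (simp_all add: complex_vec_def cart_eq_iff)

lemma complex_vec_decomp: "v = complex_vec (Re_vec v) + \<i> *s complex_vec (Im_vec v)"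
  by (simp add: complex_vec_def Re_vec_def Im_vec_def cart_eq_iff complex_eq_iff)

lemma Re_complex_vec [simp]: "Re_vec (complex_vec x) = x"
  by (simp add: complex_vec_def Re_vec_def cart_eq_iff)

lemma cnj_vec_decomp: "cnj_vec v = complex_vec (Re_vec v) - \<i> *s complex_vec (Im_vec v)"
  by (simp add: complex_vec_def Re_vec_def Im_vec_def cnj_vec_def cart_eq_iff complex_eq_iff)

lemma norm_cnj_vec [simp]: "norm (cnj_vec v) = norm v"
  by (simp add: cnj_vec_def norm_vec_def)

lemma norm_Re_vec: "norm (Re_vec v) \<le> norm v"
  unfolding norm_vec_def Re_vec_def by (intro L2_set_mono) (simp_all add: abs_Re_le_cmod)

lemma norm_vector_scalar_mult: "norm (a *s v) = cmod a * norm v" for v :: "complex^'n"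
proof -
  have "norm (a *s v) = L2_set (\<lambda>i. cmod a * norm (v $ i)) UNIV"
    by (simp add: norm_vec_def norm_mult)
  also have "\<dots> = cmod a * L2_set (\<lambda>i. norm (v $ i)) UNIV"
    by (rule L2_set_right_distrib[symmetric]) simp
  finally show ?thesis by (simp add: norm_vec_def)
qed

lemma scale_sum: "a *s sum f S = (\<Sum>i\<in>S. a *s f i)" for f :: "'i \<Rightarrow> complex^'n"
  by (simp add: cart_eq_iff sum_distrib_left)

lemma sum_scale: "sum f S *s v = (\<Sum>i\<in>S. f i *s v)" for v :: "complex^'n"
  by (simp add: cart_eq_iff sum_distrib_right)

lemma matrix_vector_mult_sum: "M *v sum f S = (\<Sum>i\<in>S. M *v f i)" for M :: "complex^'n^'m"
  by (induction S rule: infinite_finite_induct) (simp_all add: matrix_vector_right_distrib)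

lemma scaleR_eq_scalar_mult: "r *\<^sub>R v = complex_of_real r *s v" for v :: "complex^'n"
  by (simp add: cart_eq_iff) (simp add: scaleR_conv_of_real)

text \<open>\<open>p\<close> is a Jordan basis of a matrix and \<open>q\<close> its dual basis. The vector \<open>p j\<close> has position \<open>d j\<close>
  in its Jordan chain, which is the list \<open>p (j - d j)\<close>, \dots, \<open>p j\<close>, \dots\ with eigenvalue \<open>c j\<close>.\<close>

locale jordan_basis =
  fixes n :: nat and c :: "nat \<Rightarrow> complex" and d :: "nat \<Rightarrow> nat"
    and p :: "nat \<Rightarrow> complex^'n" and q :: "nat \<Rightarrow> complex^'n \<Rightarrow> complex"
  assumes chain: "j < n \<Longrightarrow> l \<le> d j \<Longrightarrow> l \<le> j \<and> d (j - l) = d j - l \<and> c (j - l) = c j"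
    and q_add: "q j (v + w) = q j v + q j w"
    and q_scale: "q j (a *s v) = a * q j v"
    and expand: "v = (\<Sum>j<n. q j v *s p j)"
    and dual: "i < n \<Longrightarrow> j < n \<Longrightarrow> q i (p j) = (if i = j then 1 else 0)"
begin

lemma q_0 [simp]: "q j 0 = 0"
  using q_scale[of j 0 0] by simp

lemma q_sum: "q j (sum f S) = (\<Sum>i\<in>S. q j (f i))"
  by (induction S rule: infinite_finite_induct) (simp_all add: q_add)

lemma linear_q: "linear (q j)"
  by (rule linearI) (simp_all add: q_add q_scale scaleR_eq_scalar_mult scaleR_conv_of_real)

lemma q_bound:
  obtains Q where "Q > 0" "\<And>j v. j < n \<Longrightarrow> cmod (q j v) \<le> Q * norm v"
proof -
  obtain Q where Q: "\<And>j. Q j > 0" "\<And>j v. cmod (q j v) \<le> Q j * norm v"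
  proof -
    have "\<forall>j. \<exists>Q>0. \<forall>v. cmod (q j v) \<le> Q * norm v"
      using linear_bounded_pos[OF linear_q] by metis
    then show ?thesis using that by metis
  qed
  have "cmod (q j v) \<le> (1 + (\<Sum>j<n. Q j)) * norm v" if "j < n" for j v
  proof -
    have "Q j \<le> (\<Sum>j<n. Q j)" using that Q(1) by (intro member_le_sum) (auto intro: less_imp_le)
    then have "Q j * norm v \<le> (1 + (\<Sum>j<n. Q j)) * norm v" by (intro mult_right_mono) auto
    then show ?thesis using Q(2)[of j v] by linarith
  qed
  moreover have "1 + (\<Sum>j<n. Q j) > 0" using Q(1) by (intro add_pos_nonneg sum_nonneg) (auto intro: less_imp_le)
  ultimately show ?thesis by (intro that)
qed

text \<open>The entry of the exponential of a Jordan block at distance \<open>l\<close> above the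
  diagonal.\<close>

definition coef :: "nat \<Rightarrow> nat \<Rightarrow> real \<Rightarrow> complex" where
  "coef j l t = exp (c j * of_real t) * (of_real t ^ l / fact l)"

definition flow_basis :: "nat \<Rightarrow> real \<Rightarrow> complex^'n" where
  "flow_basis j t = (\<Sum>l\<le>d j. coef j l t *s p (j - l))"

text \<open>The exponential of the matrix through its explicit action on the Jordan basis, from
  which growth can be read off. That it is the sum of the power series is shown in
  \<open>exp_series_flow\<close>.\<close>

definition flow :: "real \<Rightarrow> complex^'n \<Rightarrow> complex^'n" where
  "flow t v = (\<Sum>j<n. q j v *s flow_basis j t)"

lemma flow_add: "flow t (v + w) = flow t v + flow t w"
  by (simp add: flow_def q_add vector_sadd_rdistrib sum.distrib)

lemma flow_scale: "flow t (a *s v) = a *s flow t v"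
  by (simp add: flow_def q_scale scale_sum vector_smult_assoc)

lemma flow_sum: "flow t (sum f S) = (\<Sum>i\<in>S. flow t (f i))"
proof (induction S rule: infinite_finite_induct)
  case (insert x F)
  then show ?case by (simp add: flow_add)
qed (use flow_scale[of t 0 0] in auto)

lemma flow_p: "j < n \<Longrightarrow> flow t (p j) = flow_basis j t"
proof -
  assume j: "j < n"
  have "flow t (p j) = (\<Sum>i<n. if i = j then flow_basis j t else 0)"
    unfolding flow_def using j by (intro sum.cong refl) (auto simp: dual)
  then show ?thesis using j by simp
qed

lemma flow_0: "flow 0 v = v"
proof -
  have "flow_basis j 0 = p j" for j
  proof -
    have "flow_basis j 0 = (\<Sum>l\<le>d j. if l = 0 then p j else 0)"
      unfolding flow_basis_def coef_def by (intro sum.cong refl) auto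
    then show ?thesis by simp
  qed
  then show ?thesis using expand[of v] by (simp add: flow_def)
qed

text \<open>Collecting the double sum by the total descent \<open>r = l + m\<close> in the chain,
  the inner sums are binomial expansions of \<open>(s + t) ^ r\<close>.\<close>

lemma flow_flow_basis:
  assumes j: "j < n"
  shows "flow s (flow_basis j t) = flow_basis j (s + t)"
proof -
  have *: "flow s (p (j - l)) = (\<Sum>m\<le>d j - l. coef j m s *s p (j - (l + m)))" if "l \<le> d j" for l
  proof -
    have "j - l < n" using j by simp
    then show ?thesis using chain[OF j that] by (simp add: flow_p flow_basis_def coef_def)
  qed
  have "flow s (flow_basis j t) = (\<Sum>l\<le>d j. coef j l t *s flow s (p (j - l)))"
    by (simp add: flow_basis_def flow_sum flow_scale)
  also have "\<dots> = (\<Sum>l\<le>d j. \<Sum>m\<le>d j - l. (coef j l t * coef j m s) *s p (j - (l + m)))"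
    by (intro sum.cong refl) (simp add: * scale_sum vector_smult_assoc)
  also have "\<dots> = (\<Sum>(l, m)\<in>{(l, m). l + m \<le> d j}. (coef j l t * coef j m s) *s p (j - (l + m)))"
  proof -
    have "(SIGMA l:{..d j}. {..d j - l}) = {(l, m). l + m \<le> d j}" by auto
    then show ?thesis by (subst sum.Sigma) auto
  qed
  also have "\<dots> = (\<Sum>r\<le>d j. \<Sum>l\<le>r. (coef j l t * coef j (r - l) s) *s p (j - (l + (r - l))))"
    by (rule sum.triangle_reindex_eq)
  also have "\<dots> = (\<Sum>r\<le>d j. coef j r (s + t) *s p (j - r))"
  proof (intro sum.cong refl)
    fix r
    have "(\<Sum>l\<le>r. coef j l t * coef j (r - l) s) = coef j r (s + t)"
    proof -
      have "(\<Sum>l\<le>r. coef j l t * coef j (r - l) s)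
          = (\<Sum>l\<le>r. exp (c j * of_real (s + t)) / fact r * (of_nat (r choose l) * of_real t ^ l * of_real s ^ (r - l)))"
      proof (intro sum.cong refl)
        fix l assume "l \<in> {..r}"
        then have b: "(of_nat (r choose l) :: complex) = fact r / (fact l * fact (r - l))"
          by (intro binomial_fact) auto
        show "coef j l t * coef j (r - l) s
          = exp (c j * of_real (s + t)) / fact r * (of_nat (r choose l) * of_real t ^ l * of_real s ^ (r - l))"
          by (simp add: coef_def b algebra_simps exp_add)
      qed
      also have "\<dots> = exp (c j * of_real (s + t)) / fact r * (of_real t + of_real s) ^ r"
        by (simp add: binomial_ring sum_distrib_left)
      finally show ?thesis by (simp add: coef_def add.commute)
    qed
    then show "(\<Sum>l\<le>r. (coef j l t * coef j (r - l) s) *s p (j - (l + (r - l)))) = coef j r (s + t) *s p (j - r)"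
      by (simp flip: sum_scale)
  qed
  finally show ?thesis by (simp add: flow_basis_def)
qed

lemma flow_group: "flow (s + t) v = flow s (flow t v)"
  by (simp add: flow_def[of "s + t"] flow_def[of t] flow_sum flow_scale flow_flow_basis)

lemma norm_flow_basis: "norm (flow_basis j t) \<le> (\<Sum>l\<le>d j. cmod (coef j l t) * norm (p (j - l)))"
  unfolding flow_basis_def by (rule order_trans[OF norm_sum]) (simp add: norm_vector_scalar_mult)

lemma cont_flow: "continuous_on UNIV (\<lambda>t. flow t v)"
  unfolding flow_def flow_basis_def coef_def vector_scalar_mult_def
  by (intro continuous_intros) auto

lemma cmod_coef: "cmod (coef j l t) = exp (Re (c j) * t) * (\<bar>t\<bar> ^ l / fact l)"
  by (simp add: coef_def norm_mult norm_divide norm_power)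

text \<open>On a chain the matrix is \<open>c j\<close> plus a nilpotent shift, so its powers follow
  the binomial theorem; the induction step is Pascal's rule. For \<open>l > m\<close> the truncated
  exponent \<open>m - l\<close> is harmless because the binomial coefficient is 0.\<close>

lemma power_chain:
  assumes M: "\<And>j. j < n \<Longrightarrow> M *v p j = c j *s p j + (if d j = 0 then 0 else p (j - 1))" and j: "j < n"
  shows "((*v) M ^^ m) (p j) = (\<Sum>l\<le>d j. (of_nat (m choose l) * c j ^ (m - l)) *s p (j - l))"
proof (induction m)
  case 0
  have "(\<Sum>l\<le>d j. (of_nat (0 choose l) * c j ^ (0 - l)) *s p (j - l)) = (\<Sum>l\<le>d j. if l = 0 then p j else 0)"
    by (intro sum.cong refl) auto
  then show ?case by simp
next
  case (Suc m)
  define a where "a = (\<lambda>m l. of_nat (m choose l) * c j ^ (m - l) :: complex)"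
  have Mp: "M *v p (j - l) = c j *s p (j - l) + (if l = d j then 0 else p (j - Suc l))" if "l \<le> d j" for l
    using M[of "j - l"] chain[OF j that] j that by auto
  have a_Suc: "a (Suc m) (Suc l) = c j * a m (Suc l) + a m l" for l
  proof (cases "Suc l \<le> m")
    case True
    then have "c j * c j ^ (m - Suc l) = c j ^ (m - l)" by (metis Suc_diff_Suc Suc_le_lessD power_Suc)
    then show ?thesis by (simp add: a_def algebra_simps)
  next
    case False
    then show ?thesis by (simp add: a_def)
  qed
  have a_0: "a (Suc m) 0 = c j * a m 0" by (simp add: a_def)
  have "((*v) M ^^ Suc m) (p j) = M *v (\<Sum>l\<le>d j. a m l *s p (j - l))" using Suc by (simp add: a_def)
  also have "\<dots> = (\<Sum>l\<le>d j. a m l *s (M *v p (j - l)))"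
    by (simp add: matrix_vector_mult_sum vector_scalar_commute)
  also have "\<dots> = (\<Sum>l\<le>d j. (c j * a m l) *s p (j - l) + (if l = d j then 0 else a m l *s p (j - Suc l)))"
    by (intro sum.cong refl) (auto simp: Mp vector_add_ldistrib vector_smult_assoc mult.commute)
  also have "\<dots> = (\<Sum>l\<le>d j. (c j * a m l) *s p (j - l)) + (\<Sum>l<d j. a m l *s p (j - Suc l))"
  proof -
    have "(\<Sum>l\<le>d j. if l = d j then 0 else a m l *s p (j - Suc l))
        = (\<Sum>l<d j. if l = d j then 0 else a m l *s p (j - Suc l))"
      by (simp add: lessThan_Suc_atMost[symmetric])
    also have "\<dots> = (\<Sum>l<d j. a m l *s p (j - Suc l))" by (intro sum.cong) auto
    finally show ?thesis by (simp add: sum.distrib)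
  qed
  also have "\<dots> = (c j * a m 0) *s p j + (\<Sum>l<d j. (c j * a m (Suc l) + a m l) *s p (j - Suc l))"
    by (simp add: sum.atMost_shift sum.distrib vector_sadd_rdistrib add.assoc)
  also have "\<dots> = (\<Sum>l\<le>d j. a (Suc m) l *s p (j - l))"
    by (simp add: sum.atMost_shift a_Suc a_0)
  finally show ?case by (simp only: a_def)
qed

text \<open>The terms with \<open>m < l\<close> vanish. After a shift by \<open>l\<close> the
  binomial coefficient cancels the factorial, and the exponential series remains.\<close>

lemma exp_series_shift:
  fixes z :: complex and t :: real
  shows "(\<lambda>m. of_real t ^ m / fact m * (of_nat (m choose l) * z ^ (m - l))) sums
    (exp (z * of_real t) * (of_real t ^ l / fact l))"
proof -
  have "(\<lambda>m. of_real t ^ l / fact l * ((z * of_real t) ^ m /\<^sub>R fact m)) sums (of_real t ^ l / fact l * exp (z * of_real t))"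
    by (intro sums_mult exp_converges)
  moreover have "of_real t ^ l / fact l * ((z * of_real t) ^ m /\<^sub>R fact m)
      = of_real t ^ (m + l) / fact (m + l) * (of_nat (m + l choose l) * z ^ (m + l - l))" for m
  proof -
    have "(of_nat (m + l choose l) :: complex) = fact (m + l) / (fact l * fact m)"
      by (subst binomial_fact) auto
    then show ?thesis by (simp add: scaleR_conv_of_real power_add power_mult_distrib field_simps)
  qed
  ultimately have "(\<lambda>m. of_real t ^ (m + l) / fact (m + l) * (of_nat (m + l choose l) * z ^ (m + l - l))) sums
      (of_real t ^ l / fact l * exp (z * of_real t))" by simp
  then show ?thesis
    by (subst (asm) sums_zero_iff_shift) (auto simp: mult.commute)
qed

lemma sums_vec_iff: "f sums s \<longleftrightarrow> (\<forall>i. (\<lambda>m. f m $ i) sums (s $ i))" for f :: "nat \<Rightarrow> 'a::real_normed_vector^'k"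
  unfolding sums_def
  by (auto simp: sum_component[symmetric] intro: tendsto_vec_nth vec_tendstoI simp del: sum_component)

lemma exp_series_flow:
  assumes M: "\<And>j. j < n \<Longrightarrow> M *v p j = c j *s p j + (if d j = 0 then 0 else p (j - 1))"
  shows "(\<lambda>m. (of_real t ^ m / fact m) *s ((*v) M ^^ m) v) sums flow t v"
proof -
  have scale_sums: "(\<lambda>m. f m *s u) sums (s *s u)" if "f sums s" for f s and u :: "complex^'n"
    unfolding sums_vec_iff using that by (auto intro: sums_mult2)
  have scale_sums': "(\<lambda>m. a *s f m) sums (a *s (s :: complex^'n))" if "f sums s" for f s and a :: complex
    using that unfolding sums_vec_iff by (auto intro: sums_mult)
  have basis: "(\<lambda>m. (of_real t ^ m / fact m) *s ((*v) M ^^ m) (p j)) sums flow_basis j t" if j: "j < n" for j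
  proof -
    have "(\<lambda>m. \<Sum>l\<le>d j. (of_real t ^ m / fact m * (of_nat (m choose l) * c j ^ (m - l))) *s p (j - l)) sums flow_basis j t"
      unfolding flow_basis_def coef_def by (intro sums_sum scale_sums exp_series_shift)
    then show ?thesis by (simp add: power_chain[OF M j] scale_sum vector_smult_assoc)
  qed
  have lin: "((*v) M ^^ m) (\<Sum>j\<in>S. a j *s u j) = (\<Sum>j\<in>S. a j *s ((*v) M ^^ m) (u j))" for m S and a u
    by (induction m) (simp_all add: matrix_vector_mult_sum vector_scalar_commute)
  have "(\<lambda>m. \<Sum>j<n. q j v *s ((of_real t ^ m / fact m) *s ((*v) M ^^ m) (p j))) sums flow t v"
    unfolding flow_def
  proof (rule sums_sum)
    fix j assume "j \<in> {..<n}"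
    then show "(\<lambda>m. q j v *s ((of_real t ^ m / fact m) *s ((*v) M ^^ m) (p j))) sums (q j v *s flow_basis j t)"
      using basis[of j] by (intro scale_sums') auto
  qed
  moreover have "(of_real t ^ m / fact m) *s ((*v) M ^^ m) v
      = (\<Sum>j<n. q j v *s ((of_real t ^ m / fact m) *s ((*v) M ^^ m) (p j)))" for m
    by (subst expand[of v], subst lin) (simp add: scale_sum vector_smult_assoc mult.commute)
  ultimately show ?thesis by simp
qed

end

definition complex_matrix :: "real^'n^'n \<Rightarrow> complex^'n^'n" where
  "complex_matrix A = (\<chi> i j. complex_of_real (A $ i $ j))"

lemma complex_matrix_mult_vec: "complex_matrix A *v complex_vec x = complex_vec (A *v x)"
  by (simp add: complex_matrix_def complex_vec_def matrix_vector_mult_def cart_eq_iff)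

locale real_jordan_basis = jordan_basis n c d p q
  for n c d and p :: "nat \<Rightarrow> complex^'n" and q +
  fixes A :: "real^'n^'n" and lam :: real and k :: nat
  assumes chain_A: "j < n \<Longrightarrow> complex_matrix A *v p j = c j *s p j + (if d j = 0 then 0 else p (j - 1))"
    and lam_pos: "lam > 0"
    and lam_le: "j < n \<Longrightarrow> lam \<le> Re (c j)"
    and k_max: "j < n \<Longrightarrow> Re (c j) = lam \<Longrightarrow> d j \<le> k"
    and k_attained: "\<exists>j<n. Re (c j) = lam \<and> d j = k"
begin

definition E :: "real \<Rightarrow> real^'n \<Rightarrow> real^'n" where
  "E t x = matrix_exp (t *\<^sub>R A) *v x"

text \<open>\<open>matrix_exp\<close> is an infinite sum of matrices whose convergence is
  established here as well: applied to the unit vectors, the series of the complex flow gives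
  convergence of each entry, with limit \<open>Y\<close>.\<close>

lemma complex_vec_E: "complex_vec (E t x) = flow t (complex_vec x)"
proof -
  define W where "W = (\<lambda>m. (((**) (t *\<^sub>R A) ^^ m) (Finite_Cartesian_Product.mat 1)) /\<^sub>R fact m)"
  have pow1: "(((**) B ^^ m) (Finite_Cartesian_Product.mat 1)) *v y = ((*v) B ^^ m) y" for B :: "real^'n^'n" and m y
    by (induction m) (simp_all flip: matrix_vector_mul_assoc)
  have pow2: "((*v) (t *\<^sub>R A) ^^ m) y = t ^ m *\<^sub>R ((*v) A ^^ m) y" for m y
    by (induction m) (simp_all add: scaleR_matrix_vector_assoc[symmetric] matrix_vector_mult_scaleR mult.commute)
  have pow3: "complex_vec (((*v) A ^^ m) y) = ((*v) (complex_matrix A) ^^ m) (complex_vec y)" for m y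
    by (induction m) (simp_all flip: complex_matrix_mult_vec)
  have W: "complex_vec (W m *v y) = (of_real t ^ m / fact m) *s ((*v) (complex_matrix A) ^^ m) (complex_vec y)" for m y
    by (simp add: W_def scaleR_matrix_vector_assoc[symmetric] pow1 pow2 pow3 complex_vec_scaleR
        vector_smult_assoc divide_inverse mult.commute)
  have ser: "(\<lambda>m. complex_vec (W m *v y)) sums flow t (complex_vec y)" for y
    unfolding W by (rule exp_series_flow) (rule chain_A)
  define Y :: "real^'n^'n" where "Y = (\<chi> i j. Re (flow t (complex_vec (axis j 1)) $ i))"
  have entry: "(\<lambda>m. W m $ i $ j) sums (Y $ i $ j)" for i j
  proof -
    have "(\<lambda>m. complex_vec (W m *v axis j 1) $ i) sums (flow t (complex_vec (axis j 1)) $ i)"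
      using ser[of "axis j 1"] unfolding sums_vec_iff by blast
    then have "(\<lambda>m. Re (complex_vec (W m *v axis j 1) $ i)) sums Re (flow t (complex_vec (axis j 1)) $ i)"
      by (rule sums_Re)
    then show ?thesis
      by (simp add: Y_def complex_vec_def matrix_vector_mul_component inner_axis)
  qed
  have "W sums Y" using entry by (simp add: sums_vec_iff)
  then have "matrix_exp (t *\<^sub>R A) = Y" unfolding matrix_exp_def W_def[symmetric] by (rule sums_unique[symmetric])
  then have E: "E t x = Y *v x" by (simp add: E_def)
  have "(\<lambda>m. (W m *v x) $ i) sums ((Y *v x) $ i)" for i
    unfolding matrix_vector_mult_def vec_lambda_beta by (intro sums_sum sums_mult2 entry)
  then have "(\<lambda>m. complex_vec (W m *v x)) sums complex_vec (Y *v x)"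
    unfolding sums_vec_iff complex_vec_def vec_lambda_beta by (intro allI sums_of_real)
  then show ?thesis unfolding E using ser[of x] by (rule sums_unique2)
qed

lemma flow_decomp: "flow t v = complex_vec (E t (Re_vec v)) + \<i> *s complex_vec (E t (Im_vec v))"
  by (subst complex_vec_decomp[of v]) (simp add: flow_add flow_scale complex_vec_E)

lemma flow_cnj: "flow t (cnj_vec v) = cnj_vec (flow t v)"
proof -
  have "flow t u = flow t (u - w) + flow t w" for u w by (simp flip: flow_add)
  then have "flow t (u - w) = flow t u - flow t w" for u w by (simp add: algebra_simps)
  then have "flow t (cnj_vec v) = complex_vec (E t (Re_vec v)) - \<i> *s complex_vec (E t (Im_vec v))"
    by (simp add: cnj_vec_decomp flow_scale complex_vec_E)
  moreover have "cnj_vec (complex_vec a + \<i> *s complex_vec b) = complex_vec a - \<i> *s complex_vec b" for a b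
    by (simp add: cnj_vec_def complex_vec_def cart_eq_iff complex_eq_iff)
  ultimately show ?thesis by (metis flow_decomp)
qed

lemma Re_flow: "Re_vec (flow t v) = E t (Re_vec v)"
  unfolding flow_decomp by (simp add: Re_vec_def complex_vec_def cart_eq_iff)

text \<open>The last vectors of the largest blocks with real part \<open>lam\<close>: by
  \<open>k_max\<close> no position beyond \<open>k\<close> occurs for this real part. Hence
  \<open>j - k\<close> is the index of the eigenvector at the start of the block.\<close>

definition J :: "nat set" where "J = {j. j < n \<and> Re (c j) = lam \<and> d j = k}"

definition HC :: "(complex^'n) set" where
  "HC = {v. \<forall>i<n. q i v \<noteq> 0 \<longrightarrow> i \<in> (\<lambda>j. j - k) ` J}"

definition H :: "(real^'n) set" where "H = {x. complex_vec x \<in> HC}"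

section \<open>Leading term of the backward flow\<close>

definition weight :: "real \<Rightarrow> real" where "weight t = exp (- lam * t) * t ^ k"

text \<open>The quotient of \<open>coef j k (- t)\<close> by \<open>weight t\<close>. For
  \<open>j\<close> in \<open>J\<close> the number \<open>c j - lam\<close> is imaginary, so the
  modulus is \<open>1 / fact k\<close> for every \<open>t\<close>.\<close>

definition phase :: "nat \<Rightarrow> real \<Rightarrow> complex" where
  "phase j t = exp (- (c j - of_real lam) * of_real t) * ((- 1) ^ k / fact k)"

text \<open>The part of \<open>flow (- t) v\<close>, divided by \<open>weight t\<close>, that does
  not tend to 0: the descents by \<open>k\<close> places in the largest blocks with real part
  \<open>lam\<close>, which end in eigenvectors.\<close>

definition main_part :: "real \<Rightarrow> complex^'n \<Rightarrow> complex^'n" where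
  "main_part t v = (\<Sum>j\<in>J. (q j v * phase j t) *s p (j - k))"

lemma finite_J: "finite J" by (simp add: J_def)

lemma weight_pos: "t > 0 \<Longrightarrow> weight t > 0" by (simp add: weight_def)

definition remainder :: "nat \<Rightarrow> nat \<Rightarrow> real \<Rightarrow> complex" where
  "remainder j l t = coef j l (- t) / of_real (weight t) - (if j \<in> J \<and> l = k then phase j t else 0)"

text \<open>The leading coefficient cancels exactly. Another coefficient with real part
  \<open>lam\<close> has \<open>l < k\<close> and lacks a power of \<open>t\<close>; a coefficient
  with larger real part decays exponentially, whatever the length of its block.\<close>

lemma remainder_tendsto_0:
  assumes j: "j < n" and l: "l \<le> d j"
  shows "(remainder j l \<longlongrightarrow> 0) at_top"
proof (cases "j \<in> J \<and> l = k")
  case True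
  have "\<forall>\<^sub>F t in at_top. 0 = remainder j l t"
    using eventually_gt_at_top[of "0::real"]
  proof eventually_elim
    case (elim t)
    have "exp (c j * of_real (- t)) = exp (- (c j - of_real lam) * of_real t) * of_real (exp (- lam * t))"
      by (simp add: algebra_simps flip: exp_add exp_of_real)
    moreover have "(of_real (- t) :: complex) ^ k = (- 1) ^ k * of_real t ^ k"
      by (subst power_mult_distrib[symmetric]) simp
    ultimately have "coef j l (- t) = phase j t * of_real (weight t)"
      using True by (simp add: coef_def phase_def weight_def)
    then show ?case using True weight_pos[OF elim] by (simp add: remainder_def)
  qed
  then show ?thesis using Lim_transform_eventually tendsto_const by fast
next
  case False
  have R: "lam \<le> Re (c j)" using j by (rule lam_le)
  have eq: "cmod (remainder j l t) = exp (- (Re (c j) - lam) * t) * (t ^ l / t ^ k) / fact l" if "t > 0" for t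
  proof -
    have "remainder j l t = coef j l (- t) / of_real (weight t)" using False by (auto simp: remainder_def)
    then have "cmod (remainder j l t) = cmod (coef j l (- t)) / weight t"
      using weight_pos[OF that] by (simp add: norm_divide)
    also have "\<dots> = exp (- (Re (c j) * t)) / exp (- (lam * t)) * (t ^ l / t ^ k) / fact l"
      using that by (simp add: cmod_coef weight_def)
    also have "exp (- (Re (c j) * t)) / exp (- (lam * t)) = exp (- (Re (c j) - lam) * t)"
      by (simp add: algebra_simps flip: exp_diff)
    finally show ?thesis .
  qed
  show ?thesis
  proof (cases "Re (c j) = lam")
    case True
    then have "l < k" using False l k_max[OF j True] j by (cases "l = k") (auto simp: J_def)
    show ?thesis
    proof (rule Lim_null_comparison)
      show "((\<lambda>t::real. 1 / t) \<longlongrightarrow> 0) at_top"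
        using tendsto_inverse_0_at_top[OF filterlim_ident] by (simp add: inverse_eq_divide)
      show "\<forall>\<^sub>F t in at_top. norm (remainder j l t) \<le> 1 / t"
        using eventually_ge_at_top[of "1::real"]
      proof eventually_elim
        case (elim t)
        have "t ^ l * t \<le> t ^ k" using \<open>l < k\<close> elim power_increasing[of "Suc l" k t] by (simp add: mult.commute)
        then have "t ^ l / t ^ k \<le> 1 / t" using elim by (simp add: field_simps)
        moreover have "t ^ l / t ^ k / fact l \<le> t ^ l / t ^ k / 1"
          using elim by (intro divide_left_mono) auto
        ultimately show ?case using eq[of t] elim True by simp
      qed
    qed
  next
    case False
    define b where "b = Re (c j) - lam"
    have b: "b > 0" using R False by (simp add: b_def)
    show ?thesis
    proof (rule Lim_null_comparison)
      show "((\<lambda>t. (1 + 1 * t) ^ l * exp (- b * t)) \<longlongrightarrow> 0) at_top" by (rule exp_dominates_power[OF b])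
      show "\<forall>\<^sub>F t in at_top. norm (remainder j l t) \<le> (1 + 1 * t) ^ l * exp (- b * t)"
        using eventually_ge_at_top[of "1::real"]
      proof eventually_elim
        case (elim t)
        have "t ^ l / t ^ k \<le> t ^ l / 1" using elim by (intro divide_left_mono) auto
        also have "t ^ l / 1 \<le> (1 + 1 * t) ^ l" using elim by (simp add: power_mono)
        finally have 1: "t ^ l / t ^ k \<le> (1 + 1 * t) ^ l" .
        have "norm (remainder j l t) \<le> exp (- b * t) * (t ^ l / t ^ k) / 1"
          using eq[of t] elim unfolding b_def by (auto intro!: divide_left_mono)
        also have "\<dots> \<le> exp (- b * t) * (1 + 1 * t) ^ l" unfolding div_by_1 by (intro mult_left_mono 1) simp
        finally show ?case by (simp add: mult.commute)
      qed
    qed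
  qed
qed

text \<open>The error is uniform in \<open>v\<close> because it is a finite combination of
  remainders whose coefficients \<open>q j v\<close> are bounded by
  \<open>Q * norm v\<close>.\<close>

lemma flow_main_part:
  assumes "\<epsilon> > 0"
  obtains T0 where "T0 > 0"
    "\<And>t v. t \<ge> T0 \<Longrightarrow> norm (flow (- t) v - of_real (weight t) *s main_part t v) \<le> \<epsilon> * weight t * norm v"
proof -
  obtain Q where Q: "Q > 0" "\<And>j v. j < n \<Longrightarrow> cmod (q j v) \<le> Q * norm v" by (rule q_bound) metis
  define S where "S = (\<lambda>t. \<Sum>j<n. \<Sum>l\<le>d j. cmod (remainder j l t) * norm (p (j - l)))"
  have "(S \<longlongrightarrow> (\<Sum>j<n. \<Sum>l\<le>d j. 0 * norm (p (j - l)))) at_top"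
    unfolding S_def using remainder_tendsto_0
    by (intro tendsto_sum tendsto_mult tendsto_const tendsto_norm_zero) auto
  then have "(S \<longlongrightarrow> 0) at_top" by simp
  then have "\<forall>\<^sub>F t in at_top. S t < \<epsilon> / Q" using assms Q(1) by (intro order_tendstoD(2)) auto
  then obtain T0 where T0: "\<And>t. t \<ge> T0 \<Longrightarrow> S t < \<epsilon> / Q" by (auto simp: eventually_at_top_linorder)
  have "norm (flow (- t) v - of_real (weight t) *s main_part t v) \<le> \<epsilon> * weight t * norm v"
    if t: "t \<ge> max 1 T0" for t v
  proof -
    have W: "weight t > 0" using t by (intro weight_pos) auto
    have "main_part t v = (\<Sum>j<n. \<Sum>l\<le>d j. (q j v * (if j \<in> J \<and> l = k then phase j t else 0)) *s p (j - l))"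
    proof -
      have "(\<Sum>j<n. \<Sum>l\<le>d j. (q j v * (if j \<in> J \<and> l = k then phase j t else 0)) *s p (j - l))
          = (\<Sum>j<n. if j \<in> J then (q j v * phase j t) *s p (j - k) else 0)"
      proof (intro sum.cong refl)
        fix j
        have "(\<Sum>l\<le>d j. (q j v * (if j \<in> J \<and> l = k then phase j t else 0)) *s p (j - l))
            = (\<Sum>l\<le>d j. if l = k then (if j \<in> J then (q j v * phase j t) *s p (j - k) else 0) else 0)"
          by (intro sum.cong refl) auto
        then show "(\<Sum>l\<le>d j. (q j v * (if j \<in> J \<and> l = k then phase j t else 0)) *s p (j - l))
            = (if j \<in> J then (q j v * phase j t) *s p (j - k) else 0)"
          by (auto simp: J_def)
      qed
      also have "\<dots> = main_part t v"
        unfolding main_part_def by (subst sum.inter_filter[symmetric]) (auto simp: J_def intro!: sum.cong)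
      finally show ?thesis by simp
    qed
    moreover have "flow (- t) v = (\<Sum>j<n. \<Sum>l\<le>d j. (q j v * coef j l (- t)) *s p (j - l))"
      by (simp add: flow_def flow_basis_def scale_sum vector_smult_assoc)
    moreover have "q j v * coef j l (- t) - of_real (weight t) * (q j v * (if j \<in> J \<and> l = k then phase j t else 0))
        = of_real (weight t) * q j v * remainder j l t" for j l
      using W by (simp add: remainder_def field_simps)
    ultimately have eq: "flow (- t) v - of_real (weight t) *s main_part t v
        = (\<Sum>j<n. \<Sum>l\<le>d j. (of_real (weight t) * q j v * remainder j l t) *s p (j - l))"
      by (simp add: scale_sum vector_smult_assoc flip: sum_subtractf vector_sub_rdistrib)
    have "norm (flow (- t) v - of_real (weight t) *s main_part t v)
        \<le> (\<Sum>j<n. \<Sum>l\<le>d j. (weight t * (Q * norm v)) * (cmod (remainder j l t) * norm (p (j - l))))"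
      unfolding eq
    proof (intro sum_norm_le)
      fix j l assume "j \<in> {..<n}"
      then have "weight t * cmod (q j v) \<le> weight t * (Q * norm v)"
        using W Q(2)[of j v] by (intro mult_left_mono) auto
      then have "(weight t * cmod (q j v)) * (cmod (remainder j l t) * norm (p (j - l)))
          \<le> (weight t * (Q * norm v)) * (cmod (remainder j l t) * norm (p (j - l)))"
        by (intro mult_right_mono) auto
      then show "norm ((of_real (weight t) * q j v * remainder j l t) *s p (j - l))
          \<le> (weight t * (Q * norm v)) * (cmod (remainder j l t) * norm (p (j - l)))"
        using W by (simp add: norm_vector_scalar_mult norm_mult mult.assoc)
    qed
    also have "\<dots> = weight t * (Q * norm v) * S t" by (simp only: S_def sum_distrib_left)
    also have "\<dots> \<le> weight t * (Q * norm v) * (\<epsilon> / Q)"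
      using T0[of t] t W Q(1) by (intro mult_left_mono) auto
    finally show ?thesis using Q(1) by (simp add: mult_ac)
  qed
  then show ?thesis by (intro that[of "max 1 T0"]) auto
qed

lemma J_shift: "j \<in> J \<Longrightarrow> j - k < n \<and> d (j - k) = 0 \<and> c (j - k) = c j \<and> k \<le> j"
  using chain[of j k] by (auto simp: J_def)

lemma inj_shift: "inj_on (\<lambda>j. j - k) J"
  using J_shift by (intro inj_onI) (metis le_add_diff_inverse2)

lemma p_shift_in_HC: "j \<in> J \<Longrightarrow> p (j - k) \<in> HC"
  using J_shift[of j] by (auto simp: HC_def dual split: if_splits)

lemma HC_expand:
  assumes "v \<in> HC"
  shows "v = (\<Sum>j\<in>J. q (j - k) v *s p (j - k))"
proof -
  have "v = (\<Sum>i<n. q i v *s p i)" by (rule expand)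
  also have "\<dots> = (\<Sum>i\<in>(\<lambda>j. j - k) ` J. q i v *s p i)"
    using assms J_shift by (intro sum.mono_neutral_right) (auto simp: HC_def)
  also have "\<dots> = (\<Sum>j\<in>J. q (j - k) v *s p (j - k))" by (simp add: sum.reindex[OF inj_shift])
  finally show ?thesis .
qed

lemma flow_HC:
  assumes "v \<in> HC"
  shows "flow t v = (\<Sum>j\<in>J. (q (j - k) v * exp (c j * of_real t)) *s p (j - k))"
proof -
  have "flow t (p (j - k)) = exp (c j * of_real t) *s p (j - k)" if "j \<in> J" for j
    using J_shift[OF that] by (simp add: flow_p flow_basis_def coef_def)
  then show ?thesis
    by (subst HC_expand[OF assms]) (simp add: flow_sum flow_scale vector_smult_assoc)
qed

text \<open>Every vector of \<open>HC\<close> is a limit of rescaled images of a bounded family of vectors under \<open>flow (- t)\<close>,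
  and all such limits lie in \<open>HC\<close>. As \<open>flow\<close> commutes with conjugation, so does \<open>HC\<close>.\<close>

definition source :: "complex^'n \<Rightarrow> real \<Rightarrow> complex^'n" where
  "source v t = (\<Sum>j\<in>J. (q (j - k) v * (exp ((c j - of_real lam) * of_real t) * ((- 1) ^ k * fact k))) *s p j)"

text \<open>\<open>source\<close> moves the coordinates of \<open>v\<close> from the starts of the
  blocks to their ends and multiplies them by the inverses of \<open>phase\<close>; the sign
  \<open>(- 1) ^ k\<close> is its own inverse.\<close>

lemma main_part_source:
  assumes "v \<in> HC"
  shows "main_part t (source v t) = v"
proof -
  have "q j (source v t) * phase j t = q (j - k) v" if j: "j \<in> J" for j
  proof -
    have "q j (source v t) = (\<Sum>i\<in>J. if i = j then q (j - k) v * (exp ((c j - of_real lam) * of_real t) * ((- 1) ^ k * fact k)) else 0)"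
      unfolding source_def q_sum q_scale using j by (intro sum.cong refl) (auto simp: dual J_def)
    also have "\<dots> = q (j - k) v * (exp ((c j - of_real lam) * of_real t) * ((- 1) ^ k * fact k))"
      using j finite_J by simp
    finally have src: "q j (source v t) = q (j - k) v * (exp ((c j - of_real lam) * of_real t) * ((- 1) ^ k * fact k))" .
    have alg: "x * (e1 * (s * f)) * (e2 * (s / f)) = x * (e1 * e2) * (s * s)" if "f \<noteq> 0" for x e1 e2 s f :: complex
      using that by simp
    have 1: "exp ((c j - of_real lam) * of_real t) * exp (- (c j - of_real lam) * of_real t) = 1"
      by (simp add: algebra_simps flip: exp_add)
    have 2: "(- 1) ^ k * (- 1) ^ k = (1 :: complex)" by (simp flip: power_mult_distrib)
    show ?thesis unfolding src phase_def by (subst alg) (simp_all only: 1 2 fact_nonzero not_False_eq_True mult_1_right)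
  qed
  then show ?thesis unfolding main_part_def by (subst (2) HC_expand[OF assms]) simp
qed

lemma source_bounded:
  obtains C where "\<And>t. norm (source v t) \<le> C"
proof -
  have "norm (source v t) \<le> (\<Sum>j\<in>J. cmod (q (j - k) v) * fact k * norm (p j))" for t
    unfolding source_def
  proof (intro sum_norm_le)
    fix j assume j: "j \<in> J"
    then have e: "cmod (exp ((c j - of_real lam) * of_real t)) = 1" by (simp add: J_def)
    show "norm ((q (j - k) v * (exp ((c j - of_real lam) * of_real t) * ((- 1) ^ k * fact k))) *s p j)
        \<le> cmod (q (j - k) v) * fact k * norm (p j)"
      unfolding norm_vector_scalar_mult norm_mult e by (simp add: norm_power)
  qed
  then show ?thesis by (rule that)
qed

lemma flow_source_tendsto:
  assumes "v \<in> HC"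
  shows "((\<lambda>t. (1 / of_real (weight t)) *s flow (- t) (source v t)) \<longlongrightarrow> v) at_top"
proof (rule LIM_zero_cancel, rule tendstoI)
  fix r :: real assume r: "r > 0"
  obtain C where C: "\<And>t. norm (source v t) \<le> C" by (rule source_bounded[of v]) metis
  define \<epsilon> where "\<epsilon> = r / (\<bar>C\<bar> + 1)"
  have \<epsilon>: "\<epsilon> > 0" using r by (simp add: \<epsilon>_def)
  obtain T0 where T0: "T0 > 0"
    "\<And>t v. t \<ge> T0 \<Longrightarrow> norm (flow (- t) v - of_real (weight t) *s main_part t v) \<le> \<epsilon> * weight t * norm v"
    by (rule flow_main_part[OF \<epsilon>]) (rule that)
  show "\<forall>\<^sub>F t in at_top. dist ((1 / of_real (weight t)) *s flow (- t) (source v t) - v) 0 < r"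
    using eventually_ge_at_top[of T0]
  proof eventually_elim
    case (elim t)
    have W: "weight t > 0" using elim T0(1) by (intro weight_pos) auto
    have "norm (flow (- t) (source v t) - of_real (weight t) *s v) \<le> \<epsilon> * weight t * norm (source v t)"
      using T0(2)[OF elim, of "source v t"] by (simp add: main_part_source[OF assms])
    also have "\<dots> \<le> \<epsilon> * weight t * \<bar>C\<bar>" using C[of t] W \<epsilon> by (intro mult_left_mono) auto
    also have "\<dots> < r * weight t"
      using W r by (simp add: \<epsilon>_def field_simps)
    finally have *: "norm (flow (- t) (source v t) - of_real (weight t) *s v) < r * weight t" .
    have "(1 / of_real (weight t)) *s flow (- t) (source v t) - v
        = (1 / of_real (weight t)) *s (flow (- t) (source v t) - of_real (weight t) *s v)"
      using W by (simp add: vector_ssub_ldistrib vector_smult_assoc)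
    then have "norm ((1 / of_real (weight t)) *s flow (- t) (source v t) - v)
        = cmod (1 / of_real (weight t)) * norm (flow (- t) (source v t) - of_real (weight t) *s v)"
      by (simp only: norm_vector_scalar_mult)
    also have "\<dots> = norm (flow (- t) (source v t) - of_real (weight t) *s v) / weight t"
      using W by (simp add: norm_divide)
    also have "\<dots> < r" using * W by (simp only: pos_divide_less_eq)
    finally show ?case by (simp only: dist_norm diff_zero)
  qed
qed

text \<open>Conjugation need not permute the chosen Jordan basis, so the defining coordinates of
  \<open>HC\<close> say nothing directly. Instead the conjugate of \<open>v\<close> is the limit of
  rescaled backward flows of the conjugated, still bounded sources.\<close>

lemma HC_cnj:
  assumes "v \<in> HC"
  shows "cnj_vec v \<in> HC"
  unfolding HC_def
proof (intro CollectI allI impI, rule ccontr)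
  fix i assume i: "i < n" "q i (cnj_vec v) \<noteq> 0" "i \<notin> (\<lambda>j. j - k) ` J"
  define f where "f = (\<lambda>t. (1 / of_real (weight t)) *s flow (- t) (cnj_vec (source v t)))"
  have cnj_scale: "cnj_vec (x *s u) = cnj x *s cnj_vec u" for x and u :: "complex^'n"
    by (simp add: cnj_vec_def cart_eq_iff)
  have "f = (\<lambda>t. cnj_vec ((1 / of_real (weight t)) *s flow (- t) (source v t)))"
    unfolding f_def by (simp add: fun_eq_iff flow_cnj cnj_scale)
  moreover have "((\<lambda>t. cnj_vec ((1 / of_real (weight t)) *s flow (- t) (source v t))) \<longlongrightarrow> cnj_vec v) at_top"
    unfolding cnj_vec_def by (intro tendsto_vec_lambda tendsto_cnj tendsto_vec_nth flow_source_tendsto assms)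
  ultimately have "(f \<longlongrightarrow> cnj_vec v) at_top" by simp
  then have lim1: "((\<lambda>t. q i (f t)) \<longlongrightarrow> q i (cnj_vec v)) at_top"
    by (rule bounded_linear.tendsto[OF linear_conv_bounded_linear[THEN iffD1, OF linear_q]])
  obtain C where C: "\<And>t. norm (source v t) \<le> C" by (rule source_bounded[of v]) metis
  obtain Q where Q: "Q > 0" "\<And>j v. j < n \<Longrightarrow> cmod (q j v) \<le> Q * norm v" by (rule q_bound) metis
  define r where "r = cmod (q i (cnj_vec v))"
  have r: "r > 0" using i by (simp add: r_def)
  define \<epsilon> where "\<epsilon> = r / (2 * Q * (\<bar>C\<bar> + 1))"
  have \<epsilon>: "\<epsilon> > 0" using r Q(1) by (simp add: \<epsilon>_def)
  obtain T0 where T0: "T0 > 0"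
    "\<And>t v. t \<ge> T0 \<Longrightarrow> norm (flow (- t) v - of_real (weight t) *s main_part t v) \<le> \<epsilon> * weight t * norm v"
    by (rule flow_main_part[OF \<epsilon>]) (rule that)
  \<comment> \<open>The forbidden coordinate vanishes on the leading term. Only the error
    contributes to it, at most \<open>r / 2\<close> by the choice of \<open>\<epsilon>\<close>,
    whereas the limit would have modulus \<open>r\<close>.\<close>
  have q_main: "q i (main_part t u) = 0" for t u
    unfolding main_part_def q_sum q_scale using i J_shift by (intro sum.neutral) (auto simp: dual)
  have "\<forall>\<^sub>F t in at_top. cmod (q i (f t)) \<le> r / 2"
    using eventually_ge_at_top[of T0]
  proof eventually_elim
    case (elim t)
    define u where "u = cnj_vec (source v t)"
    have W: "weight t > 0" using elim T0(1) by (intro weight_pos) auto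
    have "q i (flow (- t) u) = q i (flow (- t) u - of_real (weight t) *s main_part t u)"
      using linear_diff[OF linear_q] by (simp add: q_scale q_main)
    then have "cmod (q i (flow (- t) u)) \<le> Q * norm (flow (- t) u - of_real (weight t) *s main_part t u)"
      using Q(2)[OF i(1)] by simp
    also have "\<dots> \<le> Q * (\<epsilon> * weight t * norm u)" using T0(2)[OF elim] Q(1) by (intro mult_left_mono) auto
    also have "\<dots> \<le> Q * (\<epsilon> * weight t * (\<bar>C\<bar> + 1))"
      using C[of t] Q(1) \<epsilon> W by (intro mult_left_mono) (auto simp: u_def)
    also have "\<dots> = r / 2 * weight t" using Q(1) by (simp add: \<epsilon>_def add_nonneg_eq_0_iff)
    finally show ?case using W by (simp add: f_def q_scale norm_mult norm_divide u_def field_simps)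
  qed
  then have "r \<le> r / 2"
    unfolding r_def by (intro tendsto_upperbound[OF tendsto_norm[OF lim1]]) auto
  then show False using r by simp
qed

lemma HC_add: "v \<in> HC \<Longrightarrow> w \<in> HC \<Longrightarrow> v + w \<in> HC"
  and HC_scale: "v \<in> HC \<Longrightarrow> a *s v \<in> HC"
  by (auto simp: HC_def q_add q_scale)

lemma Re_in_H:
  assumes v: "v \<in> HC"
  shows "Re_vec v \<in> H"
proof -
  have "complex_vec (Re_vec v) = (1 / 2) *s (v + cnj_vec v)"
    by (simp add: complex_vec_def Re_vec_def cnj_vec_def cart_eq_iff complex_eq_iff)
  then show ?thesis unfolding H_def using v by (simp only: mem_Collect_eq HC_scale HC_add HC_cnj)
qed

lemma Im_in_H:
  assumes v: "v \<in> HC"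
  shows "Im_vec v \<in> H"
proof -
  have "complex_vec (Im_vec v) = (- \<i> / 2) *s (v + (- 1) *s cnj_vec v)"
    by (simp add: complex_vec_def Im_vec_def cnj_vec_def cart_eq_iff complex_eq_iff)
  then show ?thesis unfolding H_def using v by (simp only: mem_Collect_eq HC_scale HC_add HC_cnj)
qed

text \<open>If all real vectors lie in the complex subspace \<open>HC\<close>, so do all complex
  ones. Then every Jordan basis vector is a block start of real part \<open>lam\<close>; such a
  \<open>j - k\<close> exists for the last vector \<open>p i\<close> of a block only if
  \<open>k = 0\<close>. This is how the hypothesis on the real part Jordan form excludes
  \<open>H = UNIV\<close>.\<close>

lemma H_UNIV_imp:
  assumes "H = UNIV" "i < n"
  shows "d i = 0" "Re (c i) = lam"
proof -
  have "complex_vec x \<in> HC" for x using assms(1) by (auto simp: H_def)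
  then have "v \<in> HC" for v by (subst complex_vec_decomp) (intro HC_add HC_scale)
  then have "p i \<in> HC" .
  then have "i \<in> (\<lambda>j. j - k) ` J" using assms(2) by (auto simp: HC_def dual)
  then obtain j where "j \<in> J" "i = j - k" by auto
  then show "d i = 0" "Re (c i) = lam" using J_shift[of j] by (auto simp: J_def)
qed

text \<open>Blocks with real part above \<open>lam\<close> may be longer than \<open>k + 1\<close>;
  the gap \<open>b\<close> between the real parts absorbs their extra powers of
  \<open>t\<close>.\<close>

lemma flow_decay:
  obtains C where "\<And>t x. t \<ge> 0 \<Longrightarrow> norm (flow (- t) x) \<le> C * (exp (- lam * t) * (1 + t) ^ k) * norm x"
proof -
  obtain Q where Q: "Q > 0" "\<And>j v. j < n \<Longrightarrow> cmod (q j v) \<le> Q * norm v" by (rule q_bound) metis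
  have "\<exists>C\<ge>0. \<forall>t\<ge>0. cmod (coef j l (- t)) \<le> C * (exp (- lam * t) * (1 + t) ^ k)"
    if j: "j < n" and l: "l \<le> d j" for j l
  proof (cases "Re (c j) = lam")
    case True
    have "cmod (coef j l (- t)) \<le> 1 * (exp (- lam * t) * (1 + t) ^ k)" if t: "t \<ge> 0" for t
    proof -
      have "t ^ l / fact l \<le> t ^ l / 1" using t by (intro divide_left_mono) auto
      also have "t ^ l / 1 \<le> (1 + t) ^ l" using t by (simp add: power_mono)
      also have "\<dots> \<le> (1 + t) ^ k" using t l k_max[OF j True] by (intro power_increasing) auto
      finally have "exp (- lam * t) * (t ^ l / fact l) \<le> exp (- lam * t) * (1 + t) ^ k"
        by (intro mult_left_mono) auto
      moreover have "cmod (coef j l (- t)) = exp (- lam * t) * (t ^ l / fact l)"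
        using t by (simp add: cmod_coef True)
      ultimately show ?thesis by linarith
    qed
    then show ?thesis by (intro exI[of _ 1]) auto
  next
    case False
    define b where "b = Re (c j) - lam"
    have b: "b > 0" using lam_le[OF j] False by (simp add: b_def)
    obtain C where C: "C \<ge> 1" "\<And>t. t \<ge> 0 \<Longrightarrow> (1 + t) ^ l * exp (- b * t) \<le> C"
      by (rule exp_power_bounded[OF b, of l]) (rule that)
    have "cmod (coef j l (- t)) \<le> C * (exp (- lam * t) * (1 + t) ^ k)" if t: "t \<ge> 0" for t
    proof -
      have "t ^ l / fact l \<le> t ^ l / 1" using t by (intro divide_left_mono) auto
      also have "t ^ l / 1 \<le> (1 + t) ^ l" using t by (simp add: power_mono)
      finally have "exp (- Re (c j) * t) * (t ^ l / fact l) \<le> exp (- Re (c j) * t) * (1 + t) ^ l"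
        by (intro mult_left_mono) auto
      moreover have "cmod (coef j l (- t)) = exp (- Re (c j) * t) * (t ^ l / fact l)"
        using t by (simp add: cmod_coef)
      ultimately have "cmod (coef j l (- t)) \<le> exp (- Re (c j) * t) * (1 + t) ^ l" by linarith
      also have "\<dots> = exp (- lam * t) * ((1 + t) ^ l * exp (- b * t))" by (simp add: b_def algebra_simps flip: exp_add)
      also have "\<dots> \<le> exp (- lam * t) * (C * (1 + t) ^ k)"
      proof (intro mult_left_mono)
        have "C * 1 \<le> C * (1 + t) ^ k" using t C(1) by (intro mult_left_mono one_le_power) auto
        then show "(1 + t) ^ l * exp (- b * t) \<le> C * (1 + t) ^ k" using C(2)[OF t] by linarith
      qed auto
      finally show ?thesis by (simp add: mult_ac)
    qed
    then show ?thesis using C(1) by (intro exI[of _ C]) auto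
  qed
  then obtain C where C: "\<And>j l. j < n \<Longrightarrow> l \<le> d j \<Longrightarrow> C j l \<ge> 0"
    "\<And>j l t. j < n \<Longrightarrow> l \<le> d j \<Longrightarrow> t \<ge> 0 \<Longrightarrow> cmod (coef j l (- t)) \<le> C j l * (exp (- lam * t) * (1 + t) ^ k)"
    by metis
  have "norm (flow (- t) x) \<le> Q * (\<Sum>j<n. \<Sum>l\<le>d j. C j l * norm (p (j - l))) * (exp (- lam * t) * (1 + t) ^ k) * norm x"
    if t: "t \<ge> 0" for t x
  proof -
    define w where "w = exp (- lam * t) * (1 + t) ^ k"
    have w: "w \<ge> 0" using t by (simp add: w_def)
    have "norm (flow (- t) x) \<le> (\<Sum>j<n. (Q * norm x) * (\<Sum>l\<le>d j. C j l * w * norm (p (j - l))))"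
      unfolding flow_def
    proof (intro sum_norm_le)
      fix j assume "j \<in> {..<n}"
      then have j: "j < n" by simp
      have "norm (flow_basis j (- t)) \<le> (\<Sum>l\<le>d j. C j l * w * norm (p (j - l)))"
        using C(2)[OF j _ t] unfolding w_def
        by (intro order_trans[OF norm_flow_basis] sum_mono mult_right_mono) auto
      then show "norm (q j x *s flow_basis j (- t)) \<le> (Q * norm x) * (\<Sum>l\<le>d j. C j l * w * norm (p (j - l)))"
        using Q(2)[OF j, of x] Q(1) unfolding norm_vector_scalar_mult by (intro mult_mono) auto
    qed
    also have "\<dots> = Q * (\<Sum>j<n. \<Sum>l\<le>d j. C j l * norm (p (j - l))) * w * norm x"
      by (simp add: sum_distrib_left sum_distrib_right mult_ac)
    finally show ?thesis by (simp add: w_def)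
  qed
  then show ?thesis by (rule that)
qed

text \<open>On \<open>HC\<close> the flow is diagonal in the chosen basis, with entries of modulus
  \<open>exp (lam * t)\<close>, so the estimate holds for negative times too.\<close>

lemma H_flow_bound: "\<exists>C. \<forall>h\<in>H. \<forall>t. norm (E t h) \<le> C * exp (lam * t) * norm h"
proof -
  obtain Q where Q: "Q > 0" "\<And>j v. j < n \<Longrightarrow> cmod (q j v) \<le> Q * norm v" by (rule q_bound) metis
  have "norm (E t h) \<le> (Q * (\<Sum>j\<in>J. norm (p (j - k)))) * exp (lam * t) * norm h" if h: "h \<in> H" for h t
  proof -
    have "norm (E t h) = norm (flow t (complex_vec h))" by (simp flip: complex_vec_E)
    also have "\<dots> \<le> (\<Sum>j\<in>J. (Q * norm h) * exp (lam * t) * norm (p (j - k)))"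
    proof (subst flow_HC)
      show "complex_vec h \<in> HC" using h by (simp add: H_def)
      show "norm (\<Sum>j\<in>J. (q (j - k) (complex_vec h) * exp (c j * of_real t)) *s p (j - k))
          \<le> (\<Sum>j\<in>J. (Q * norm h) * exp (lam * t) * norm (p (j - k)))"
      proof (intro sum_norm_le)
        fix j assume j: "j \<in> J"
        then have e: "cmod (exp (c j * of_real t)) = exp (lam * t)" by (simp add: J_def)
        show "norm ((q (j - k) (complex_vec h) * exp (c j * of_real t)) *s p (j - k))
            \<le> (Q * norm h) * exp (lam * t) * norm (p (j - k))"
          unfolding norm_vector_scalar_mult norm_mult e
          using Q(2)[of "j - k" "complex_vec h"] J_shift[OF j] by (intro mult_right_mono) auto
      qed
    qed
    finally show ?thesis by (simp add: sum_distrib_left sum_distrib_right mult_ac)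
  qed
  then show ?thesis by blast
qed

lemma H_flow_invariant: "h \<in> H \<Longrightarrow> E t h \<in> H"
proof -
  assume "h \<in> H"
  then have h: "complex_vec h \<in> HC" by (simp add: H_def)
  have sum_in: "sum f S \<in> HC" if "\<And>j. j \<in> S \<Longrightarrow> f j \<in> HC" for f and S :: "nat set"
    using that
  proof (induction S rule: infinite_finite_induct)
    case (insert x F) then show ?case by (simp add: HC_add)
  qed (auto simp: HC_def)
  have "complex_vec (E t h) \<in> HC"
    unfolding complex_vec_E flow_HC[OF h] by (intro sum_in HC_scale p_shift_in_HC)
  then show ?thesis by (simp add: H_def)
qed

lemma H_limit:
  assumes "e \<in> H"
  shows "\<exists>w C. (\<forall>T. norm (w T) \<le> C) \<and>
    (\<lambda>T::nat. E (- real T) (w T) /\<^sub>R (exp (- lam * real T) * real T ^ k)) \<longlonglongrightarrow> e"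
proof -
  have e: "complex_vec e \<in> HC" using assms by (simp add: H_def)
  obtain C where C: "\<And>t. norm (source (complex_vec e) t) \<le> C" by (rule source_bounded[of "complex_vec e"]) metis
  define w where "w = (\<lambda>T::nat. Re_vec (source (complex_vec e) (real T)))"
  have "norm (w T) \<le> C" for T unfolding w_def by (rule order_trans[OF norm_Re_vec C])
  moreover have "(\<lambda>T::nat. E (- real T) (w T) /\<^sub>R weight (real T)) \<longlonglongrightarrow> e"
  proof -
    have "(\<lambda>T::nat. (1 / of_real (weight T)) *s flow (- real T) (source (complex_vec e) (real T))) \<longlonglongrightarrow> complex_vec e"
      by (rule filterlim_compose[OF flow_source_tendsto[OF e] filterlim_real_sequentially])
    then have "(\<lambda>T::nat. Re_vec ((1 / of_real (weight T)) *s flow (- real T) (source (complex_vec e) (real T)))) \<longlonglongrightarrow> Re_vec (complex_vec e)"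
      unfolding Re_vec_def by (intro tendsto_vec_lambda tendsto_Re tendsto_vec_nth)
    moreover have "Re_vec ((1 / of_real r) *s v) = Re_vec v /\<^sub>R r" for r and v :: "complex^'n"
      by (simp add: Re_vec_def cart_eq_iff divide_inverse flip: of_real_inverse)
    ultimately show ?thesis by (simp add: Re_flow w_def)
  qed
  ultimately show ?thesis unfolding weight_def by blast
qed

text \<open>The real part of the leading term lies in \<open>H\<close> and is annihilated by
  \<open>a\<close>; what remains is the error of \<open>flow_main_part\<close>, which is small
  compared with \<open>weight t\<close>.\<close>

lemma H_orthogonal_decay:
  assumes a: "\<forall>h\<in>H. a \<bullet> h = 0" and "\<epsilon> > 0"
  shows "\<exists>T0. \<forall>t\<ge>T0. \<forall>x. \<bar>a \<bullet> E (- t) x\<bar> \<le> \<epsilon> * (exp (- lam * t) * t ^ k) * norm x"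
proof -
  define \<epsilon>' where "\<epsilon>' = \<epsilon> / (norm a + 1)"
  have \<epsilon>': "\<epsilon>' > 0" using assms(2) by (simp add: \<epsilon>'_def add_nonneg_pos)
  obtain T0 where T0: "T0 > 0"
    "\<And>t v. t \<ge> T0 \<Longrightarrow> norm (flow (- t) v - of_real (weight t) *s main_part t v) \<le> \<epsilon>' * weight t * norm v"
    by (rule flow_main_part[OF \<epsilon>']) (rule that)
  have sum_in: "sum f S \<in> HC" if "\<And>j. j \<in> S \<Longrightarrow> f j \<in> HC" for f and S :: "nat set"
    using that
  proof (induction S rule: infinite_finite_induct)
    case (insert x F) then show ?case by (simp add: HC_add)
  qed (auto simp: HC_def)
  have "\<bar>a \<bullet> E (- t) x\<bar> \<le> \<epsilon> * weight t * norm x" if t: "t \<ge> T0" for t x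
  proof -
    define v where "v = of_real (weight t) *s main_part t (complex_vec x)"
    have "v \<in> HC" unfolding v_def main_part_def by (intro HC_scale sum_in p_shift_in_HC)
    then have "a \<bullet> Re_vec v = 0" using a Re_in_H by blast
    moreover have "Re_vec (u - w) = Re_vec u - Re_vec w" for u w :: "complex^'n"
      by (simp add: Re_vec_def cart_eq_iff)
    then have "E (- t) x - Re_vec v = Re_vec (flow (- t) (complex_vec x) - v)"
      by (simp add: Re_flow)
    ultimately have "\<bar>a \<bullet> E (- t) x\<bar> = \<bar>a \<bullet> Re_vec (flow (- t) (complex_vec x) - v)\<bar>"
      by (metis diff_zero inner_diff_right)
    also have "\<dots> \<le> norm a * norm (Re_vec (flow (- t) (complex_vec x) - v))" by (rule Cauchy_Schwarz_ineq2)
    also have "\<dots> \<le> norm a * (\<epsilon>' * weight t * norm x)"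
      using T0(2)[OF t, of "complex_vec x"] norm_Re_vec[of "flow (- t) (complex_vec x) - v"]
      by (intro mult_left_mono) (auto simp: v_def)
    also have "\<dots> = (norm a * \<epsilon>') * (weight t * norm x)" by simp
    also have "\<dots> \<le> \<epsilon> * (weight t * norm x)"
    proof (intro mult_right_mono)
      have "norm a / (norm a + 1) \<le> 1" by (simp add: divide_le_eq_1 add_nonneg_pos)
      then have "\<epsilon> * (norm a / (norm a + 1)) \<le> \<epsilon> * 1" using assms(2) by (intro mult_left_mono) auto
      then show "norm a * \<epsilon>' \<le> \<epsilon>" by (simp add: \<epsilon>'_def mult.commute)
      show "0 \<le> weight t * norm x" using weight_pos[of t] t T0(1) by simp
    qed
    finally show ?thesis by (simp add: mult_ac)
  qed
  then show ?thesis unfolding weight_def by blast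
qed

lemma H_subspace: "Real_Vector_Spaces.subspace H"
proof (rule subspaceI)
  show "0 \<in> H" by (simp add: H_def HC_def)
  show "x + y \<in> H" if "x \<in> H" "y \<in> H" for x y using that by (simp add: H_def complex_vec_add HC_add)
  show "r *\<^sub>R x \<in> H" if "x \<in> H" for r x using that by (simp add: H_def complex_vec_scaleR HC_scale)
qed

lemma H_not_zero: "H \<noteq> {0}"
proof
  assume H: "H = {0}"
  obtain j where j: "j \<in> J" using k_attained by (auto simp: J_def)
  have "p (j - k) = 0"
    using complex_vec_decomp[of "p (j - k)"] Re_in_H[OF p_shift_in_HC[OF j]] Im_in_H[OF p_shift_in_HC[OF j]] H
    by simp
  moreover have "q (j - k) (p (j - k)) = 1" using J_shift[OF j] by (simp add: dual)
  ultimately show False by simp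
qed

lemma expanding_flow_matrix_exp:
  assumes N: "\<exists>c>0. \<forall>x. c * norm x \<le> N x" "\<exists>C. \<forall>x. N x \<le> C * norm x"
    "continuous_on UNIV N" "\<And>x. N (- x) = N x"
  shows "expanding_flow E N lam k H"
proof (rule expanding_flow.intro)
  show "Real_Vector_Spaces.linear (E t)" for t
    unfolding E_def by (rule matrix_vector_mul_linear)
  show "E (s + t) x = E s (E t x)" for s t x
    by (simp flip: complex_vec_eq_iff add: complex_vec_E flow_group)
  show "E 0 x = x" for x
    by (simp flip: complex_vec_eq_iff add: complex_vec_E flow_0)
  show "continuous_on UNIV (\<lambda>t. E t x)" for x
  proof -
    have "(\<lambda>t. E t x) = (\<lambda>t. Re_vec (flow t (complex_vec x)))" by (simp add: Re_flow)
    moreover have "continuous_on UNIV (\<lambda>t. Re_vec (flow t (complex_vec x)))"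
      unfolding Re_vec_def using cont_flow by (intro continuous_intros) auto
    ultimately show ?thesis by metis
  qed
  obtain C where "\<And>t x. t \<ge> 0 \<Longrightarrow> norm (flow (- t) x) \<le> C * (exp (- lam * t) * (1 + t) ^ k) * norm x"
    by (rule flow_decay) (rule that)
  then have "norm (E (- t) x) \<le> C * (exp (- lam * t) * (1 + t) ^ k) * norm x" if "t \<ge> 0" for t x
    using that by (metis norm_complex_vec complex_vec_E)
  then show "\<exists>C. \<forall>t\<ge>0. \<forall>x. norm (E (- t) x) \<le> C * (exp (- lam * t) * (1 + t) ^ k) * norm x" by blast
qed (use N lam_pos H_subspace H_flow_bound H_flow_invariant H_limit H_orthogonal_decay H_not_zero in \<open>simp_all\<close>)

end

section \<open>Jordan matrices by entries and the existence of a Jordan basis\<close>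

text \<open>Lists, for each index of a Jordan matrix, its position in its block and its eigenvalue.\<close>

definition block_positions :: "(nat \<times> 'a) list \<Rightarrow> (nat \<times> 'a) list" where
  "block_positions n_as = concat (map (\<lambda>(k, a). map (\<lambda>d. (d, a)) [0..<k]) n_as)"

lemma block_positions_Nil [simp]: "block_positions [] = []"
  by (simp add: block_positions_def)

lemma block_positions_Cons:
  "block_positions ((k, a) # n_as) = map (\<lambda>d. (d, a)) [0..<k] @ block_positions n_as"
  by (simp add: block_positions_def)

lemma length_block_positions: "length (block_positions n_as) = sum_list (map fst n_as)"
  by (induction n_as) (auto simp: block_positions_Cons)

lemma set_block_positions: "set (block_positions n_as) = {(d, a). \<exists>k. (k, a) \<in> set n_as \<and> d < k}"
  by (auto simp: block_positions_def)

lemma fst_block_positions_0: "block_positions n_as \<noteq> [] \<Longrightarrow> fst (block_positions n_as ! 0) = 0"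
proof (induction n_as)
  case (Cons na n_as)
  obtain k a where na: "na = (k, a)" by force
  show ?case
    using Cons by (cases k) (auto simp: na block_positions_Cons nth_append)
qed simp

text \<open>The blocks are split off one at a time. The superdiagonal entry between two blocks
  vanishes, which is encoded by the position 0 of the first index of a block.\<close>

lemma jordan_matrix_index:
  fixes n_as :: "(nat \<times> 'a :: {zero, one}) list"
  assumes "i < length (block_positions n_as)" "j < length (block_positions n_as)"
  shows "jordan_matrix n_as $$ (i, j) = (if i = j then snd (block_positions n_as ! j)
    else if Suc i = j \<and> fst (block_positions n_as ! j) \<noteq> 0 then 1 else 0)"
  using assms
proof (induction n_as arbitrary: i j)
  case (Cons na n_as)
  obtain k a where na: "na = (k, a)" by force
  have len: "length (block_positions (na # n_as)) = k + sum_list (map fst n_as)"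
    by (simp add: length_block_positions na)
  have ij: "i < k + sum_list (map fst n_as)" "j < k + sum_list (map fst n_as)"
    using Cons.prems unfolding len by auto
  have J: "jordan_matrix (na # n_as) $$ (i, j) =
    (if i < k then if j < k then jordan_block k a $$ (i, j) else 0
     else if j < k then 0 else jordan_matrix n_as $$ (i - k, j - k))"
    using ij unfolding na jordan_matrix_Cons by (subst index_mat_four_block(1)) auto
  have nth: "block_positions (na # n_as) ! j = (if j < k then (j, a) else block_positions n_as ! (j - k))"
    by (simp add: na block_positions_Cons nth_append)
  show ?case
  proof (cases "j < k")
    case True
    then show ?thesis unfolding J nth by auto
  next
    case False
    show ?thesis
    proof (cases "i < k")
      case True
      have "fst (block_positions n_as ! (j - k)) = 0" if "Suc i = j"
      proof -
        have "j - k = 0" using that True by simp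
        moreover have "block_positions n_as \<noteq> []"
          using ij(2) False length_block_positions[of n_as] by (metis add_0_right list.size(3))
        ultimately show ?thesis using fst_block_positions_0 by metis
      qed
      then show ?thesis unfolding J nth using True False by auto
    next
      case i: False
      have "jordan_matrix n_as $$ (i - k, j - k) = (if i - k = j - k then snd (block_positions n_as ! (j - k))
        else if Suc (i - k) = j - k \<and> fst (block_positions n_as ! (j - k)) \<noteq> 0 then 1 else 0)"
        using ij False i by (intro Cons.IH) (auto simp: length_block_positions)
      moreover have "(i - k = j - k) = (i = j)" "(Suc (i - k) = j - k) = (Suc i = j)" using False i by auto
      ultimately show ?thesis unfolding J nth using i False by simp
    qed
  qed
qed simp

lemma block_positions_minus:
  assumes "j < length (block_positions n_as)" "l \<le> fst (block_positions n_as ! j)"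
  shows "l \<le> j \<and> block_positions n_as ! (j - l) = (fst (block_positions n_as ! j) - l, snd (block_positions n_as ! j))"
  using assms
proof (induction n_as arbitrary: j)
  case (Cons na n_as)
  obtain k a where na: "na = (k, a)" by force
  have nth: "block_positions (na # n_as) ! m = (if m < k then (m, a) else block_positions n_as ! (m - k))" for m
    by (simp add: na block_positions_Cons nth_append)
  show ?case
  proof (cases "j < k")
    case True
    then show ?thesis using Cons.prems(2) by (auto simp: nth)
  next
    case False
    have "j - k < length (block_positions n_as)"
      using Cons.prems(1) False by (simp add: na block_positions_Cons)
    moreover have "l \<le> fst (block_positions n_as ! (j - k))" using Cons.prems(2) False by (simp add: nth)
    ultimately have IH: "l \<le> j - k" "block_positions n_as ! (j - k - l)
        = (fst (block_positions n_as ! (j - k)) - l, snd (block_positions n_as ! (j - k)))"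
      using Cons.IH by blast+
    then have "\<not> j - l < k" "j - l - k = j - k - l" "l \<le> j" using False by auto
    then show ?thesis using IH False by (simp add: nth)
  qed
qed simp

lemma jordan_nf_sizes:
  fixes A :: "real^'n^'n"
  assumes "jordan_nf (complex_mat A) n_as"
  shows "length (block_positions n_as) = CARD('n)" "\<And>k a. (k, a) \<in> set n_as \<Longrightarrow> k > 0"
proof -
  obtain m P Q where "{complex_mat A, jordan_matrix n_as, P, Q} \<subseteq> carrier_mat m m"
    using assms unfolding jordan_nf_def by (auto dest: similar_matD)
  then have "dim_row (complex_mat A) = dim_row (jordan_matrix n_as)" by auto
  then show "length (block_positions n_as) = CARD('n)" by (simp add: complex_mat_def length_block_positions)
  show "k > 0" if "(k, a) \<in> set n_as" for k a
    using assms that unfolding jordan_nf_def by (metis gr0I image_eqI fst_conv)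
qed

lemma spectrum_jordan_nf:
  fixes A :: "real^'n^'n"
  assumes "jordan_nf (complex_mat A) n_as"
  shows "spectrum (complex_mat A) = snd ` set (block_positions n_as)"
proof -
  have "complex_mat A \<in> carrier_mat CARD('n) CARD('n)" by (simp add: complex_mat_def)
  then have "spectrum (complex_mat A) = {x. poly (char_poly (complex_mat A)) x = 0}"
    by (rule spectrum_root_char_poly)
  also have "char_poly (complex_mat A) = (\<Prod>(k, a)\<leftarrow>n_as. [:- a, 1:] ^ k)"
    by (rule jordan_nf_char_poly[OF assms])
  also have "{x. poly (\<Prod>(k, a)\<leftarrow>n_as. [:- a, 1:] ^ k) x = 0} = snd ` set n_as"
  proof -
    have "poly (\<Prod>(k, a)\<leftarrow>ms. [:- a, 1:] ^ k) x = 0 \<longleftrightarrow> (\<exists>(k, a)\<in>set ms. k > 0 \<and> x = a)"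
      for ms :: "(nat \<times> complex) list" and x
      by (induction ms) (auto simp: poly_power)
    then show ?thesis using jordan_nf_sizes(2)[OF assms] by force
  qed
  also have "\<dots> = snd ` set (block_positions n_as)"
    using jordan_nf_sizes(2)[OF assms] by (force simp: set_block_positions)
  finally show ?thesis .
qed

lemma jordan_nf_exists_complex:
  fixes A :: "real^'n^'n"
  obtains n_as where "jordan_nf (complex_mat A) n_as"
proof -
  have A: "complex_mat A \<in> carrier_mat CARD('n) CARD('n)" by (simp add: complex_mat_def)
  obtain as where "char_poly (complex_mat A) = (\<Prod>a\<leftarrow>as. [:- a, 1:])"
    using char_poly_factorized[OF A] by blast
  from jordan_nf_exists[OF A this] show ?thesis using that by blast
qed

lemma index_mult_mat_sum:
  assumes "X \<in> carrier_mat n n" "Y \<in> carrier_mat n n" "i < n" "j < n"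
  shows "(X * Y) $$ (i, j) = (\<Sum>m<n. X $$ (i, m) * Y $$ (m, j))"
  using assms by (simp add: scalar_prod_def atLeast0LessThan)

text \<open>The columns of \<open>P\<close> are the Jordan basis and the rows of \<open>Q\<close>
  its dual basis; \<open>complex_mat A * P = P * J\<close> read by columns is the chain relation.
  \<open>idx\<close> and \<open>pos\<close> translate between the indices of both kinds of
  matrices.\<close>

lemma jordan_basis_exists:
  fixes A :: "real^'n^'n"
  assumes jnf: "jordan_nf (complex_mat A) n_as"
  defines "n \<equiv> CARD('n)" and "c \<equiv> \<lambda>j. snd (block_positions n_as ! j)" and "d \<equiv> \<lambda>j. fst (block_positions n_as ! j)"
  obtains p :: "nat \<Rightarrow> complex^'n" and q where "jordan_basis n c d p q"
    "\<And>j. j < n \<Longrightarrow> complex_matrix A *v p j = c j *s p j + (if d j = 0 then 0 else p (j - 1))"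
proof -
  define J where "J = jordan_matrix n_as"
  have len: "length (block_positions n_as) = n" unfolding n_def by (rule jordan_nf_sizes(1)[OF jnf])
  obtain P Q where PQ: "similar_mat_wit (complex_mat A) J P Q"
    using jnf unfolding jordan_nf_def similar_mat_def J_def by blast
  have Ac: "complex_mat A \<in> carrier_mat n n" by (simp add: complex_mat_def n_def)
  note wit = similar_mat_witD2[OF Ac PQ]
  have Jc: "J \<in> carrier_mat n n" and P: "P \<in> carrier_mat n n" and Q: "Q \<in> carrier_mat n n"
    and PQ1: "P * Q = 1\<^sub>m n" and QP1: "Q * P = 1\<^sub>m n" using wit by auto
  have AP: "complex_mat A * P = P * J"
  proof -
    have "complex_mat A * P = P * J * Q * P" using wit(3) by simp
    also have "\<dots> = P * J * (Q * P)" using P Jc Q by (simp add: assoc_mult_mat[of _ n n _ n _ n])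
    finally show ?thesis using P Jc by (simp add: QP1)
  qed
  define idx where "idx = from_nat_into (UNIV :: 'n set)"
  define pos where "pos = inv_into {..<n} idx"
  have bij: "bij_betw idx {..<n} UNIV"
    unfolding idx_def n_def by (rule bij_betw_from_nat_into_finite) simp
  have pos: "pos i < n" "idx (pos i) = i" for i
  proof -
    have "i \<in> idx ` {..<n}" using bij by (simp add: bij_betw_def)
    then show "pos i < n" "idx (pos i) = i"
      using inv_into_into[of i idx "{..<n}"] f_inv_into_f[of i idx "{..<n}"] by (auto simp: pos_def)
  qed
  have pos_idx: "pos (idx m) = m" if "m < n" for m
    unfolding pos_def using bij that by (intro inv_into_f_f) (auto simp: bij_betw_def)
  have sum_idx: "(\<Sum>b\<in>UNIV. f b) = (\<Sum>m<n. f (idx m))" for f :: "'n \<Rightarrow> complex"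
    using sum.reindex_bij_betw[OF bij, of f] by simp
  define p :: "nat \<Rightarrow> complex^'n" where "p = (\<lambda>j. \<chi> i. P $$ (pos i, j))"
  define q :: "nat \<Rightarrow> complex^'n \<Rightarrow> complex" where "q = (\<lambda>j v. \<Sum>m<n. Q $$ (j, m) * v $ idx m)"
  have "jordan_basis n c d p q"
  proof
    fix j l assume "j < n" "l \<le> d j"
    then show "l \<le> j \<and> d (j - l) = d j - l \<and> c (j - l) = c j"
      using block_positions_minus[of j n_as l] len by (simp add: c_def d_def)
  next
    show "q j (v + w) = q j v + q j w" for j v w
      by (simp add: q_def algebra_simps sum.distrib)
    show "q j (a *s v) = a * q j v" for j a v
      by (simp add: q_def sum_distrib_left algebra_simps)
    show "v = (\<Sum>j<n. q j v *s p j)" for v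
    proof (subst cart_eq_iff, intro allI)
      fix i
      have "(\<Sum>j<n. q j v *s p j) $ i = (\<Sum>j<n. (\<Sum>m<n. Q $$ (j, m) * v $ idx m) * P $$ (pos i, j))"
        by (simp add: p_def q_def)
      also have "\<dots> = (\<Sum>m<n. (\<Sum>j<n. P $$ (pos i, j) * Q $$ (j, m)) * v $ idx m)"
        by (simp add: sum_distrib_left sum_distrib_right mult_ac, subst sum.swap, simp)
      also have "\<dots> = (\<Sum>m<n. (if pos i = m then 1 else 0) * v $ idx m)"
        using pos(1)[of i] by (intro sum.cong refl)
          (simp add: index_mult_mat_sum[OF P Q, symmetric] PQ1)
      also have "\<dots> = (\<Sum>m<n. if m = pos i then v $ idx m else 0)" by (intro sum.cong refl) auto
      also have "\<dots> = v $ i" using pos[of i] by simp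
      finally show "v $ i = (\<Sum>j<n. q j v *s p j) $ i" by simp
    qed
    fix i j assume ij: "i < n" "j < n"
    have "q i (p j) = (\<Sum>m<n. Q $$ (i, m) * P $$ (m, j))"
      by (simp add: q_def p_def pos_idx)
    also have "\<dots> = (1\<^sub>m n) $$ (i, j)" using ij by (simp add: index_mult_mat_sum[OF Q P, symmetric] QP1)
    finally show "q i (p j) = (if i = j then 1 else 0)" using ij by simp
  qed
  moreover have "complex_matrix A *v p j = c j *s p j + (if d j = 0 then 0 else p (j - 1))" if j: "j < n" for j
  proof (subst cart_eq_iff, intro allI)
    fix i
    have "(complex_matrix A *v p j) $ i = (\<Sum>m<n. complex_of_real (A $ i $ idx m) * P $$ (m, j))"
      by (simp add: complex_matrix_def matrix_vector_mult_def p_def sum_idx pos_idx)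
    also have "\<dots> = (\<Sum>m<n. complex_mat A $$ (pos i, m) * P $$ (m, j))"
      using pos[of i] by (intro sum.cong refl) (simp add: complex_mat_def n_def idx_def)
    also have "\<dots> = (P * J) $$ (pos i, j)" using pos[of i] j by (simp add: index_mult_mat_sum[OF Ac P, symmetric] AP)
    also have "\<dots> = (\<Sum>m<n. P $$ (pos i, m) * J $$ (m, j))" using pos(1)[of i] j by (rule index_mult_mat_sum[OF P Jc])
    also have "\<dots> = (\<Sum>m<n. (if m = j then c j * P $$ (pos i, j) else 0)
        + (if Suc m = j \<and> d j \<noteq> 0 then P $$ (pos i, m) else 0))"
      using j by (intro sum.cong refl) (auto simp: J_def jordan_matrix_index len c_def d_def)
    also have "\<dots> = c j * P $$ (pos i, j) + (if d j = 0 then 0 else P $$ (pos i, j - 1))"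
    proof -
      have "(\<Sum>m<n. if Suc m = j \<and> d j \<noteq> 0 then P $$ (pos i, m) else 0) = (if d j = 0 then 0 else P $$ (pos i, j - 1))"
      proof (cases "d j = 0")
        case False
        then have "1 \<le> j" using block_positions_minus[of j n_as 1] len j by (simp add: d_def)
        then have "(\<Sum>m<n. if Suc m = j \<and> d j \<noteq> 0 then P $$ (pos i, m) else 0)
          = (\<Sum>m<n. if m = j - 1 then P $$ (pos i, m) else 0)"
          using False by (intro sum.cong refl) auto
        then show ?thesis using False j by simp
      qed simp
      then show ?thesis using j by (simp add: sum.distrib)
    qed
    finally show "(complex_matrix A *v p j) $ i = (c j *s p j + (if d j = 0 then 0 else p (j - 1))) $ i"
      by (simp add: p_def)
  qed
  ultimately show ?thesis by (rule that)
qed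

text \<open>\<open>n_as\<close> is the very list that the definition selects. All positions being 0
  means that all blocks have size 1, so after taking real parts the list is constant and sorting
  leaves it as it is.\<close>

lemma real_part_jordan_form_scalar:
  fixes A :: "real^'n^'n"
  defines "n_as \<equiv> SOME n_as. jordan_nf (complex_mat A) n_as"
  assumes "\<And>j. j < CARD('n) \<Longrightarrow> fst (block_positions n_as ! j) = 0 \<and> Re (snd (block_positions n_as ! j)) = r"
  shows "real_part_jordan_form A = r \<cdot>\<^sub>m 1\<^sub>m CARD('n)"
proof -
  have jnf: "jordan_nf (complex_mat A) n_as"
    unfolding n_as_def using jordan_nf_exists_complex[of A] by (metis someI_ex)
  have len: "length (block_positions n_as) = CARD('n)" by (rule jordan_nf_sizes(1)[OF jnf])
  have all: "d = 0 \<and> Re a = r" if "(d, a) \<in> set (block_positions n_as)" for d a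
    using that assms(2) len unfolding in_set_conv_nth by force
  define L where "L = sort_key snd (sort_key fst (map (\<lambda>(k, c). (k, Re c)) n_as))"
  have one: "k = 1 \<and> Re a = r" if "(k, a) \<in> set n_as" for k a
  proof -
    have "k > 0" using jordan_nf_sizes(2)[OF jnf that] .
    then have "(k - 1, a) \<in> set (block_positions n_as)" using that by (auto simp: set_block_positions)
    then show ?thesis using all \<open>k > 0\<close> by force
  qed
  have "sum_list (map fst ms) = length ms" if "\<forall>x\<in>set ms. fst x = 1" for ms :: "(nat \<times> complex) list"
    using that by (induction ms) auto
  then have "sum_list (map fst n_as) = length n_as" using one by fastforce
  then have lenL: "length L = CARD('n)" using len by (simp add: L_def length_block_positions)
  have L: "x = (1, r)" if "x \<in> set L" for x
    using that one by (auto simp: L_def)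
  have "L = replicate CARD('n) (1, r)"
    using L lenL by (intro replicate_eqI) auto
  moreover have "block_positions (replicate m (1, r)) = replicate m (0, r)" for m
    by (induction m) (simp_all add: block_positions_Cons)
  ultimately have bp: "block_positions L = replicate CARD('n) (0, r)" by simp
  have "jordan_matrix L = r \<cdot>\<^sub>m 1\<^sub>m CARD('n)"
  proof (rule eq_matI)
    have "sum_list (map fst L) = CARD('n)" using bp length_block_positions[of L] by simp
    then show dims: "dim_row (jordan_matrix L) = dim_row (r \<cdot>\<^sub>m 1\<^sub>m CARD('n))"
      "dim_col (jordan_matrix L) = dim_col (r \<cdot>\<^sub>m 1\<^sub>m CARD('n))" by auto
    fix i j assume "i < dim_row (r \<cdot>\<^sub>m 1\<^sub>m CARD('n))" "j < dim_col (r \<cdot>\<^sub>m 1\<^sub>m CARD('n))"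
    then show "jordan_matrix L $$ (i, j) = (r \<cdot>\<^sub>m 1\<^sub>m CARD('n)) $$ (i, j)"
      by (simp add: jordan_matrix_index bp)
  qed
  then show ?thesis by (simp add: real_part_jordan_form_def L_def n_as_def)
qed

lemma expanding_flow_of_matrix:
  fixes A :: "real^'n^'n" and N :: "real^'n \<Rightarrow> real"
  assumes pos: "\<And>c. eigenvalue (complex_mat A) c \<Longrightarrow> Re c > 0"
    and N: "\<exists>c>0. \<forall>x. c * norm x \<le> N x" "\<exists>C. \<forall>x. N x \<le> C * norm x"
    "continuous_on UNIV N" "\<And>x. N (- x) = N x"
  obtains k H where "expanding_flow (\<lambda>t x. matrix_exp (t *\<^sub>R A) *v x) N (min_eigenvalue_Re A) k H"
    "H = UNIV \<Longrightarrow> real_part_jordan_form A = min_eigenvalue_Re A \<cdot>\<^sub>m 1\<^sub>m CARD('n)"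
proof -
  define n_as where "n_as = (SOME n_as. jordan_nf (complex_mat A) n_as)"
  have jnf: "jordan_nf (complex_mat A) n_as"
    unfolding n_as_def using jordan_nf_exists_complex[of A] by (metis someI_ex)
  define n where "n = CARD('n)"
  define c where "c = (\<lambda>j. snd (block_positions n_as ! j))"
  define d where "d = (\<lambda>j. fst (block_positions n_as ! j))"
  define lam where "lam = min_eigenvalue_Re A"
  obtain p :: "nat \<Rightarrow> complex^'n" and q where pq: "jordan_basis n c d p q"
    "\<And>j. j < n \<Longrightarrow> complex_matrix A *v p j = c j *s p j + (if d j = 0 then 0 else p (j - 1))"
    unfolding n_def c_def d_def by (rule jordan_basis_exists[OF jnf]) blast
  have len: "length (block_positions n_as) = n" unfolding n_def by (rule jordan_nf_sizes(1)[OF jnf])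
  have spec: "spectrum (complex_mat A) = c ` {..<n}"
    unfolding spectrum_jordan_nf[OF jnf] set_conv_nth len c_def by auto
  have "n > 0" by (simp add: n_def)
  then have ne: "{..<n} \<noteq> {}" by blast
  have lam_eq: "lam = Min ((\<lambda>j. Re (c j)) ` {..<n})"
    by (simp add: lam_def min_eigenvalue_Re_def spec image_image)
  have lam_le: "lam \<le> Re (c j)" if "j < n" for j
    unfolding lam_eq using that by (intro Min_le) auto
  have "lam \<in> (\<lambda>j. Re (c j)) ` {..<n}" unfolding lam_eq using ne by (intro Min_in) auto
  then obtain j0 where j0: "j0 < n" "Re (c j0) = lam" by auto
  have "c j0 \<in> spectrum (complex_mat A)" using j0(1) spec by auto
  then have lam_pos: "lam > 0" using pos[of "c j0"] j0(2) by (simp add: spectrum_def)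
  define D where "D = d ` {j. j < n \<and> Re (c j) = lam}"
  define k where "k = Max D"
  have D: "finite D" "D \<noteq> {}" using j0 by (auto simp: D_def)
  have "k \<in> D" unfolding k_def using D by (rule Max_in)
  then have k1: "\<exists>j<n. Re (c j) = lam \<and> d j = k" by (auto simp: D_def)
  have k2: "d j \<le> k" if "j < n" "Re (c j) = lam" for j
    unfolding k_def using D(1) that by (intro Max_ge) (auto simp: D_def)
  interpret jordan_basis n c d p q by (rule pq(1))
  interpret real_jordan_basis n c d p q A lam k
    by unfold_locales (use pq(2) lam_pos lam_le k1 k2 in auto)
  have "expanding_flow (\<lambda>t x. matrix_exp (t *\<^sub>R A) *v x) N lam k H"
    using expanding_flow_matrix_exp[OF N] unfolding E_def[abs_def] .
  moreover have "real_part_jordan_form A = lam \<cdot>\<^sub>m 1\<^sub>m CARD('n)" if "H = UNIV"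
  proof (rule real_part_jordan_form_scalar)
    fix j assume "j < CARD('n)"
    then have "d j = 0 \<and> Re (c j) = lam" using H_UNIV_imp[OF that, of j] by (simp add: n_def)
    then show "fst (block_positions (SOME n_as. jordan_nf (complex_mat A) n_as) ! j) = 0 \<and>
        Re (snd (block_positions (SOME n_as. jordan_nf (complex_mat A) n_as) ! j)) = lam"
      by (simp add: d_def c_def n_as_def)
  qed
  ultimately show ?thesis unfolding lam_def by (rule that)
qed

section \<open>Quasisymmetric maps\<close>

text \<open>A positive, continuous and homogeneous function is compared with the norm through its
  extrema on the compact unit sphere.\<close>

lemma metric_norm_equivalent:
  fixes A :: "real^'n^'n"
  assumes "admissible_metric A g"
  shows "\<exists>c>0. \<forall>x. c * norm x \<le> metric_norm g x" "\<exists>C. \<forall>x. metric_norm g x \<le> C * norm x"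
    "continuous_on UNIV (metric_norm g)" "metric_norm g (- x) = metric_norm g x"
proof -
  define b where "b = g (0, 0)"
  have "is_inner_product b"
    using assms by (simp add: admissible_metric_def left_invariant_metric_def b_def)
  then have b: "bilinear b" "\<And>v. v \<noteq> 0 \<Longrightarrow> b v v > 0" by (auto simp: is_inner_product_def)
  have N: "metric_norm g = (\<lambda>x. sqrt (b (x, 0) (x, 0)))" by (simp add: metric_norm_def b_def fun_eq_iff)
  have scale: "metric_norm g (r *\<^sub>R x) = \<bar>r\<bar> * metric_norm g x" for r x
  proof -
    have pair: "(r *\<^sub>R x, 0 :: real) = r *\<^sub>R (x, 0)" by simp
    have "b (r *\<^sub>R x, 0) (r *\<^sub>R x, 0) = r\<^sup>2 * b (x, 0) (x, 0)"
      unfolding pair bilinear_lmul[OF b(1)] bilinear_rmul[OF b(1)] by (simp add: power2_eq_square)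
    then show ?thesis by (simp add: N real_sqrt_mult)
  qed
  show "metric_norm g (- x) = metric_norm g x" using scale[of "- 1" x] by simp
  have "bounded_bilinear b" using b(1) by (simp add: bilinear_conv_bounded_bilinear)
  then have "continuous_on UNIV (\<lambda>x. b (x, 0) (x, 0))"
    by (intro bounded_bilinear.continuous_on[of b] continuous_intros) auto
  then show cont: "continuous_on UNIV (metric_norm g)" unfolding N by (intro continuous_intros)
  have pos: "metric_norm g x > 0" if "x \<noteq> 0" for x
    using b(2)[of "(x, 0)"] that by (simp add: N zero_prod_def)
  define S where "S = sphere (0 :: real^'n) 1"
  have S: "compact S" "S \<noteq> {}" by (auto simp: S_def)
  have contS: "continuous_on S (metric_norm g)" using cont continuous_on_subset by blast
  obtain u where u: "u \<in> S" "\<And>y. y \<in> S \<Longrightarrow> metric_norm g u \<le> metric_norm g y"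
    using continuous_attains_inf[OF S contS] by blast
  obtain v where v: "v \<in> S" "\<And>y. y \<in> S \<Longrightarrow> metric_norm g y \<le> metric_norm g v"
    using continuous_attains_sup[OF S contS] by blast
  have norm_eq: "metric_norm g x = norm x * metric_norm g (x /\<^sub>R norm x)" if "x \<noteq> 0" for x
    using that by (simp add: scale)
  have in_S: "x /\<^sub>R norm x \<in> S" if "x \<noteq> 0" for x using that by (simp add: S_def)
  have zero: "metric_norm g 0 = 0" using scale[of 0 0] by simp
  have "metric_norm g u * norm x \<le> metric_norm g x" for x
  proof (cases "x = 0")
    case False
    then show ?thesis unfolding norm_eq[OF False] mult.commute[of "metric_norm g u"]
      by (intro mult_left_mono u(2) in_S) auto
  qed (simp add: zero)
  moreover have "metric_norm g u > 0" using u(1) by (intro pos) (auto simp: S_def)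
  ultimately show "\<exists>c>0. \<forall>x. c * norm x \<le> metric_norm g x" by blast
  have "metric_norm g x \<le> metric_norm g v * norm x" for x
  proof (cases "x = 0")
    case False
    then show ?thesis unfolding norm_eq[OF False] mult.commute[of "metric_norm g v"]
      by (intro mult_left_mono v(2) in_S) auto
  qed (simp add: zero)
  then show "\<exists>C. \<forall>x. metric_norm g x \<le> C * norm x" by blast
qed

text \<open>A continuous injection on an interval has no interior extremum. A zero at an interior
  point would thus force a negative value on one side; once \<open>\<eta> 0 = 0\<close> is known,
  the same fact gives monotonicity.\<close>

lemma homeomorphism_half_line:
  fixes \<eta> :: "real \<Rightarrow> real"
  assumes "homeomorphism {0..} {0..} \<eta> \<theta>"
  shows "\<eta> 0 = 0" "\<lbrakk>0 \<le> x; x < y\<rbrakk> \<Longrightarrow> \<eta> x < \<eta> y"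
proof -
  have cont: "continuous_on {0..} \<eta>" and im: "\<eta> ` {0..} = {0..}" and inv: "\<And>x. x \<ge> 0 \<Longrightarrow> \<theta> (\<eta> x) = x"
    using assms by (auto simp: homeomorphism_def)
  have inj: "inj_on \<eta> {0..}" using inv by (auto intro: inj_on_inverseI)
  have nonneg: "\<eta> x \<ge> 0" if "x \<ge> 0" for x using im that by auto
  have between: "(\<eta> a < \<eta> x \<and> \<eta> x < \<eta> b) \<or> (\<eta> b < \<eta> x \<and> \<eta> x < \<eta> a)" if "0 \<le> a" "a < x" "x < b" for a x b
    using that continuous_on_subset[OF cont, of "{a..b}"] inj_on_subset[OF inj, of "{a..b}"]
    by (intro continuous_inj_imp_mono) auto
  obtain z where z: "z \<ge> 0" "\<eta> z = 0" using im by (metis atLeast_iff image_iff order_refl)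
  have "z = 0"
  proof (rule ccontr)
    assume "z \<noteq> 0"
    then have "\<eta> 0 < 0 \<or> \<eta> (z + 1) < 0" using between[of 0 z "z + 1"] z by auto
    then show False using nonneg[of 0] nonneg[of "z + 1"] z(1) by auto
  qed
  then show eta0: "\<eta> 0 = 0" using z(2) by simp
  show "\<eta> x < \<eta> y" if "0 \<le> x" "x < y"
  proof (cases "x = 0")
    case True
    have "\<eta> y \<noteq> \<eta> 0" using inv[of y] inv[of 0] that by auto
    then show ?thesis using nonneg[of y] that True eta0 by simp
  next
    case False
    then show ?thesis using between[of 0 x y] nonneg[of x] eta0 that by auto
  qed
qed

text \<open>In the control condition of \<open>controlled_map\<close> the points \<open>y\<close> and \<open>z\<close> may coincide, in contrast to the
  definition of a quasisymmetric map. Hence the gauge must be at least \<open>1\<close> from \<open>1\<close> on.\<close>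

definition gauge_of :: "(real \<Rightarrow> real) \<Rightarrow> real \<Rightarrow> real" where
  "gauge_of \<eta> s = (if s \<le> 0 then 0 else if s < 1 then \<eta> s else max 1 (\<eta> s))"

lemma gauge_of_tendsto:
  assumes "(\<eta> \<longlongrightarrow> 0) (at_right 0)"
  shows "(gauge_of \<eta> \<longlongrightarrow> 0) (at_right 0)"
proof (rule Lim_transform_eventually[OF assms])
  show "\<forall>\<^sub>F s in at_right 0. \<eta> s = gauge_of \<eta> s"
    unfolding eventually_at_right_field by (intro exI[of _ 1]) (auto simp: gauge_of_def)
qed

text \<open>\<open>1 / \<theta> (1 / r)\<close> is the usual gauge for the inverse of an
  \<open>\<eta>\<close>-quasisymmetric map, \<open>\<theta>\<close> being the inverse of
  \<open>\<eta>\<close>. Coincident points are treated apart, since the definition speaks of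
  distinct triples.\<close>

lemma quasisymmetric_controlled:
  assumes \<eta>: "homeomorphism {0..} {0..} \<eta> \<theta>" and qs: "quasisymmetric \<eta> \<rho> \<sigma> F"
    and \<rho>: "\<And>x y. \<rho> x y \<ge> 0" "\<And>x y. \<rho> x y = 0 \<longleftrightarrow> x = y"
    and \<sigma>: "\<And>x y. \<sigma> x y \<ge> 0" "\<And>x y. \<sigma> x y = 0 \<longleftrightarrow> x = y"
  shows "\<lbrakk>s > 0; \<rho> x y \<le> s * \<rho> x z\<rbrakk> \<Longrightarrow> \<sigma> (F x) (F y) \<le> gauge_of \<eta> s * \<sigma> (F x) (F z)" (is "PROP ?A")
    and "\<lbrakk>s > 0; \<sigma> (F x) (F y) \<le> s * \<sigma> (F x) (F z)\<rbrakk> \<Longrightarrow> \<rho> x y \<le> gauge_of (\<lambda>r. 1 / \<theta> (1 / r)) s * \<rho> x z" (is "PROP ?B")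
proof -
  note mono = homeomorphism_half_line(2)[OF \<eta>]
  have bij: "bij F" and ineq: "\<And>x y z. distinct [x, y, z] \<Longrightarrow> \<sigma> (F x) (F y) / \<sigma> (F x) (F z) \<le> \<eta> (\<rho> x y / \<rho> x z)"
    using qs by (auto simp: quasisymmetric_def)
  have F_eq: "F u = F w \<longleftrightarrow> u = w" for u w using bij by (simp add: bij_is_inj inj_eq)
  have \<rho>_pos: "\<rho> u w > 0 \<longleftrightarrow> u \<noteq> w" for u w using \<rho>(1)[of u w] \<rho>(2)[of u w] by auto
  have \<sigma>_pos: "\<sigma> u w > 0 \<longleftrightarrow> u \<noteq> w" for u w using \<sigma>(1)[of u w] \<sigma>(2)[of u w] by auto
  have \<eta>_nonneg: "\<eta> r \<ge> 0" if "r \<ge> 0" for r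
    using mono[of 0 r] homeomorphism_half_line(1)[OF \<eta>] that by (cases "r = 0") auto
  have \<theta>: "\<theta> r \<ge> 0" "\<eta> (\<theta> r) = r" if "r \<ge> 0" for r
    using \<eta> that by (auto simp: homeomorphism_def)
  show "PROP ?A"
  proof -
    assume s: "s > 0" and le: "\<rho> x y \<le> s * \<rho> x z"
    have g: "gauge_of \<eta> s \<ge> \<eta> s" "gauge_of \<eta> s \<ge> 0" using s \<eta>_nonneg[of s] by (auto simp: gauge_of_def)
    consider "x = y" | "x \<noteq> y" "y = z" | "x \<noteq> y" "y \<noteq> z" by blast
    then show ?thesis
    proof cases
      case 1
      then have "\<sigma> (F x) (F y) = 0" by (simp add: \<sigma>(2))
      then show ?thesis using g(2) \<sigma>(1) by simp
    next
      case 2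
      then have "s \<ge> 1" using le \<rho>_pos[of x y] by simp
      then have "gauge_of \<eta> s \<ge> 1" by (simp add: gauge_of_def)
      then show ?thesis using 2 mult_right_mono[of 1 "gauge_of \<eta> s" "\<sigma> (F x) (F y)"] \<sigma>(1) by simp
    next
      case 3
      have xz: "x \<noteq> z"
      proof
        assume "x = z"
        then have "\<rho> x z = 0" by (simp add: \<rho>(2))
        then show False using le \<rho>_pos[of x y] 3 by simp
      qed
      have "\<rho> x y / \<rho> x z \<le> s" using le \<rho>_pos[of x z] xz by (simp add: divide_le_eq)
      then have "\<eta> (\<rho> x y / \<rho> x z) \<le> \<eta> s"
        using mono[of "\<rho> x y / \<rho> x z" s] \<rho>(1) by (cases "\<rho> x y / \<rho> x z = s") auto
      then have "\<sigma> (F x) (F y) / \<sigma> (F x) (F z) \<le> gauge_of \<eta> s"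
        using ineq[of x y z] 3 xz g(1) by auto
      then show ?thesis using \<sigma>_pos[of "F x" "F z"] xz F_eq by (simp add: divide_le_eq)
    qed
  qed
  show "PROP ?B"
  proof -
    assume s: "s > 0" and le: "\<sigma> (F x) (F y) \<le> s * \<sigma> (F x) (F z)"
    define g where "g = gauge_of (\<lambda>r. 1 / \<theta> (1 / r)) s"
    have \<theta>s: "\<theta> (1 / s) > 0"
      using \<theta>[of "1 / s"] s homeomorphism_half_line(1)[OF \<eta>] by (cases "\<theta> (1 / s) = 0") auto
    have g: "g \<ge> 1 / \<theta> (1 / s)" "g \<ge> 0" using s \<theta>s by (auto simp: gauge_of_def g_def)
    consider "x = y" | "x \<noteq> y" "y = z" | "x \<noteq> y" "y \<noteq> z" by blast
    then have "\<rho> x y \<le> g * \<rho> x z"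
    proof cases
      case 1
      then have "\<rho> x y = 0" by (simp add: \<rho>(2))
      then show ?thesis using g(2) \<rho>(1) by simp
    next
      case 2
      then have "s \<ge> 1" using le \<sigma>_pos[of "F x" "F y"] F_eq by simp
      then have "g \<ge> 1" by (simp add: gauge_of_def g_def)
      then show ?thesis using 2 mult_right_mono[of 1 g "\<rho> x y"] \<rho>(1) by simp
    next
      case 3
      have \<sigma>xy: "\<sigma> (F x) (F y) > 0" using 3 \<sigma>_pos F_eq by simp
      have xz: "x \<noteq> z"
      proof
        assume "x = z"
        then have "\<sigma> (F x) (F z) = 0" by (simp add: \<sigma>(2))
        then show False using le \<sigma>xy by simp
      qed
      have pos: "\<rho> x y > 0" "\<rho> x z > 0" using 3 xz \<rho>_pos by auto
      \<comment> \<open>The inequality is used with \<open>y\<close> and \<open>z\<close> exchanged;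
        applying \<open>\<theta>\<close> and taking reciprocals yields the gauge of the
        inverse.\<close>
      have "1 / s \<le> \<sigma> (F x) (F z) / \<sigma> (F x) (F y)" using le s \<sigma>xy by (simp add: field_simps)
      also have "\<dots> \<le> \<eta> (\<rho> x z / \<rho> x y)" using 3 xz by (intro ineq) auto
      finally have "1 / s \<le> \<eta> (\<rho> x z / \<rho> x y)" .
      then have "\<theta> (1 / s) \<le> \<rho> x z / \<rho> x y"
        using mono[of "\<rho> x z / \<rho> x y" "\<theta> (1 / s)"] \<theta>(2)[of "1 / s"] s pos
        by (intro leI notI) auto
      then have "\<rho> x y \<le> 1 / \<theta> (1 / s) * \<rho> x z" using pos \<theta>s by (simp add: field_simps)
      also have "\<dots> \<le> g * \<rho> x z" using g(1) \<rho>(1) by (intro mult_right_mono)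
      finally show ?thesis .
    qed
    then show ?thesis by (simp add: g_def)
  qed
qed

text \<open>For the inverse gauge: \<open>\<eta>\<close> is increasing and finite at every
  \<open>M\<close>, so \<open>\<theta> (1 / r)\<close> exceeds \<open>M\<close> as soon as
  \<open>1 / r\<close> exceeds \<open>\<eta> M\<close>.\<close>

lemma homeomorphism_gauge:
  assumes \<eta>: "homeomorphism {0..} {0..} \<eta> \<theta>"
  shows "gauge_of \<eta> s \<ge> 0" "(gauge_of \<eta> \<longlongrightarrow> 0) (at_right 0)"
    "gauge_of (\<lambda>r. 1 / \<theta> (1 / r)) s \<ge> 0" "(gauge_of (\<lambda>r. 1 / \<theta> (1 / r)) \<longlongrightarrow> 0) (at_right 0)"
proof -
  note mono = homeomorphism_half_line(2)[OF \<eta>] and eta0 = homeomorphism_half_line(1)[OF \<eta>]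
  have \<theta>: "\<theta> r \<ge> 0" "\<eta> (\<theta> r) = r" if "r \<ge> 0" for r
    using \<eta> that by (auto simp: homeomorphism_def)
  have \<eta>_nonneg: "\<eta> r \<ge> 0" if "r \<ge> 0" for r
    using mono[of 0 r] eta0 that by (cases "r = 0") auto
  show "gauge_of \<eta> s \<ge> 0" using \<eta>_nonneg[of s] by (auto simp: gauge_of_def)
  show "gauge_of (\<lambda>r. 1 / \<theta> (1 / r)) s \<ge> 0" using \<theta>(1)[of "1 / s"] by (auto simp: gauge_of_def)
  have "continuous_on {0..} \<eta>" using \<eta> by (simp add: homeomorphism_def)
  then have "(\<eta> \<longlongrightarrow> \<eta> 0) (at 0 within {0..})" by (simp add: continuous_on_def)
  then have "(\<eta> \<longlongrightarrow> 0) (at_right 0)"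
    unfolding eta0 by (rule tendsto_within_subset) auto
  then show "(gauge_of \<eta> \<longlongrightarrow> 0) (at_right 0)" by (rule gauge_of_tendsto)
  have "((\<lambda>r. 1 / \<theta> (1 / r)) \<longlongrightarrow> 0) (at_right 0)"
  proof (rule tendstoI)
    fix e :: real assume e: "e > 0"
    define M where "M = 2 / e"
    have M: "M > 0" using e by (simp add: M_def)
    then have \<eta>M: "\<eta> M > 0" using mono[of 0 M] eta0 by simp
    have "dist (1 / \<theta> (1 / r)) 0 < e" if r: "0 < r" "r < 1 / \<eta> M" for r
    proof -
      have "\<eta> M < 1 / r" using r \<eta>M by (simp add: field_simps)
      then have "\<eta> M < \<eta> (\<theta> (1 / r))" using r \<theta>(2)[of "1 / r"] by simp
      then have "M \<le> \<theta> (1 / r)"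
        using mono[of "\<theta> (1 / r)" M] \<theta>(1)[of "1 / r"] r by (intro leI notI) auto
      then have "1 / \<theta> (1 / r) \<le> 1 / M" using M by (intro divide_left_mono) auto
      also have "\<dots> < e" using e by (simp add: M_def)
      finally show ?thesis using \<theta>(1)[of "1 / r"] r by simp
    qed
    then show "\<forall>\<^sub>F r in at_right 0. dist (1 / \<theta> (1 / r)) 0 < e"
      unfolding eventually_at_right_field using \<eta>M by (intro exI[of _ "1 / \<eta> M"]) auto
  qed
  then show "(gauge_of (\<lambda>r. 1 / \<theta> (1 / r)) \<longlongrightarrow> 0) (at_right 0)" by (rule gauge_of_tendsto)
qed

theorem theorem5p12:
  fixes A B :: "real^'n^'n"
    and gA gB :: "(real^'n) \<times> real \<Rightarrow> (real^'n) \<times> real \<Rightarrow> (real^'n) \<times> real \<Rightarrow> real"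
    and \<eta> :: "real \<Rightarrow> real"
    and \<epsilon> :: real
  assumes "\<And>c. eigenvalue (complex_mat A) c \<Longrightarrow> Re c > 0"
    and "\<And>c. eigenvalue (complex_mat B) c \<Longrightarrow> Re c > 0"
    and "admissible_metric A gA"
    and "admissible_metric B gB"
    and "\<epsilon> = min_eigenvalue_Re A / min_eigenvalue_Re B"
    and "\<nexists>c. real_part_jordan_form A = c \<cdot>\<^sub>m 1\<^sub>m CARD('n)"
  shows "\<exists>K\<ge>1. \<forall>F :: real^'n \<Rightarrow> real^'n.
    quasisymmetric \<eta> (visual_quasimetric A gA) (visual_quasimetric B gB) F \<longrightarrow>
    quasisimilarity K (\<lambda>x y. visual_quasimetric A gA x y powr \<epsilon>) (visual_quasimetric B gB) F"
proof (cases "\<exists>\<theta>. homeomorphism {0..} {0..} \<eta> \<theta>")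
  case False
  \<comment> \<open>If \<open>\<eta>\<close> is no homeomorphism, no map is
    \<open>\<eta>\<close>-quasisymmetric and \<open>K = 1\<close> serves vacuously.\<close>
  then show ?thesis by (intro exI[of _ 1]) (simp add: quasisymmetric_def)
next
  case True
  then obtain \<theta> where \<theta>: "homeomorphism {0..} {0..} \<eta> \<theta>" by blast
  define EA where "EA = (\<lambda>t (x :: real^'n). matrix_exp (t *\<^sub>R A) *v x)"
  define EB where "EB = (\<lambda>t (x :: real^'n). matrix_exp (t *\<^sub>R B) *v x)"
  define lA where "lA = min_eigenvalue_Re A"
  define lB where "lB = min_eigenvalue_Re B"
  obtain kA HA where flowA: "expanding_flow EA (metric_norm gA) lA kA HA"
    and HA: "HA = UNIV \<Longrightarrow> real_part_jordan_form A = min_eigenvalue_Re A \<cdot>\<^sub>m 1\<^sub>m CARD('n)"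
    unfolding EA_def lA_def
    by (rule expanding_flow_of_matrix[OF assms(1) metric_norm_equivalent[OF assms(3)]]) blast+
  obtain kB HB where flowB: "expanding_flow EB (metric_norm gB) lB kB HB"
    unfolding EB_def lB_def
    by (rule expanding_flow_of_matrix[OF assms(2) metric_norm_equivalent[OF assms(4)]]) blast+
  have HA_ne: "HA \<noteq> UNIV" using HA assms(6) by blast
  interpret A: expanding_flow EA "metric_norm gA" lA kA HA by (rule flowA)
  interpret B: expanding_flow EB "metric_norm gB" lB kB HB by (rule flowB)
  interpret two_flows EA "metric_norm gA" lA kA HA EB "metric_norm gB" lB kB HB ..
  have DA: "visual_quasimetric A gA x y = A.rho (x - y)" for x y
    unfolding visual_quasimetric_def slice_dist_def A.rho_def by (simp add: EA_def)
  have DB: "visual_quasimetric B gB x y = B.rho (x - y)" for x y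
    unfolding visual_quasimetric_def slice_dist_def B.rho_def by (simp add: EB_def)
  define h where "h = gauge_of \<eta>"
  define h' where "h' = gauge_of (\<lambda>r. 1 / \<theta> (1 / r))"
  \<comment> \<open>\<open>K\<close> is fixed before any \<open>F\<close> is considered; it depends
    on \<open>\<eta>\<close> through the gauges and on the matrices and metrics through the
    flows.\<close>
  obtain K where K: "K \<ge> 1"
    "\<And>F G. bicontrolled_map EA (metric_norm gA) lA kA HA EB (metric_norm gB) lB kB HB h F h' G \<Longrightarrow>
      \<exists>C>0. \<forall>x y. C / K * A.rho (x - y) powr (lA / lB) \<le> B.rho (F x - F y) \<and>
        B.rho (F x - F y) \<le> C * K * A.rho (x - y) powr (lA / lB)"
    by (rule controlled_imp_quasisimilar[OF HA_ne, of h h']) (rule that)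
  have "quasisimilarity K (\<lambda>x y. visual_quasimetric A gA x y powr \<epsilon>) (visual_quasimetric B gB) F"
    if F: "quasisymmetric \<eta> (visual_quasimetric A gA) (visual_quasimetric B gB) F" for F
  proof -
    have bij: "bij F" using F by (simp add: quasisymmetric_def)
    define G where "G = inv_into UNIV F"
    have inv_F: "G (F x) = x" "F (G y) = y" for x y
      using bij by (simp_all add: G_def bij_is_inj bij_is_surj surj_f_inv_f)
    note control = quasisymmetric_controlled[OF \<theta> F, unfolded DA DB]
    have c1: "controlled_map EA (metric_norm gA) lA kA HA EB (metric_norm gB) lB kB HB h F"
      using homeomorphism_gauge(1,2)[OF \<theta>] control(1) bij
      by unfold_locales (auto simp: h_def bij_is_inj)
    have c2: "controlled_map EB (metric_norm gB) lB kB HB EA (metric_norm gA) lA kA HA h' G"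
    proof unfold_locales
      show "inj G" using inv_F(2) by (metis injI)
      fix s u v w assume "0 < s" "B.rho (u - v) \<le> s * B.rho (u - w)"
      then show "A.rho (G u - G v) \<le> h' s * A.rho (G u - G w)"
        unfolding h'_def using control(2)[of s "G u" "G v" "G w"] by (simp add: inv_F)
    qed (use homeomorphism_gauge(3,4)[OF \<theta>] in \<open>auto simp: h'_def\<close>)
    have "bicontrolled_map EA (metric_norm gA) lA kA HA EB (metric_norm gB) lB kB HB h F h' G"
      by (intro bicontrolled_map.intro bicontrolled_map_axioms.intro c1 c2 inv_F)
    from K(2)[OF this] show ?thesis
      using K(1) bij by (simp add: quasisimilarity_def DA DB assms(5) lA_def lB_def)
  qed
  then show ?thesis using K(1) by blast
qed

end
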